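(* Let $q$ be a power of an odd prime $p$ and let $\ell$ be a positive integer such that $\gcd(p,\ell)=1$ and $2\gcd(\ell,q+1)$ divides $q+1$. Let $e:=\gcd(\ell(q-1),q^2-1)$ and $N:=q(e+1)$, the number of $\mathbb{F}_{q^2}$-rational points of the affine curve $C_{q,\ell}: y^q-y=x^\ell$, and let $g=(q-1)(\ell-1)/2$ be the genus of (the nonsingular projective model of) $C_{q,\ell}$. Let $m$ be a nonnegative integer with $2g-2<m<N$ and $$2(m+1)\le (q-1)(\ell-1)+q(e+1)-\mu\cdot qe,$$ where $\mu=0$ if $p$ divides $e+1$ and $\mu=1$ otherwise. Then there exists (obtained from the AG code $C(D,mP_\infty)$ over $\mathbb{F}_{q^2}$ of this curve) a quantum code with parameters $$[[N,\,N-2m+2g-2,\,\ge m-(q-1)(\ell-1)+2]]_{q^2}.$$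
   Context: The curve $C_{q,\ell}$ over $\mathbb{F}_{q^2}$ is smooth, geometrically irreducible and has exactly one place at infinity: the normalization of its projective closure in $\mathbb{P}^2$ is $C_{q,\ell}$ together with a single further $\mathbb{F}_{q^2}$-rational point $P_\infty$. $D=P_1+\cdots+P_N$ is the sum of all $\mathbb{F}_{q^2}$-rational points of the affine curve, and $C(D,mP_\infty)$ is the image of $\mathcal{L}(mP_\infty)$ (functions over $\mathbb{F}_{q^2}$) under $h\mapsto(h(P_1),\dots,h(P_N))$. For a prime power $Q$, an $[[N,K,\ge d]]_{Q}$ quantum code here is a stabilizer quantum code: a $Q^K$-dimensional subspace of $(\mathbb{C}^{Q})^{\otimes N}$ that is the joint $+1$-eigenspace of an abelian subgroup of the generalized Pauli (error) group, with minimum distance at least $d$. It is a standard known fact that a linear $[N,k]$ code $\mathcal C$ over $\mathbb{F}_Q$ with $\mathcal C\subseteq\mathcal C^\perp$ (Euclidean dual) yields an $[[N,N-2k,\ge d^\perp]]_Q$ stabilizer code, where $d^\perp$ is the minimum distance of $\mathcal C^\perp$. *)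

theory Defs
  imports
    Complex_Main
    "HOL-Library.FuncSet"
    "HOL-Library.Cardinality"
    "HOL-Library.Function_Algebras"
    "HOL-Computational_Algebra.Computational_Algebra"
    "Jordan_Normal_Form.Matrix"
begin

section \<open>Function fields of plane curves\<close>

text \<open>
  A bivariate polynomial over \<open>'a\<close> is an element of \<open>'a poly poly\<close>: the outer variable is \<open>Y\<close>,
  the coefficients are polynomials in \<open>X\<close>.
\<close>

definition eval2 :: "'a::comm_semiring_0 poly poly \<Rightarrow> 'a \<times> 'a \<Rightarrow> 'a" where
  "eval2 f = (\<lambda>(x, y). poly (poly f [:y:]) x)"

definition affine_points :: "'a::comm_semiring_0 poly poly \<Rightarrow> ('a \<times> 'a) set" where
  "affine_points f = {P. eval2 f P = 0}"

text \<open>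
  For \<open>f\<close> irreducible over \<open>k(X)\<close> and of positive degree in \<open>Y\<close>, the function field of \<open>f = 0\<close> is
  \<open>k(X)[Y]/(f)\<close>. Its elements are represented by their remainders modulo \<open>f\<close>.
\<close>

definition function_field :: "'a::field poly poly \<Rightarrow> 'a poly fract poly ring" where
  "function_field f =
    \<lparr>carrier = {h. h mod fract_poly f = h},
     monoid.mult = (\<lambda>g h. (g * h) mod fract_poly f),
     one = 1 mod fract_poly f,
     zero = 0,
     add = (+)\<rparr>"

definition constants :: "'a::field poly fract poly set" where
  "constants = range (\<lambda>c. [:to_fract [:c:]:])"

definition coord_x :: "'a::field poly poly \<Rightarrow> 'a poly fract poly" where
  "coord_x f = [:to_fract [:0, 1:]:] mod fract_poly f"

definition coord_y :: "'a::field poly poly \<Rightarrow> 'a poly fract poly" where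
  "coord_y f = [:0, 1:] mod fract_poly f"

text \<open>
  \<open>value_at f h P\<close> is meaningful when \<open>h\<close> is regular at the rational point \<open>P\<close>, i.e.\ \<open>h = a/b\<close> in
  the function field with \<open>a, b \<in> k[X,Y]\<close> and \<open>b(P) \<noteq> 0\<close>; at a nonsingular point this says that
  \<open>P\<close> is not a pole of \<open>h\<close>.
\<close>

definition value_at :: "'a::field poly poly \<Rightarrow> 'a poly fract poly \<Rightarrow> 'a \<times> 'a \<Rightarrow> 'a" where
  "value_at f h P =
    (THE c. \<exists>a b. eval2 b P \<noteq> 0 \<and> fract_poly f dvd fract_poly b * h - fract_poly a
                \<and> c = eval2 a P / eval2 b P)"


section \<open>Places and Riemann-Roch spaces\<close>

text \<open>
  A place of a function field \<open>K\<close> with constant field \<open>k\<close> is identified with its normalized discrete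
  valuation. The value at \<open>0\<close>, mathematically \<open>\<infinity>\<close>, is left out: valuations are extensional functions
  on the nonzero elements, so that each place is a unique HOL function.
\<close>

definition places :: "('b, 'c) ring_scheme \<Rightarrow> 'b set \<Rightarrow> ('b \<Rightarrow> int) set" where
  "places K k =
    {v \<in> extensional (carrier K - {\<zero>\<^bsub>K\<^esub>}).
       (\<forall>g \<in> carrier K - {\<zero>\<^bsub>K\<^esub>}. \<forall>h \<in> carrier K - {\<zero>\<^bsub>K\<^esub>}.
          v (g \<otimes>\<^bsub>K\<^esub> h) = v g + v h \<and>
          (g \<oplus>\<^bsub>K\<^esub> h \<noteq> \<zero>\<^bsub>K\<^esub> \<longrightarrow> min (v g) (v h) \<le> v (g \<oplus>\<^bsub>K\<^esub> h))) \<and>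
       (\<forall>c \<in> k - {\<zero>\<^bsub>K\<^esub>}. v c = 0) \<and>
       (\<exists>t \<in> carrier K - {\<zero>\<^bsub>K\<^esub>}. v t = 1)}"

text \<open>A divisor is given by its coefficient function on places.\<close>

definition riemann_roch_space ::
    "('b, 'c) ring_scheme \<Rightarrow> 'b set \<Rightarrow> (('b \<Rightarrow> int) \<Rightarrow> int) \<Rightarrow> 'b set" where
  "riemann_roch_space K k G =
    {h \<in> carrier K. h = \<zero>\<^bsub>K\<^esub> \<or> (\<forall>v \<in> places K k. v h + G v \<ge> 0)}"

text \<open>
  For a curve with exactly one place at infinity, this is that place: the only one
  at which \<open>x\<close> or \<open>y\<close> has a pole, i.e.\ that is not centred on the affine curve.
\<close>

definition place_at_infinity :: "'a::field poly poly \<Rightarrow> ('a poly fract poly \<Rightarrow> int)" where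
  "place_at_infinity f =
    (THE v. v \<in> places (function_field f) constants \<and>
       (coord_x f \<noteq> 0 \<and> v (coord_x f) < 0 \<or> coord_y f \<noteq> 0 \<and> v (coord_y f) < 0))"

text \<open>The one-point code \<open>C(D, m P\<^sub>\<infinity>)\<close>, where \<open>D = P 0 + \<dots> + P (N - 1)\<close>.\<close>

definition one_point_code ::
    "'a::field poly poly \<Rightarrow> nat \<Rightarrow> (nat \<Rightarrow> 'a \<times> 'a) \<Rightarrow> nat \<Rightarrow> 'a vec set" where
  "one_point_code f N P m =
    (\<lambda>h. vec N (\<lambda>i. value_at f h (P i))) `
      riemann_roch_space (function_field f) constants
        (\<lambda>v. if v = place_at_infinity f then int m else 0)"

text \<open>\<open>Y^q - Y - X^l\<close>\<close>

definition curve_poly :: "nat \<Rightarrow> nat \<Rightarrow> 'a::field poly poly" where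
  "curve_poly q l = monom 1 q - monom 1 1 - [:monom 1 l:]"


section \<open>Stabilizer codes\<close>

text \<open>
  The space \<open>(\<complex>\<^sup>Q)\<close> tensored \<open>N\<close> times has the basis \<open>|x\<rangle>\<close>, where \<open>x\<close> ranges over vectors of length
  \<open>N\<close> over the field with \<open>Q\<close> elements. A state is given by its coefficient function.
\<close>

type_synonym 'a state = "'a vec \<Rightarrow> complex"

definition state_space :: "nat \<Rightarrow> 'a state set" where
  "state_space N = {\<psi>. \<forall>x. x \<notin> carrier_vec N \<longrightarrow> \<psi> x = 0}"

definition state_inner :: "nat \<Rightarrow> 'a state \<Rightarrow> 'a state \<Rightarrow> complex" where
  "state_inner N \<phi> \<psi> = (\<Sum>x \<in> carrier_vec N. cnj (\<phi> x) * \<psi> x)"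

definition state_dim :: "'a state set \<Rightarrow> nat" where
  "state_dim V = vector_space.dim (\<lambda>(c::complex) \<psi> x. c * \<psi> x) V"

text \<open>The trace from the finite field \<open>'a\<close> to its prime field.\<close>

definition abs_trace :: "'a::{field,finite} \<Rightarrow> 'a" where
  "abs_trace x = (\<Sum>i < (THE n. CARD('a) = CHAR('a) ^ n). x ^ (CHAR('a) ^ i))"

text \<open>\<open>x \<mapsto> exp (2 \<pi> i tr(x) / p)\<close>, with the prime field identified with \<open>{0, \<dots>, p - 1}\<close>\<close>

definition add_char :: "'a::{field,finite} \<Rightarrow> complex" where
  "add_char x =
    cis (2 * pi * real (THE k. k < CHAR('a) \<and> of_nat k = abs_trace x) / real CHAR('a))"

text \<open>
  \<open>X(a)|x\<rangle> = |x + a\<rangle>\<close> and \<open>Z(b)|x\<rangle> = \<chi>(b \<bullet> x)|x\<rangle>\<close>, written on coefficient functions. All operators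
  yield \<open>0\<close> outside \<open>carrier_vec N\<close>, so composing them never leaves the state space.
\<close>

definition shift_op :: "nat \<Rightarrow> 'a::{field,finite} vec \<Rightarrow> 'a state \<Rightarrow> 'a state" where
  "shift_op N a \<psi> = (\<lambda>x. if x \<in> carrier_vec N then \<psi> (x - a) else 0)"

definition phase_op :: "nat \<Rightarrow> 'a::{field,finite} vec \<Rightarrow> 'a state \<Rightarrow> 'a state" where
  "phase_op N b \<psi> = (\<lambda>x. if x \<in> carrier_vec N then add_char (b \<bullet> x) * \<psi> x else 0)"

text \<open>\<open>\<omega>^c X(a) Z(b)\<close> with \<open>\<omega> = exp (2 \<pi> i / p)\<close>\<close>

definition pauli_op ::
    "nat \<Rightarrow> nat \<Rightarrow> 'a::{field,finite} vec \<Rightarrow> 'a vec \<Rightarrow> 'a state \<Rightarrow> 'a state" where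
  "pauli_op N c a b \<psi> =
    (\<lambda>x. cis (2 * pi * real c / real CHAR('a)) * shift_op N a (phase_op N b \<psi>) x)"

text \<open>The neutral element acts as the identity on \<open>state_space N\<close>.\<close>

definition pauli_group :: "nat \<Rightarrow> ('a::{field,finite} state \<Rightarrow> 'a state) monoid" where
  "pauli_group N =
    \<lparr>carrier = {pauli_op N c a b | c a b. a \<in> carrier_vec N \<and> b \<in> carrier_vec N},
     monoid.mult = (\<circ>),
     one = pauli_op N 0 (0\<^sub>v N) (0\<^sub>v N)\<rparr>"

definition joint_eigenspace :: "nat \<Rightarrow> ('a state \<Rightarrow> 'a state) set \<Rightarrow> 'a state set" where
  "joint_eigenspace N S = {\<psi> \<in> state_space N. \<forall>E \<in> S. E \<psi> = \<psi>}"

definition error_weight :: "nat \<Rightarrow> 'a::zero vec \<Rightarrow> 'a vec \<Rightarrow> nat" where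
  "error_weight N a b = card {i. i < N \<and> (a $ i \<noteq> 0 \<or> b $ i \<noteq> 0)}"

definition detects :: "nat \<Rightarrow> 'a state set \<Rightarrow> ('a state \<Rightarrow> 'a state) \<Rightarrow> bool" where
  "detects N V E \<longleftrightarrow>
    (\<exists>c. \<forall>\<phi> \<in> V. \<forall>\<psi> \<in> V. state_inner N \<phi> (E \<psi>) = c * state_inner N \<phi> \<psi>)"

text \<open>
  Minimum distance at least \<open>d\<close>: every error of weight less than \<open>d\<close> is detected. A one-dimensional
  code detects every error, so by the usual convention its distance is that of a pure code:
  nontrivial errors of weight less than \<open>d\<close> map it to an orthogonal space.
\<close>

definition min_distance_ge :: "nat \<Rightarrow> 'a::{field,finite} state set \<Rightarrow> nat \<Rightarrow> bool" where
  "min_distance_ge N V d \<longleftrightarrow>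
    (\<forall>a \<in> carrier_vec N. \<forall>b \<in> carrier_vec N. error_weight N a b < d \<longrightarrow>
       detects N V (pauli_op N 0 a b) \<and>
       (state_dim V = 1 \<and> 0 < error_weight N a b \<longrightarrow>
          (\<forall>\<phi> \<in> V. \<forall>\<psi> \<in> V. state_inner N \<phi> (pauli_op N 0 a b \<psi>) = 0)))"

text \<open>\<open>V\<close> is an \<open>[[N, K, \<ge> d]]\<^sub>Q\<close> stabilizer code, where \<open>Q = CARD('a)\<close>.\<close>

definition stabilizer_code ::
    "nat \<Rightarrow> nat \<Rightarrow> nat \<Rightarrow> 'a::{field,finite} state set \<Rightarrow> bool" where
  "stabilizer_code N K d V \<longleftrightarrow>
    (\<exists>S. subgroup S (pauli_group N) \<and> (\<forall>A \<in> S. \<forall>B \<in> S. A \<circ> B = B \<circ> A) \<and>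
         V = joint_eigenspace N S) \<and>
    state_dim V = CARD('a) ^ K \<and>
    min_distance_ge N V d"

text \<open>
  The quantum code obtained from a Euclidean self-orthogonal code \<open>C\<close> of length \<open>N\<close>: its stabilizer
  consists of all \<open>X(a)Z(b)\<close> with \<open>a, b \<in> C\<close>.
\<close>

definition quantum_code_of :: "nat \<Rightarrow> 'a::{field,finite} vec set \<Rightarrow> 'a state set" where
  "quantum_code_of N C = joint_eigenspace N {pauli_op N 0 a b | a b. a \<in> C \<and> b \<in> C}"

end

theory Submission
  imports Defs "HOL-Algebra.Algebraic_Closure_Type" "Jordan_Normal_Form.Char_Poly" "HOL-Number_Theory.Residues"
begin

text \<open>
  Let \<open>k\<close> be the field with \<open>q\<^sup>2\<close> elements. The proof makes the code \<open>C(D, m P\<^sub>\<infinity>)\<close> completely explicit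
  and then argues with monomials \<open>x^i y^j\<close>, to which the weight \<open>q i + l j\<close> is attached.

  \<^item> The functions. Both \<open>x\<close> and \<open>y\<close> have a pole at infinity, of orders \<open>q\<close> and \<open>l\<close>. As \<open>q\<close> and \<open>l\<close> are coprime,
    the terms of \<open>h = \<Sum> r\<^sub>j(x) y^j\<close>, \<open>j < q\<close>, have pairwise different pole orders, so that the pole order of
    \<open>h\<close> is the largest weight of its terms (\<open>w_eq_weight\<close>). This single computation shows that the
    curve is irreducible and that there is only one place at infinity. Places are obtained from
    embeddings of the function field into Laurent series: at infinity \<open>y = t^-l\<close> and \<open>x = t^-q u\<close> with
    \<open>u^l = 1 - t^(l (q - 1))\<close>; at a point \<open>(x\<^sub>0, y\<^sub>0)\<close> over the algebraic closure \<open>x = x\<^sub>0 + t\<close>, and \<open>y\<close> is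
    \<open>y\<^sub>0\<close> plus the solution of \<open>\<delta>^q - \<delta> = x^l - x\<^sub>0^l\<close> without constant term. If some \<open>r\<^sub>j\<close> is not a polynomial, it has a pole
    at some \<open>x\<^sub>0\<close>; above \<open>x\<^sub>0\<close> there are \<open>q\<close> points, more than the degree of \<open>h\<close> in \<open>y\<close>, so the polar
    parts cannot cancel at all of them (\<open>affine_pole\<close>). Hence \<open>L(m P\<^sub>\<infinity>)\<close> is the span of the
    monomials with \<open>j < q\<close> of weight at most \<open>m\<close> (\<open>riemann_roch_space_eq\<close>).

  \<^item> The code. The rational points lie over \<open>0\<close> and the roots of \<open>x^e = -1\<close>, with \<open>q\<close> points over each.
    A function of weight less than \<open>N\<close> vanishing at all of them is \<open>0\<close>, and the semigroup of weights has
    \<open>g\<close> gaps, so the dimension is \<open>m + 1 - g\<close>. Sums over the points of products of two functions are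
    power sums over fibres and over the roots of \<open>x^e = -1\<close>; only exponents \<open>j = q - 1\<close> contribute, and the upper bound on
    \<open>m\<close> makes the contributions vanish (\<open>self_orthogonality\<close>). The distance of the dual code is
    bounded by the order bound of Feng and Rao (\<open>order_bound\<close>), which here equals the Goppa bound since
    every weight has at most \<open>2 g\<close> splittings spoiled by gaps.

  \<^item> The quantum code. For a self-orthogonal code \<open>C\<close>, a state fixed by all \<open>X(a) Z(b)\<close> with \<open>a, b \<in> C\<close>
    is a function supported on the dual code and constant on the cosets of \<open>C\<close>. This gives the dimension, and an
    error \<open>X(a) Z(b)\<close> with \<open>a\<close> or \<open>b\<close> outside of the dual code maps such functions to orthogonal ones.
\<close>

(* polynomials are elements of 'a poly, and $ selects entries of vectors *)
hide_const (open) Polynomials.degree Divisibility.prime UnivPoly.up_ring.monom UnivPoly.up_ring.coeff Module.module.smult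
no_notation fps_nth (infixl "$" 75)

section \<open>Finite fields and their additive character\<close>

lemma degree_diff_eq_left:
  "degree q < degree p \<Longrightarrow> degree (p - q) = degree p"
  for p q :: "'a::comm_ring_1 poly"
  by (metis degree_add_eq_left degree_minus diff_conv_add_uminus)

lemma finite_field_power_card_minus_1:
  fixes x :: "'a::{field,finite}"
  assumes "x \<noteq> 0"
  shows "x ^ (CARD('a) - 1) = 1"
proof -
  let ?U = "UNIV - {0::'a}"
  have "prod id ?U = (\<Prod>y\<in>?U. x * y)"
    by (rule prod.reindex_bij_witness[where i = "\<lambda>y. x * y" and j = "\<lambda>y. y / x"]) (use assms in auto)
  also have "\<dots> = x ^ (CARD('a) - 1) * prod id ?U"
    by (simp add: prod.distrib card_Diff_singleton)
  finally show ?thesis by simp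
qed

lemma finite_field_power_card:
  fixes x :: "'a::{field,finite}"
  shows "x ^ CARD('a) = x"
proof (cases "x = 0")
  case False
  have "x ^ (CARD('a) - 1) * x = x ^ CARD('a)" by (rule power_minus_mult) simp
  then show ?thesis using finite_field_power_card_minus_1[OF False] by simp
qed (simp add: power_0_left)

lemma prime_CHAR_finite_field: "prime CHAR('a::{field,finite})"
  by (rule prime_CHAR_semidom) (simp add: finite_imp_CHAR_pos)

lemma card_power_roots_le:
  fixes c :: "'a::idom"
  assumes "n > 0"
  shows "finite {x. x ^ n = c} \<and> card {x. x ^ n = c} \<le> n"
proof -
  define P where "P = monom (1::'a) n - [:c:]"
  have deg: "degree P = n"
    unfolding P_def using assms
    by (simp add: degree_diff_eq_left degree_monom_eq)
  have "P \<noteq> 0" using deg assms by auto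
  moreover have "{x. x ^ n = c} = {x. poly P x = 0}"
    by (auto simp: P_def poly_monom)
  ultimately show ?thesis
    using poly_roots_finite[of P] card_poly_roots_bound[of P] deg by simp
qed

lemma abs_trace_conv_sum:
  assumes "CARD('a::{field,finite}) = CHAR('a) ^ n"
  shows "abs_trace (x::'a) = (\<Sum>i<n. x ^ (CHAR('a) ^ i))"
proof -
  have "CHAR('a) > 1"
    using prime_CHAR_finite_field[where 'a='a] prime_gt_1_nat by blast
  then have "(THE n. CARD('a) = CHAR('a) ^ n) = n"
    using assms by (auto intro!: the_equality simp: power_inject_exp)
  then show ?thesis
    by (simp add: abs_trace_def)
qed

lemma abs_trace_add:
  "abs_trace (x + y) = abs_trace x + abs_trace (y::'a::{field,finite})"
  unfolding abs_trace_def
  by (simp add: freshmans_dream'[OF prime_CHAR_finite_field refl] sum.distrib)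

text \<open>
  The Frobenius map shifts the summands of the trace cyclically, since \<open>x^(p^n) = x\<close>. Hence
  the trace lies in the prime field, the set of roots of \<open>X^p - X\<close>.
\<close>

lemma abs_trace_power_CHAR:
  assumes "CARD('a::{field,finite}) = CHAR('a) ^ n"
  shows "abs_trace (x::'a) ^ CHAR('a) = abs_trace x"
proof -
  let ?p = "CHAR('a)"
  have "abs_trace x ^ ?p = (\<Sum>i<n. x ^ (?p ^ Suc i))"
    unfolding abs_trace_conv_sum[OF assms]
    by (simp add: freshmans_dream_sum[OF prime_CHAR_finite_field] power_mult [symmetric] mult.commute)
  also have "\<dots> + x ^ (?p ^ 0) = (\<Sum>i<Suc n. x ^ (?p ^ i))"
    by (subst sum.lessThan_Suc_shift) (simp add: add.commute)
  also have "\<dots> = abs_trace x + x ^ (?p ^ n)"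
    unfolding abs_trace_conv_sum[OF assms] by simp
  also have "x ^ (?p ^ n) = x"
    using finite_field_power_card[of x] assms by simp
  finally show ?thesis by simp
qed

lemma prime_field_element:
  fixes z :: "'a::{field,finite}"
  assumes "z ^ CHAR('a) = z"
  shows "\<exists>!k. k < CHAR('a) \<and> of_nat k = z"
proof -
  let ?p = "CHAR('a)"
  have p: "prime ?p" by (rule prime_CHAR_finite_field)
  then have p1: "?p > 1" by (rule prime_gt_1_nat)
  have inj: "inj_on (of_nat :: nat \<Rightarrow> 'a) {..<?p}"
    by (auto simp: inj_on_def of_nat_eq_iff_cong_CHAR cong_def)
  define P where "P = monom (1::'a) ?p - [:0, 1:]"
  have deg: "degree P = ?p"
    unfolding P_def using p1
    by (subst degree_diff_eq_left) (auto simp: degree_monom_eq)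
  have "P \<noteq> 0" using deg p1 by auto
  have sub: "of_nat ` {..<?p} \<subseteq> {x. poly P x = 0}"
  proof
    fix z :: 'a assume "z \<in> of_nat ` {..<?p}"
    then obtain j where z: "z = of_nat j" by blast
    have "(of_nat j :: 'a) ^ ?p = of_nat j"
      by (induction j) (simp_all add: freshmans_dream[OF p refl] power_0_left finite_imp_CHAR_pos)
    then show "z \<in> {x. poly P x = 0}" by (simp add: P_def poly_monom z)
  qed
  have "card (of_nat ` {..<?p} :: 'a set) = ?p"
    using card_image[OF inj] by simp
  moreover have "card {x. poly P x = 0} \<le> ?p"
    using card_poly_roots_bound[OF \<open>P \<noteq> 0\<close>] deg by simp
  ultimately have "of_nat ` {..<?p} = {x. poly P x = 0}"
    using sub poly_roots_finite[OF \<open>P \<noteq> 0\<close>] by (metis card_seteq)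
  moreover have "poly P z = 0"
    using assms by (simp add: P_def poly_monom)
  ultimately obtain k where "k < ?p" "of_nat k = z" by (metis (mono_tags, lifting) imageE lessThan_iff mem_Collect_eq)
  then show ?thesis
    using inj by (auto simp: inj_on_def)
qed

lemma cis_eq_of_cong:
  assumes "[k = k'] (mod p)" and "p > 0"
  shows "cis (2 * pi * real k / real p) = cis (2 * pi * real k' / real p)"
proof -
  have red: "cis (2 * pi * real k / real p) = cis (2 * pi * real (k mod p) / real p)" for k
  proof -
    have "real k = real p * real (k div p) + real (k mod p)"
      by (metis mult_div_mod_eq of_nat_add of_nat_mult)
    then have "2 * pi * real k / real p = 2 * pi * real (k div p) + 2 * pi * real (k mod p) / real p"
      using \<open>p > 0\<close> by (simp add: field_simps)
    moreover have "cis (2 * pi * real (k div p)) = 1"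
      using cis_multiple_2pi[of "real (k div p)"] by simp
    ultimately show ?thesis by (simp add: cis_mult [symmetric])
  qed
  show ?thesis
    using assms red[of k] red[of k'] by (simp add: cong_def)
qed

lemma add_char_conv_cis:
  assumes "CARD('a::{field,finite}) = CHAR('a) ^ n"
  shows "\<exists>k. of_nat k = abs_trace x \<and> k < CHAR('a) \<and>
    add_char (x::'a) = cis (2 * pi * real k / real CHAR('a))"
  using theI'[OF prime_field_element[OF abs_trace_power_CHAR[OF assms, of x]]]
  by (auto simp: add_char_def)

lemma add_char_add:
  assumes "CARD('a::{field,finite}) = CHAR('a) ^ n"
  shows "add_char (x + y :: 'a) = add_char x * add_char y"
proof -
  let ?p = "CHAR('a)"
  have p0: "?p > 0" by (simp add: finite_imp_CHAR_pos)
  obtain i where i: "of_nat i = abs_trace x" "add_char x = cis (2 * pi * real i / real ?p)"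
    using add_char_conv_cis[OF assms] by blast
  obtain j where j: "of_nat j = abs_trace y" "add_char y = cis (2 * pi * real j / real ?p)"
    using add_char_conv_cis[OF assms] by blast
  obtain k where k: "of_nat k = abs_trace (x + y)" "add_char (x + y) = cis (2 * pi * real k / real ?p)"
    using add_char_conv_cis[OF assms] by blast
  have "(of_nat k :: 'a) = of_nat (i + j)"
    using i j k by (simp add: abs_trace_add)
  then have "[k = i + j] (mod ?p)"
    by (simp only: of_nat_eq_iff_cong_CHAR)
  then have "add_char (x + y) = cis (2 * pi * real (i + j) / real ?p)"
    using k(2) cis_eq_of_cong[OF _ p0] by simp
  also have "2 * pi * real (i + j) / real ?p = 2 * pi * real i / real ?p + 2 * pi * real j / real ?p"
    by (simp add: add_divide_distrib distrib_left)
  finally show ?thesis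
    using i(2) j(2) by (simp only: cis_mult)
qed

lemma add_char_0:
  assumes "CARD('a::{field,finite}) = CHAR('a) ^ n"
  shows "add_char (0::'a) = 1"
proof -
  have "add_char (0::'a) = add_char (0::'a) * add_char (0::'a)"
    using add_char_add[OF assms, of 0 0] by (simp only: add_0_left)
  moreover have "add_char (0::'a) \<noteq> 0" by (simp add: add_char_def)
  ultimately show ?thesis by (metis mult_cancel_left2)
qed

text \<open>
  The trace is a polynomial of degree \<open>p^(n - 1)\<close>, so it cannot vanish on all
  \<open>p^n\<close> elements.
\<close>

lemma add_char_nontrivial:
  assumes "CARD('a::{field,finite}) = CHAR('a) ^ n"
  shows "\<exists>x::'a. add_char x \<noteq> 1"
proof -
  let ?p = "CHAR('a)"
  have p1: "?p > 1"
    using prime_CHAR_finite_field[where 'a='a] prime_gt_1_nat by blast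
  have "CARD('a) \<noteq> 1"
    by (metis UNIV_I card_1_singletonE singletonD zero_neq_one)
  then obtain n' where n: "n = Suc n'"
    using assms by (cases n) auto
  define P :: "'a poly" where "P = (\<Sum>i<n. monom 1 (?p ^ i))"
  have coeff: "coeff P (?p ^ n') = 1"
    unfolding P_def coeff_sum coeff_monom
    using p1 n by (subst sum.cong[OF refl, of _ _ "\<lambda>i. if i = n' then 1 else 0"])
      (auto simp: power_inject_exp)
  then have "P \<noteq> 0" by auto
  have "degree P \<le> ?p ^ n'"
    unfolding P_def using p1 n
    by (intro degree_sum_le) (auto intro!: order.trans[OF degree_monom_le] power_increasing)
  then have "card {x. poly P x = 0} \<le> ?p ^ n'"
    using card_poly_roots_bound[OF \<open>P \<noteq> 0\<close>] by simp
  also have "\<dots> < CARD('a)" using assms n p1 by simp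
  finally obtain x where "poly P x \<noteq> 0" by fastforce
  then have tr: "abs_trace x \<noteq> 0"
    by (simp add: abs_trace_conv_sum[OF assms] P_def poly_sum poly_monom)
  obtain k where k: "of_nat k = abs_trace x" "k < ?p" "add_char x = cis (2 * pi * real k / real ?p)"
    using add_char_conv_cis[OF assms] by blast
  have "k > 0" using tr k(1) by (cases k) auto
  have "add_char x \<noteq> 1"
  proof
    assume "add_char x = 1"
    then have "cos (2 * pi * real k / real ?p) = 1"
      using k(3) by (metis cis.simps(1) one_complex.simps(1))
    then obtain m :: int where "2 * pi * real k / real ?p = real_of_int m * 2 * pi"
      using cos_one_2pi_int by auto
    then have "2 * pi * (real k / real ?p) = 2 * pi * real_of_int m"
      by (metis mult.commute mult.assoc times_divide_eq_right)
    then have "real k / real ?p = real_of_int m"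
      by (simp only: mult_cancel_left) simp
    then have "real_of_int m > 0" "real_of_int m < 1"
      using \<open>k > 0\<close> k(2) by (auto simp flip: \<open>real k / real ?p = real_of_int m\<close> simp: divide_simps)
    then show False by simp
  qed
  then show ?thesis by blast
qed

lemma add_char_scale_nontrivial:
  assumes "CARD('a::{field,finite}) = CHAR('a) ^ n" and "z \<noteq> (0::'a)"
  shows "\<exists>s. add_char (s * z) \<noteq> 1"
proof -
  obtain x :: 'a where "add_char x \<noteq> 1" using add_char_nontrivial[OF assms(1)] by blast
  then show ?thesis using assms(2) by (intro exI[of _ "x / z"]) simp
qed

section \<open>Self-orthogonal codes give stabilizer codes\<close>

lemma bij_betw_vec_PiE:
  "bij_betw (\<lambda>v. restrict (\<lambda>i. v $ i) {..<N}) (carrier_vec N :: 'a vec set) ({..<N} \<rightarrow>\<^sub>E UNIV)"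
proof (rule bij_betw_byWitness[where f' = "\<lambda>h. vec N h"])
  show "\<forall>v\<in>carrier_vec N :: 'a vec set. vec N (restrict (\<lambda>i. v $ i) {..<N}) = v"
    by (auto intro!: eq_vecI)
  show "\<forall>h\<in>{..<N} \<rightarrow>\<^sub>E (UNIV :: 'a set). restrict (\<lambda>i. vec N h $ i) {..<N} = h"
    by (simp add: PiE_def extensional_def fun_eq_iff)
  show "(\<lambda>v. restrict (\<lambda>i. v $ i) {..<N}) ` carrier_vec N \<subseteq> {..<N} \<rightarrow>\<^sub>E (UNIV :: 'a set)"
    by (rule image_subsetI) (simp only: restrict_PiE, simp)
  show "vec N ` ({..<N} \<rightarrow>\<^sub>E (UNIV :: 'a set)) \<subseteq> carrier_vec N"
    by (rule image_subsetI) simp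
qed

lemma finite_carrier_vec: "finite (carrier_vec N :: 'a::finite vec set)"
  using bij_betw_finite[OF bij_betw_vec_PiE[where 'a='a and N=N]] by (simp add: finite_PiE)

lemma card_carrier_vec: "card (carrier_vec N :: 'a::finite vec set) = CARD('a) ^ N"
  using bij_betw_same_card[OF bij_betw_vec_PiE[where 'a='a and N=N]] by (simp add: card_PiE)

definition dual_code :: "nat \<Rightarrow> 'a::comm_semiring_0 vec set \<Rightarrow> 'a vec set" where
  "dual_code N C = {x \<in> carrier_vec N. \<forall>b \<in> C. b \<bullet> x = 0}"

text \<open>
  The permutation \<open>t\<close> of the summands multiplies the sum by \<open>c\<close>.
\<close>

lemma sum_eq_0_by_translation:
  fixes \<phi> :: "'b \<Rightarrow> complex"
  assumes "bij_betw t H H" and "\<And>x. x \<in> H \<Longrightarrow> \<phi> (t x) = c * \<phi> x" and "c \<noteq> 1"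
  shows "sum \<phi> H = 0"
proof -
  have "sum \<phi> H = (\<Sum>x\<in>H. \<phi> (t x))"
    by (rule sum.reindex_bij_betw[OF assms(1), symmetric])
  also have "\<dots> = c * sum \<phi> H"
    using assms(2) by (simp add: sum_distrib_left)
  finally show ?thesis using assms(3) by simp
qed

locale linear_code =
  fixes N :: nat and C :: "'a::{field,finite} vec set"
  assumes carrier: "C \<subseteq> carrier_vec N"
    and zero_mem: "0\<^sub>v N \<in> C"
    and add_mem: "\<And>a b. a \<in> C \<Longrightarrow> b \<in> C \<Longrightarrow> a + b \<in> C"
    and smult_mem: "\<And>s a. a \<in> C \<Longrightarrow> s \<cdot>\<^sub>v a \<in> C"
begin

lemma uminus_mem:
  assumes "a \<in> C"
  shows "- a \<in> C"
proof -
  have "- a = (- 1) \<cdot>\<^sub>v a" by (intro eq_vecI) auto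
  then show ?thesis using smult_mem[OF assms] by metis
qed

lemma finite_code: "finite C"
  using carrier finite_carrier_vec finite_subset by blast

lemma bij_betw_translation:
  assumes a: "a \<in> C" and H: "H \<subseteq> carrier_vec N" and closed: "\<And>x c. x \<in> H \<Longrightarrow> c \<in> C \<Longrightarrow> x + c \<in> H"
  shows "bij_betw (\<lambda>x. x + a) H H"
proof (rule bij_betw_byWitness[where f' = "\<lambda>x. x + (- a)"])
  have a': "a \<in> carrier_vec N" using a carrier by auto
  show "\<forall>x\<in>H. x + a + - a = x" "\<forall>x\<in>H. x + - a + a = x"
    using H a' by (auto intro!: eq_vecI)
  show "(\<lambda>x. x + a) ` H \<subseteq> H" "(\<lambda>x. x + - a) ` H \<subseteq> H"
    using closed a uminus_mem by auto
qed

text \<open>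
  Double counting: the sum of \<open>\<chi>(b \<bullet> x)\<close> over \<open>b \<in> C\<close> detects
  \<open>x\<close> in the dual code, the sum over all vectors \<open>x\<close> detects \<open>b =
  0\<close>. Both sums vanish otherwise, because some translation changes the character; for the first
  sum this uses that \<open>C\<close> is closed under scalars.
\<close>

lemma card_dual_code:
  assumes CARD: "CARD('a) = CHAR('a) ^ n"
  shows "card (dual_code N C) * card C = CARD('a) ^ N"
proof -
  let ?A = "carrier_vec N :: 'a vec set"
  have fin: "finite ?A" by (rule finite_carrier_vec)
  have inner: "(\<Sum>b\<in>C. add_char (b \<bullet> x)) = (if x \<in> dual_code N C then of_nat (card C) else 0)"
    if x: "x \<in> ?A" for x
  proof (cases "x \<in> dual_code N C")
    case True
    then show ?thesis by (simp add: dual_code_def add_char_0[OF CARD])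
  next
    case False
    then obtain b where b: "b \<in> C" "b \<bullet> x \<noteq> 0" using x by (auto simp: dual_code_def)
    obtain s where s: "add_char (s * (b \<bullet> x)) \<noteq> 1"
      using add_char_scale_nontrivial[OF CARD b(2)] by blast
    have sb: "s \<cdot>\<^sub>v b \<in> C" by (rule smult_mem[OF b(1)])
    have "(\<Sum>b\<in>C. add_char (b \<bullet> x)) = 0"
    proof (rule sum_eq_0_by_translation[OF bij_betw_translation[OF sb carrier add_mem] _ s])
      fix c assume c: "c \<in> C"
      have "(c + s \<cdot>\<^sub>v b) \<bullet> x = c \<bullet> x + s * (b \<bullet> x)"
        using c b(1) carrier x sb
        by (subst add_scalar_prod_distrib[of _ N]) (auto intro!: smult_scalar_prod_distrib)
      then show "add_char ((c + s \<cdot>\<^sub>v b) \<bullet> x) = add_char (s * (b \<bullet> x)) * add_char (c \<bullet> x)"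
        by (simp add: add_char_add[OF CARD])
    qed
    then show ?thesis using False by simp
  qed
  have outer: "(\<Sum>x\<in>?A. add_char (b \<bullet> x)) = (if b = 0\<^sub>v N then of_nat (CARD('a) ^ N) else 0)"
    if b: "b \<in> C" for b
  proof (cases "b = 0\<^sub>v N")
    case True
    then show ?thesis
      by (simp add: add_char_0[OF CARD] card_carrier_vec)
  next
    case False
    have bc: "b \<in> ?A" using b carrier by auto
    then obtain i where i: "i < N" "b $ i \<noteq> 0"
      using False by (metis carrier_vecD eq_vecI index_zero_vec(1) index_zero_vec(2))
    obtain s where s: "add_char (s * b $ i) \<noteq> 1"
      using add_char_scale_nontrivial[OF CARD i(2)] by blast
    define h where "h = s \<cdot>\<^sub>v unit_vec N i"
    have h: "h \<in> ?A" by (simp add: h_def)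
    have bh: "b \<bullet> h = s * b $ i"
      using bc i by (simp add: h_def scalar_prod_right_unit)
    interpret full: linear_code N ?A by standard auto
    have "(\<Sum>x\<in>?A. add_char (b \<bullet> x)) = 0"
    proof (rule sum_eq_0_by_translation[OF full.bij_betw_translation[OF h subset_refl full.add_mem] _ s])
      fix x assume x: "x \<in> ?A"
      show "add_char (b \<bullet> (x + h)) = add_char (s * b $ i) * add_char (b \<bullet> x)"
        using scalar_prod_add_distrib[OF bc x h] bh by (simp add: add_char_add[OF CARD])
    qed
    then show ?thesis using False by simp
  qed
  have "of_nat (card (dual_code N C) * card C) = (\<Sum>x\<in>?A. if x \<in> dual_code N C then of_nat (card C) else (0::complex))"
    using fin by (subst sum.If_cases) (auto simp: dual_code_def Int_def)
  also have "\<dots> = (\<Sum>x\<in>?A. \<Sum>b\<in>C. add_char (b \<bullet> x))"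
    using inner by simp
  also have "\<dots> = (\<Sum>b\<in>C. \<Sum>x\<in>?A. add_char (b \<bullet> x))" by (rule sum.swap)
  also have "\<dots> = (\<Sum>b\<in>C. if b = 0\<^sub>v N then of_nat (CARD('a) ^ N) else 0)"
    using outer by simp
  also have "\<dots> = of_nat (CARD('a) ^ N)"
    using zero_mem finite_code by simp
  finally show ?thesis by (simp only: of_nat_eq_iff)
qed

lemma dual_code_add:
  assumes "x \<in> dual_code N C" "y \<in> dual_code N C"
  shows "x + y \<in> dual_code N C"
proof -
  have "b \<bullet> (x + y) = 0" if "b \<in> C" for b
    using that assms carrier scalar_prod_add_distrib[of b N x y] by (auto simp: dual_code_def)
  then show ?thesis using assms by (auto simp: dual_code_def)
qed

end

locale self_orthogonal_code = linear_code +
  assumes orth: "\<And>a b. a \<in> C \<Longrightarrow> b \<in> C \<Longrightarrow> a \<bullet> b = 0"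
begin

lemma code_subset_dual: "C \<subseteq> dual_code N C"
  using carrier orth by (auto simp: dual_code_def)

definition stab :: "('a state \<Rightarrow> 'a state) set" where
  "stab = {pauli_op N 0 a b | a b. a \<in> C \<and> b \<in> C}"

lemma pauli_op_apply:
  "pauli_op N c (a :: 'a vec) b \<psi> x = (if x \<in> carrier_vec N \<and> x - a \<in> carrier_vec N
     then cis (2 * pi * real c / real CHAR('a)) * (add_char (b \<bullet> (x - a)) * \<psi> (x - a)) else 0)"
  by (simp add: pauli_op_def shift_op_def phase_op_def)

context
  fixes n assumes CARD: "CARD('a) = CHAR('a) ^ n"
begin

text \<open>
  In general the product carries the phase \<open>\<chi>(b \<bullet> a')\<close>, which is trivial for a
  self-orthogonal code.
\<close>

lemma pauli_op_comp:
  assumes ab: "a \<in> C" "b \<in> C" and ab': "a' \<in> C" "b' \<in> C"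
  shows "pauli_op N 0 a b \<circ> pauli_op N 0 a' b' = pauli_op N 0 (a + a') (b + b')"
proof (intro ext)
  fix \<psi> :: "'a state" and x
  have car: "a \<in> carrier_vec N" "b \<in> carrier_vec N" "a' \<in> carrier_vec N" "b' \<in> carrier_vec N"
    using assms carrier by auto
  show "(pauli_op N 0 a b \<circ> pauli_op N 0 a' b') \<psi> x = pauli_op N 0 (a + a') (b + b') \<psi> x"
  proof (cases "x \<in> carrier_vec N")
    case True
    define y where "y = x - a - a'"
    have y: "y \<in> carrier_vec N" using True car by (simp add: y_def)
    have xa: "x - a \<in> carrier_vec N" "x - a = y + a'" "x - (a + a') = y"
      using True car by (auto simp: y_def intro!: eq_vecI)
    have "b \<bullet> (y + a') = b \<bullet> y"
      using scalar_prod_add_distrib[of b N y a'] car y orth[OF ab(2) ab'(1)] by simp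
    moreover have "(b + b') \<bullet> y = b \<bullet> y + b' \<bullet> y"
      using add_scalar_prod_distrib[of b N b' y] car y by simp
    moreover have "y + a' - a' = y"
      using y car by (auto intro!: eq_vecI)
    ultimately show ?thesis
      using True y car by (simp add: pauli_op_apply xa(2,3) add_char_add[OF CARD])
  qed (simp add: pauli_op_apply)
qed

lemma pauli_op_comp_identity:
  assumes "(a :: 'a vec) \<in> carrier_vec N"
  shows "pauli_op N c a b \<circ> pauli_op N 0 (0\<^sub>v N) (0\<^sub>v N) = pauli_op N c a b"
    and "pauli_op N 0 (0\<^sub>v N) (0\<^sub>v N) \<circ> pauli_op N c a b = pauli_op N c a b"
  using assms by (auto simp: fun_eq_iff pauli_op_apply add_char_0[OF CARD])

text \<open>
  Inverses in the Pauli group are given by a definite description, so uniqueness of inverses has to be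
  checked among all Pauli operators.
\<close>

lemma subgroup_stab: "subgroup stab (pauli_group N)"
proof
  let ?I = "pauli_op N 0 (0\<^sub>v N) (0\<^sub>v N) :: 'a state \<Rightarrow> 'a state"
  show sub: "stab \<subseteq> carrier (pauli_group N)"
    using carrier by (auto simp: stab_def pauli_group_def)
  show "A \<otimes>\<^bsub>pauli_group N\<^esub> B \<in> stab" if AB: "A \<in> stab" "B \<in> stab" for A B
  proof -
    obtain a b a' b' where *: "a \<in> C" "b \<in> C" "a' \<in> C" "b' \<in> C" "A = pauli_op N 0 a b" "B = pauli_op N 0 a' b'"
      using AB unfolding stab_def by blast
    then show ?thesis
      using pauli_op_comp[of a b a' b'] add_mem unfolding stab_def pauli_group_def by auto
  qed
  show "\<one>\<^bsub>pauli_group N\<^esub> \<in> stab"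
    using zero_mem by (auto simp: stab_def pauli_group_def)
  show "inv\<^bsub>pauli_group N\<^esub> A \<in> stab" if A: "A \<in> stab" for A
  proof -
    obtain a b where ab: "a \<in> C" "b \<in> C" "A = pauli_op N 0 a b" using A unfolding stab_def by blast
    define B where "B = (pauli_op N 0 (- a) (- b) :: 'a state \<Rightarrow> 'a state)"
    have m: "- a \<in> C" "- b \<in> C" using ab uminus_mem by auto
    have ca: "a \<in> carrier_vec N" "b \<in> carrier_vec N" using ab carrier by auto
    have AB: "A \<circ> B = ?I" "B \<circ> A = ?I"
      using pauli_op_comp[OF ab(1,2) m] pauli_op_comp[OF m ab(1,2)] ca
      by (simp_all add: ab(3) B_def)
    have B: "B \<in> stab" using m unfolding B_def stab_def by blast
    have "inv\<^bsub>pauli_group N\<^esub> A = B"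
      unfolding m_inv_def
    proof (rule the_equality)
      show "B \<in> carrier (pauli_group N) \<and> A \<otimes>\<^bsub>pauli_group N\<^esub> B = \<one>\<^bsub>pauli_group N\<^esub> \<and>
        B \<otimes>\<^bsub>pauli_group N\<^esub> A = \<one>\<^bsub>pauli_group N\<^esub>"
        using AB B sub by (auto simp: pauli_group_def)
    next
      fix Y assume Y: "Y \<in> carrier (pauli_group N) \<and> A \<otimes>\<^bsub>pauli_group N\<^esub> Y = \<one>\<^bsub>pauli_group N\<^esub> \<and>
        Y \<otimes>\<^bsub>pauli_group N\<^esub> A = \<one>\<^bsub>pauli_group N\<^esub>"
      then obtain c a' b' where Y': "Y = pauli_op N c a' b'" "a' \<in> carrier_vec N"
        unfolding pauli_group_def by auto
      have YA: "Y \<circ> A = ?I" using Y by (simp add: pauli_group_def)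
      have "Y = Y \<circ> (A \<circ> B)"
        using pauli_op_comp_identity(1)[OF Y'(2)] by (simp only: AB Y')
      also have "\<dots> = ?I \<circ> B" by (simp only: YA comp_assoc [symmetric])
      also have "\<dots> = B"
        unfolding B_def by (rule pauli_op_comp_identity(2)) (use ca in simp)
      finally show "Y = B" .
    qed
    then show ?thesis using B by simp
  qed
qed

lemma stab_commute:
  assumes "A \<in> stab" "B \<in> stab"
  shows "A \<circ> B = B \<circ> A"
proof -
  obtain a b a' b' where *: "a \<in> C" "b \<in> C" "a' \<in> C" "b' \<in> C" "A = pauli_op N 0 a b" "B = pauli_op N 0 a' b'"
    using assms unfolding stab_def by blast
  moreover have "a + a' = a' + a" "b + b' = b' + b"
    using * carrier comm_add_vec by blast+
  ultimately show ?thesis by (simp add: pauli_op_comp)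
qed

text \<open>
  Invariance under the phase operators \<open>Z(b)\<close> restricts the support to the dual code,
  invariance under the shifts \<open>X(a)\<close> means constancy on the cosets of \<open>C\<close>.
\<close>

lemma quantum_code_eq:
  "quantum_code_of N C = {\<psi> \<in> state_space N. (\<forall>x. \<psi> x \<noteq> 0 \<longrightarrow> x \<in> dual_code N C) \<and>
     (\<forall>x \<in> carrier_vec N. \<forall>a \<in> C. \<psi> (x + a) = \<psi> x)}" (is "_ = ?R")
proof (intro equalityI subsetI)
  fix \<psi> assume "\<psi> \<in> quantum_code_of N C"
  then have st: "\<psi> \<in> state_space N" and fixed: "\<And>a b. a \<in> C \<Longrightarrow> b \<in> C \<Longrightarrow> pauli_op N 0 a b \<psi> = \<psi>"
    unfolding quantum_code_of_def joint_eigenspace_def by auto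
  have "x \<in> dual_code N C" if nz: "\<psi> x \<noteq> 0" for x
  proof (rule ccontr)
    assume nd: "x \<notin> dual_code N C"
    have x: "x \<in> carrier_vec N" using st nz by (auto simp: state_space_def)
    then obtain b where b: "b \<in> C" "b \<bullet> x \<noteq> 0" using nd by (auto simp: dual_code_def)
    obtain s where s: "add_char (s * (b \<bullet> x)) \<noteq> 1"
      using add_char_scale_nontrivial[OF CARD b(2)] by blast
    have "pauli_op N 0 (0\<^sub>v N) (s \<cdot>\<^sub>v b) \<psi> x = \<psi> x"
      using fixed[OF zero_mem smult_mem[OF b(1)]] by simp
    moreover have "x - 0\<^sub>v N = x" using x by auto
    moreover have "(s \<cdot>\<^sub>v b) \<bullet> x = s * (b \<bullet> x)"
      using b(1) carrier x by (auto intro!: smult_scalar_prod_distrib)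
    ultimately show False using nz s x by (simp add: pauli_op_apply)
  qed
  moreover have "\<psi> (x + a) = \<psi> x" if x: "x \<in> carrier_vec N" and a: "a \<in> C" for x a
  proof -
    have a': "a \<in> carrier_vec N" using a carrier by auto
    have "pauli_op N 0 a (0\<^sub>v N) \<psi> (x + a) = \<psi> (x + a)"
      using fixed[OF a zero_mem] by simp
    moreover have "x + a - a = x" using x a' by (auto intro!: eq_vecI)
    ultimately show ?thesis using x a' by (simp add: pauli_op_apply add_char_0[OF CARD])
  qed
  ultimately show "\<psi> \<in> ?R" using st by blast
next
  fix \<psi> assume "\<psi> \<in> ?R"
  then have st: "\<psi> \<in> state_space N" and supp: "\<And>x. \<psi> x \<noteq> 0 \<Longrightarrow> x \<in> dual_code N C"
    and inv: "\<And>x a. x \<in> carrier_vec N \<Longrightarrow> a \<in> C \<Longrightarrow> \<psi> (x + a) = \<psi> x" by auto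
  have "pauli_op N 0 a b \<psi> = \<psi>" if ab: "a \<in> C" "b \<in> C" for a b
  proof
    fix x
    have ca: "a \<in> carrier_vec N" using ab carrier by auto
    show "pauli_op N 0 a b \<psi> x = \<psi> x"
    proof (cases "x \<in> carrier_vec N")
      case True
      have "x - a + a = x" using True ca by (auto intro!: eq_vecI)
      then have eq: "\<psi> (x - a) = \<psi> x"
        using inv[of "x - a" a] True ca ab by simp
      have "add_char (b \<bullet> (x - a)) = 1" if "\<psi> (x - a) \<noteq> 0"
        using supp[OF that] ab by (simp add: dual_code_def add_char_0[OF CARD])
      then show ?thesis using True ca eq by (cases "\<psi> x = 0") (auto simp: pauli_op_apply)
    next
      case False
      then show ?thesis using st by (simp add: pauli_op_apply state_space_def)
    qed
  qed
  then show "\<psi> \<in> quantum_code_of N C"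
    using st unfolding quantum_code_of_def joint_eigenspace_def by auto
qed

definition coset_state :: "'a vec \<Rightarrow> 'a state" where
  "coset_state x = (\<lambda>y. if \<exists>a \<in> C. y = x + a then 1 else 0)"

lemma coset_state_eq_iff:
  assumes "x \<in> carrier_vec N" "y \<in> carrier_vec N"
  shows "coset_state x = coset_state y \<longleftrightarrow> (\<exists>a \<in> C. y = x + a)"
proof
  assume eq: "coset_state x = coset_state y"
  have "\<exists>a\<in>C. y = y + a" using assms(2) by (intro bexI[of _ "0\<^sub>v N"] zero_mem) simp
  then have "coset_state y y = 1" by (simp add: coset_state_def)
  then have "coset_state x y = 1" using eq by simp
  then show "\<exists>a \<in> C. y = x + a" by (metis coset_state_def zero_neq_one)
next
  assume "\<exists>a \<in> C. y = x + a"
  then obtain a where a: "a \<in> C" "y = x + a" by blast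
  have ca: "a \<in> carrier_vec N" using a carrier by auto
  have "(\<exists>b\<in>C. z = x + b) \<longleftrightarrow> (\<exists>b\<in>C. z = y + b)" for z
  proof
    assume "\<exists>b\<in>C. z = x + b"
    then obtain b where b: "b \<in> C" "z = x + b" by blast
    have "b \<in> carrier_vec N" using b carrier by auto
    then have "z = y + (b + (- a))" using a b ca assms by (auto intro!: eq_vecI)
    then show "\<exists>b\<in>C. z = y + b" using add_mem[OF b(1) uminus_mem[OF a(1)]] by blast
  next
    assume "\<exists>b\<in>C. z = y + b"
    then obtain b where b: "b \<in> C" "z = y + b" by blast
    have "b \<in> carrier_vec N" using b carrier by auto
    then have "z = x + (a + b)" using a b ca assms by (auto intro!: eq_vecI)
    then show "\<exists>b\<in>C. z = x + b" using add_mem[OF a(1) b(1)] by blast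
  qed
  then show "coset_state x = coset_state y" by (simp add: coset_state_def)
qed

text \<open>
  The indicator functions of the cosets of \<open>C\<close> in the dual code form a basis.
\<close>

lemma state_dim_quantum_code:
  "state_dim (quantum_code_of N C) * card C = card (dual_code N C)"
proof -
  interpret vs: vector_space "\<lambda>(c::complex) (\<psi> :: 'a state) x. c * \<psi> x"
    by standard (auto simp: fun_eq_iff algebra_simps)
  let ?D = "dual_code N C" and ?V = "quantum_code_of N C"
  have Dcar: "?D \<subseteq> carrier_vec N" by (auto simp: dual_code_def)
  have finD: "finite ?D" using Dcar finite_carrier_vec finite_subset by blast
  define B where "B = coset_state ` ?D"
  have finB: "finite B" using finD by (simp add: B_def)
  have val: "coset_state x y = (if coset_state x = coset_state y then 1 else 0)"
    if "x \<in> ?D" "y \<in> ?D" for x y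
  proof -
    have "coset_state x = coset_state y \<longleftrightarrow> (\<exists>a \<in> C. y = x + a)"
      using that Dcar by (intro coset_state_eq_iff) auto
    then show ?thesis by (simp only: coset_state_def)
  qed
  have outside: "coset_state x y = 0" if "x \<in> ?D" "y \<notin> ?D" for x y
  proof -
    have "\<not> (\<exists>a \<in> C. y = x + a)" using that dual_code_add code_subset_dual by blast
    then show ?thesis by (simp add: coset_state_def)
  qed
  have at: "(\<Sum>b\<in>B. u b * b y) = u (coset_state y)" if y: "y \<in> ?D" for u y
  proof -
    have "(\<Sum>b\<in>B. u b * b y) = (\<Sum>b\<in>B. if b = coset_state y then u b else 0)"
      by (rule sum.cong[OF refl]) (use val y in \<open>auto simp: B_def\<close>)
    then show ?thesis using finB y by (simp add: B_def)
  qed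
  have sumfun: "(\<Sum>b\<in>B. (\<lambda>x. u b * b x)) y = (\<Sum>b\<in>B. u b * b y)" for u y
    by (induction B rule: infinite_finite_induct) auto
  have "vs.dim ?V = card B"
  proof (rule vs.dim_unique)
    show "B \<subseteq> ?V"
    proof
      fix b assume "b \<in> B"
      then obtain x where x: "x \<in> ?D" "b = coset_state x" by (auto simp: B_def)
      have xc: "x \<in> carrier_vec N" using x Dcar by auto
      have "b (y + a) = b y" if "y \<in> carrier_vec N" "a \<in> C" for y a
      proof -
        have ya: "y + a \<in> carrier_vec N" using that carrier by auto
        have "coset_state y = coset_state (y + a)"
          using that ya coset_state_eq_iff by blast
        then have "(\<exists>c\<in>C. y = x + c) \<longleftrightarrow> (\<exists>c\<in>C. y + a = x + c)"
          using coset_state_eq_iff[OF xc that(1)] coset_state_eq_iff[OF xc ya] by simp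
        then show ?thesis by (simp add: x coset_state_def)
      qed
      moreover have "y \<in> ?D" if "b y \<noteq> 0" for y using outside x that by blast
      moreover have "b \<in> state_space N"
        using calculation(2) Dcar unfolding state_space_def by blast
      ultimately show "b \<in> ?V" unfolding quantum_code_eq by blast
    qed
    show "?V \<subseteq> vs.span B"
    proof
      fix \<psi> assume V: "\<psi> \<in> ?V"
      define u where "u b = \<psi> (SOME x. x \<in> ?D \<and> coset_state x = b)" for b
      have "\<psi> = (\<Sum>b\<in>B. (\<lambda>x. u b * b x))"
      proof
        fix y
        show "\<psi> y = (\<Sum>b\<in>B. (\<lambda>x. u b * b x)) y"
        proof (cases "y \<in> ?D")
          case True
          define z where "z = (SOME x. x \<in> ?D \<and> coset_state x = coset_state y)"
          have z: "z \<in> ?D \<and> coset_state z = coset_state y"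
            unfolding z_def by (rule someI[of _ y]) (use True in simp)
          then obtain a where "a \<in> C" "y = z + a"
            using coset_state_eq_iff[of z y] True Dcar by blast
          then have "\<psi> y = \<psi> z" using V z Dcar unfolding quantum_code_eq by auto
          then show ?thesis
            by (simp add: sumfun at[OF True] u_def z_def)
        next
          case False
          then have "\<psi> y = 0" using V unfolding quantum_code_eq by blast
          moreover have "(\<Sum>b\<in>B. u b * b y) = 0"
            by (rule sum.neutral) (use outside False in \<open>auto simp: B_def\<close>)
          ultimately show ?thesis by (simp add: sumfun)
        qed
      qed
      moreover have "(\<Sum>b\<in>B. (\<lambda>x. u b * b x)) \<in> vs.span B"
        by (rule vs.span_sum) (use vs.span_scale[OF vs.span_base] in blast)
      ultimately show "\<psi> \<in> vs.span B" by (simp only:)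
    qed
    show "vs.independent B"
    proof (rule vs.independent_if_scalars_zero[OF finB])
      fix u b assume z: "(\<Sum>b\<in>B. (\<lambda>x. u b * b x)) = 0" and "b \<in> B"
      then obtain x where x: "x \<in> ?D" "b = coset_state x" by (auto simp: B_def)
      have "(\<Sum>b\<in>B. (\<lambda>x. u b * b x)) x = 0" by (simp add: z)
      then show "u b = 0" by (simp add: sumfun at[OF x(1)] x(2))
    qed
  qed simp
  then have dim: "state_dim ?V = card B" by (simp add: state_dim_def)
  have fibre: "card {x \<in> ?D. coset_state x = b} = card C" if "b \<in> B" for b
  proof -
    obtain x where x: "x \<in> ?D" "b = coset_state x" using \<open>b \<in> B\<close> by (auto simp: B_def)
    have xc: "x \<in> carrier_vec N" using x Dcar by auto
    have "{y \<in> ?D. coset_state y = b} = (\<lambda>a. x + a) ` C"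
    proof (intro equalityI subsetI)
      fix y assume "y \<in> {y \<in> ?D. coset_state y = b}"
      then have "y \<in> ?D" "coset_state x = coset_state y" using x by auto
      then show "y \<in> (\<lambda>a. x + a) ` C"
        using coset_state_eq_iff[of x y] xc Dcar by blast
    next
      fix y assume "y \<in> (\<lambda>a. x + a) ` C"
      then obtain a where a: "a \<in> C" "y = x + a" by blast
      then have yD: "y \<in> ?D" using dual_code_add x code_subset_dual by blast
      then have "coset_state x = coset_state y"
        using coset_state_eq_iff[of x y] xc Dcar a by blast
      then show "y \<in> {y \<in> ?D. coset_state y = b}" using x yD by simp
    qed
    moreover have "inj_on (\<lambda>a. x + a) C"
    proof (rule inj_onI)
      fix a a' assume aa: "a \<in> C" "a' \<in> C" "x + a = x + a'"
      then have car: "a \<in> carrier_vec N" "a' \<in> carrier_vec N" using carrier by auto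
      show "a = a'"
      proof (rule eq_vecI)
        fix i assume "i < dim_vec a'"
        then have "(x + a) $ i = x $ i + a $ i" "(x + a') $ i = x $ i + a' $ i"
          using car by auto
        then show "a $ i = a' $ i" using aa(3) by simp
      qed (use car in auto)
    qed
    ultimately show ?thesis by (simp add: card_image)
  qed
  have "card ?D = (\<Sum>x\<in>?D. 1)" by simp
  also have "\<dots> = (\<Sum>b\<in>B. \<Sum>x\<in>{x \<in> ?D. coset_state x = b}. 1)"
    unfolding B_def by (rule sum.image_gen[OF finD])
  also have "\<dots> = card B * card C" using fibre by simp
  finally show ?thesis by (simp add: dim)
qed

text \<open>
  A shift by \<open>a\<close> outside of the dual code makes the supports disjoint. For \<open>b\<close>
  outside of the dual code, translation by a codeword changes the inner product by a nontrivial phase.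
\<close>

lemma inner_pauli_eq_0:
  assumes ab: "a \<in> carrier_vec N" "b \<in> carrier_vec N"
    and out: "a \<notin> dual_code N C \<or> b \<notin> dual_code N C"
    and \<phi>: "\<phi> \<in> quantum_code_of N C" and \<psi>: "\<psi> \<in> quantum_code_of N C"
  shows "state_inner N \<phi> (pauli_op N 0 a b \<psi>) = 0"
proof (cases "a \<in> dual_code N C")
  case False
  have zero: "\<phi> x = 0 \<or> \<psi> (x - a) = 0" if x: "x \<in> carrier_vec N" for x
  proof (rule ccontr)
    assume "\<not> (\<phi> x = 0 \<or> \<psi> (x - a) = 0)"
    then have d: "x \<in> dual_code N C" "x - a \<in> dual_code N C"
      using \<phi> \<psi> unfolding quantum_code_eq by blast+
    have "c \<bullet> a = 0" if c: "c \<in> C" for c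
    proof -
      have cc: "c \<in> carrier_vec N" using c carrier by auto
      have "a + (x - a) = x" using ab x by (auto intro!: eq_vecI)
      then have "c \<bullet> x = c \<bullet> a + c \<bullet> (x - a)"
        using scalar_prod_add_distrib[of c N a "x - a"] cc ab x by simp
      then show ?thesis using d c by (simp add: dual_code_def)
    qed
    then show False using False ab by (simp add: dual_code_def)
  qed
  show ?thesis
    unfolding state_inner_def
    by (rule sum.neutral) (use zero ab in \<open>auto simp: pauli_op_apply\<close>)
next
  case True
  then have "b \<notin> dual_code N C" using out by simp
  then obtain c where c: "c \<in> C" "c \<bullet> b \<noteq> 0" using ab by (auto simp: dual_code_def)
  have cc: "c \<in> carrier_vec N" using c carrier by auto
  have "b \<bullet> c \<noteq> 0" using c comm_scalar_prod[OF cc ab(2)] by simp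
  then obtain s where s: "add_char (s * (b \<bullet> c)) \<noteq> 1"
    using add_char_scale_nontrivial[OF CARD] by blast
  define h where "h = s \<cdot>\<^sub>v c"
  have h: "h \<in> C" by (simp add: h_def smult_mem c)
  have hc: "h \<in> carrier_vec N" using h carrier by auto
  have bh: "b \<bullet> h = s * (b \<bullet> c)" using ab cc by (simp add: h_def)
  interpret full: linear_code N "carrier_vec N :: 'a vec set" by standard auto
  show ?thesis
    unfolding state_inner_def
  proof (rule sum_eq_0_by_translation[OF full.bij_betw_translation[OF hc subset_refl full.add_mem] _ s])
    fix x :: "'a vec" assume x: "x \<in> carrier_vec N"
    have xh: "x + h - a = (x - a) + h" using x hc ab by (auto intro!: eq_vecI)
    have "b \<bullet> (x - a + h) = b \<bullet> (x - a) + s * (b \<bullet> c)"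
      using scalar_prod_add_distrib[of b N "x - a" h] x hc ab bh by simp
    moreover have "\<phi> (x + h) = \<phi> x" using \<phi> x h unfolding quantum_code_eq by blast
    moreover have "\<psi> (x - a + h) = \<psi> (x - a)"
      using \<psi> h minus_carrier_vec[OF x ab(1)] unfolding quantum_code_eq by blast
    ultimately show "cnj (\<phi> (x + h)) * pauli_op N 0 a b \<psi> (x + h) =
        add_char (s * (b \<bullet> c)) * (cnj (\<phi> x) * pauli_op N 0 a b \<psi> x)"
      using x hc ab by (simp add: pauli_op_apply xh add_char_add[OF CARD])
  qed
qed

text \<open>
  An undetected error \<open>X(a) Z(b)\<close> would have both \<open>a\<close> and \<open>b\<close> in
  the dual code; below the distance of the dual code this leaves only the identity.
\<close>

theorem stabilizer_code_of_self_orthogonal: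
  assumes card: "card C = CARD('a) ^ k"
    and dist: "\<And>x. x \<in> dual_code N C \<Longrightarrow> x \<noteq> 0\<^sub>v N \<Longrightarrow> d \<le> card {i. i < N \<and> x $ i \<noteq> 0}"
  shows "2 * k \<le> N" and "stabilizer_code N (N - 2 * k) d (quantum_code_of N C)"
proof -
  let ?V = "quantum_code_of N C" and ?Q = "CARD('a)"
  have Q1: "?Q > 1"
    using card_mono[of UNIV "{0::'a, 1}"] by simp
  have "?Q ^ k * ?Q ^ k \<le> card (dual_code N C) * card C"
    using card_mono[OF _ code_subset_dual] card finite_carrier_vec
    by (intro mult_mono) (auto simp: dual_code_def intro: finite_subset[of _ "carrier_vec N"])
  then have "?Q ^ (2 * k) \<le> ?Q ^ N"
    using card_dual_code[OF CARD] by (simp add: mult_2 power_add)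
  then show k: "2 * k \<le> N" using Q1 by (simp add: power_increasing_iff)
  have "state_dim ?V * card C * card C = ?Q ^ N"
    using state_dim_quantum_code card_dual_code[OF CARD] by simp
  then have "state_dim ?V * ?Q ^ (2 * k) = ?Q ^ N"
    by (simp only: card mult_2 power_add mult.assoc)
  also have "?Q ^ N = ?Q ^ (N - 2 * k) * ?Q ^ (2 * k)"
    by (subst power_add [symmetric]) (simp only: le_add_diff_inverse2[OF k])
  finally have dim: "state_dim ?V = ?Q ^ (N - 2 * k)" by simp
  have dual0: "x = 0\<^sub>v N" if "x \<in> dual_code N C" "card {i. i < N \<and> x $ i \<noteq> 0} < d" for x
    using dist[OF that(1)] that(2) by linarith
  have "min_distance_ge N ?V d"
    unfolding min_distance_ge_def
  proof (intro ballI impI)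
    fix a b :: "'a vec"
    assume ab: "a \<in> carrier_vec N" "b \<in> carrier_vec N" and w: "error_weight N a b < d"
    show "detects N ?V (pauli_op N 0 a b) \<and> (state_dim ?V = 1 \<and> 0 < error_weight N a b \<longrightarrow>
      (\<forall>\<phi>\<in>?V. \<forall>\<psi>\<in>?V. state_inner N \<phi> (pauli_op N 0 a b \<psi>) = 0))"
    proof (cases "a \<in> dual_code N C \<and> b \<in> dual_code N C")
      case True
      have "card {i. i < N \<and> a $ i \<noteq> 0} \<le> error_weight N a b"
        "card {i. i < N \<and> b $ i \<noteq> 0} \<le> error_weight N a b"
        unfolding error_weight_def by (auto intro!: card_mono)
      then have 0: "a = 0\<^sub>v N" "b = 0\<^sub>v N" using dual0[of a] dual0[of b] True w by linarith+
      have "pauli_op N 0 a b \<psi> = \<psi>" if "\<psi> \<in> ?V" for \<psi>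
        using that zero_mem 0 unfolding quantum_code_of_def joint_eigenspace_def by blast
      then have "detects N ?V (pauli_op N 0 a b)"
        unfolding detects_def by (intro exI[of _ 1]) simp
      moreover have "error_weight N a b = 0" by (simp add: 0 error_weight_def)
      ultimately show ?thesis by simp
    next
      case False
      then have "\<forall>\<phi>\<in>?V. \<forall>\<psi>\<in>?V. state_inner N \<phi> (pauli_op N 0 a b \<psi>) = 0"
        using inner_pauli_eq_0[OF ab] by blast
      then show ?thesis unfolding detects_def by (auto intro!: exI[of _ 0])
    qed
  qed
  moreover have "?V = joint_eigenspace N stab"
    by (simp add: quantum_code_of_def stab_def)
  ultimately show "stabilizer_code N (N - 2 * k) d ?V"
    unfolding stabilizer_code_def using dim subgroup_stab stab_commute by blast
qed

end

end

section \<open>The numerical semigroup generated by two coprime numbers\<close>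

definition weights :: "nat \<Rightarrow> nat \<Rightarrow> nat set" where
  "weights q l = {q * i + l * j | i j. True}"

locale coprime_pair =
  fixes q l :: nat
  assumes coprime: "coprime q l" and q_pos: "q > 0" and l_pos: "l > 0"
begin

lemma weight_unique:
  fixes i i' :: int
  assumes "int q * i + int l * int j = int q * i' + int l * int j'" and "j < q" "j' < q"
  shows "j = j'" and "i = i'"
proof -
  have eq: "int q * (i - i') = int l * (int j' - int j)" using assms(1) by (simp add: algebra_simps)
  then have "int q dvd int l * (int j' - int j)" by (metis dvd_triv_left)
  then have "int q dvd int j' - int j"
    using coprime coprime_dvd_mult_right_iff[of "int q" "int l"] by simp
  then have "int j' - int j = 0"
    using assms(2,3) dvd_imp_le_int[of "int j' - int j" "int q"] by linarith
  then show "j = j'" by simp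
  then show "i = i'" using assms(1) q_pos by simp
qed

text \<open>
  Invert \<open>l\<close> modulo \<open>q\<close> to find \<open>j\<close>.
\<close>

lemma weight_representation: "\<exists>i j. j < q \<and> int n = int q * i + int l * int j"
proof -
  have "coprime (int l) (int q)" using coprime by (simp add: coprime_commute)
  then obtain k where "[int l * k = 1] (mod int q)" using cong_solve_coprime_int by blast
  then have c: "[int l * (k * int n) = int n] (mod int q)"
    using cong_scalar_right[of "int l * k" 1 "int q" "int n"] by (simp add: mult.assoc)
  define j where "j = nat ((k * int n) mod int q)"
  have j: "int j = (k * int n) mod int q" using q_pos by (simp add: j_def)
  then have "j < q" using q_pos by (metis of_nat_0_less_iff of_nat_less_iff pos_mod_bound)
  have "[int l * int j = int n] (mod int q)"
    using c cong_scalar_left[of "k * int n" "int j" "int q" "int l"]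
    by (metis cong_def j mod_mult_right_eq)
  then have "int q dvd int n - int l * int j"
    by (metis cong_iff_dvd_diff cong_sym)
  then obtain i where "int n - int l * int j = int q * i" by blast
  then show ?thesis using \<open>j < q\<close> by (intro exI[of _ i] exI[of _ j]) simp
qed

lemma weights_iff:
  assumes "int n = int q * i + int l * int j" and "j < q"
  shows "n \<in> weights q l \<longleftrightarrow> i \<ge> 0"
proof
  assume "n \<in> weights q l"
  then obtain i' j' where n: "n = q * i' + l * j'" by (auto simp: weights_def)
  have "l * j' = q * (l * (j' div q)) + l * (j' mod q)"
    by (metis add_mult_distrib2 mult.left_commute mult_div_mod_eq)
  then have "int n = int q * int (i' + l * (j' div q)) + int l * int (j' mod q)"
    by (simp add: n algebra_simps flip: of_nat_mult of_nat_add)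
  then have "i = int (i' + l * (j' div q))"
    using weight_unique[of i j _ "j' mod q"] assms q_pos by simp
  then show "i \<ge> 0" by simp
next
  assume "i \<ge> 0"
  then have "int n = int (q * nat i + l * j)" using assms(1) by simp
  then have "n = q * nat i + l * j" by (simp only: of_nat_eq_iff)
  then show "n \<in> weights q l" by (auto simp: weights_def)
qed

text \<open>
  Replacing \<open>(i, j)\<close> by \<open>(-1 - i, q - 1 - j)\<close> exchanges weights and gaps below
  \<open>(q - 1) (l - 1)\<close>.
\<close>

lemma weight_symmetry:
  assumes "n < (q - 1) * (l - 1)"
  shows "n \<in> weights q l \<longleftrightarrow> (q - 1) * (l - 1) - 1 - n \<notin> weights q l"
proof -
  obtain i j where ij: "j < q" "int n = int q * i + int l * int j" using weight_representation by blast
  have "int ((q - 1) * (l - 1) - 1 - n) = (int q - 1) * (int l - 1) - 1 - int n"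
    using assms q_pos l_pos by (simp add: of_nat_diff)
  also have "\<dots> = int q * (- 1 - i) + int l * int (q - 1 - j)"
    using ij by (simp add: of_nat_diff algebra_simps)
  finally have "(q - 1) * (l - 1) - 1 - n \<in> weights q l \<longleftrightarrow> - 1 - i \<ge> 0"
    by (rule weights_iff) (use q_pos in simp)
  then show ?thesis using weights_iff[OF ij(2,1)] by auto
qed

lemma large_weights:
  assumes "(q - 1) * (l - 1) \<le> n"
  shows "n \<in> weights q l"
proof -
  obtain i j where ij: "j < q" "int n = int q * i + int l * int j" using weight_representation by blast
  have "int ((q - 1) * (l - 1)) = (int q - 1) * (int l - 1)"
    using q_pos l_pos by (simp add: of_nat_diff)
  then have n: "(int q - 1) * (int l - 1) \<le> int q * i + int l * int j" using assms ij(2) by linarith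
  have "i \<ge> 0"
  proof (rule ccontr)
    assume "\<not> i \<ge> 0"
    then have "int q * i \<le> int q * (- 1)" by (intro mult_left_mono) auto
    moreover have "int l * int j \<le> int l * (int q - 1)" using ij(1) by (intro mult_left_mono) auto
    ultimately show False using n by (simp add: algebra_simps)
  qed
  then show ?thesis using weights_iff[OF ij(2,1)] by simp
qed

definition gaps :: "nat set" where
  "gaps = {n. n \<notin> weights q l}"

lemma gaps_less: "n \<in> gaps \<Longrightarrow> n < (q - 1) * (l - 1)"
  unfolding gaps_def using large_weights[of n] not_le by blast

lemma finite_gaps: "finite gaps"
  using gaps_less by (auto intro: finite_subset[of _ "{..<(q - 1) * (l - 1)}"])

lemma card_gaps: "2 * card gaps = (q - 1) * (l - 1)"
proof -
  let ?c = "(q - 1) * (l - 1)"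
  have "bij_betw (\<lambda>n. ?c - 1 - n) gaps ({..<?c} - gaps)"
  proof (rule bij_betw_byWitness[where f' = "\<lambda>n. ?c - 1 - n"])
    show "(\<lambda>n. ?c - 1 - n) ` gaps \<subseteq> {..<?c} - gaps"
    proof
      fix k assume "k \<in> (\<lambda>n. ?c - 1 - n) ` gaps"
      then obtain n where n: "n \<in> gaps" "k = ?c - 1 - n" by blast
      then have "k < ?c" using gaps_less[OF n(1)] by linarith
      then show "k \<in> {..<?c} - gaps"
        using gaps_less[OF n(1)] weight_symmetry[of n] n by (simp add: gaps_def)
    qed
    show "(\<lambda>n. ?c - 1 - n) ` ({..<?c} - gaps) \<subseteq> gaps"
    proof
      fix k assume "k \<in> (\<lambda>n. ?c - 1 - n) ` ({..<?c} - gaps)"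
      then obtain n where n: "n < ?c" "n \<notin> gaps" "k = ?c - 1 - n" by blast
      then show "k \<in> gaps"
        using weight_symmetry[of n] by (simp add: gaps_def)
    qed
    show "\<forall>n\<in>gaps. ?c - 1 - (?c - 1 - n) = n"
      using gaps_less by fastforce
  qed auto
  then have "card gaps = card ({..<?c} - gaps)" by (rule bij_betw_same_card)
  also have "\<dots> = ?c - card gaps"
    using gaps_less finite_gaps by (subst card_Diff_subset) auto
  finally have "card gaps = ?c - card gaps" .
  moreover have "card gaps \<le> ?c"
    using card_mono[of "{..<?c}" gaps] gaps_less by auto
  ultimately show ?thesis by simp
qed

lemma card_weights_le:
  assumes "2 * g = (q - 1) * (l - 1)" and "2 * g \<le> m + 1"
  shows "card {n \<in> weights q l. n \<le> m} + g = m + 1"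
proof -
  have "{..m} = {n \<in> weights q l. n \<le> m} \<union> gaps"
  proof (intro equalityI subsetI)
    fix n assume "n \<in> {n \<in> weights q l. n \<le> m} \<union> gaps"
    then show "n \<in> {..m}" using gaps_less[of n] assms by auto
  qed (auto simp: gaps_def)
  moreover have "card ({n \<in> weights q l. n \<le> m} \<union> gaps) = card {n \<in> weights q l. n \<le> m} + card gaps"
    using finite_gaps by (intro card_Un_disjoint) (auto simp: gaps_def)
  moreover have "card {..m} = m + 1" by simp
  moreover have "card gaps = g" using card_gaps assms(1) by simp
  ultimately show ?thesis by simp
qed

text \<open>
  Of the \<open>n + 1\<close> ways to write \<open>n\<close> as a sum, each gap spoils at most two.
\<close>

lemma card_weight_splittings:
  "n + 1 \<le> card {a. a \<le> n \<and> a \<in> weights q l \<and> n - a \<in> weights q l} + (q - 1) * (l - 1)"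
proof -
  let ?S = "{a. a \<le> n \<and> a \<in> weights q l \<and> n - a \<in> weights q l}"
  have "{..n} \<subseteq> ?S \<union> (gaps \<union> (\<lambda>a. n - a) ` gaps)"
  proof
    fix a assume "a \<in> {..n}"
    then have "a = n - (n - a)" by simp
    then show "a \<in> ?S \<union> (gaps \<union> (\<lambda>a. n - a) ` gaps)"
      using \<open>a \<in> {..n}\<close> unfolding gaps_def by blast
  qed
  then have "n + 1 \<le> card (?S \<union> (gaps \<union> (\<lambda>a. n - a) ` gaps))"
    using finite_gaps card_mono[of "?S \<union> (gaps \<union> (\<lambda>a. n - a) ` gaps)" "{..n}"] by simp
  also have "\<dots> \<le> card ?S + (card gaps + card ((\<lambda>a. n - a) ` gaps))"
    by (intro order.trans[OF card_Un_le] add_left_mono card_Un_le)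
  also have "\<dots> \<le> card ?S + (card gaps + card gaps)"
    using card_image_le[OF finite_gaps] by (intro add_left_mono) auto
  finally show ?thesis using card_gaps by simp
qed

end

section \<open>Roots in a finite field\<close>

text \<open>
  The polynomial \<open>X^Q - X\<close> vanishes on all \<open>Q\<close> elements of the field, and
  neither factor can have more roots than its degree.
\<close>

lemma card_roots_of_factor:
  fixes A R :: "'a::{field,finite} poly"
  assumes "A * R = monom 1 CARD('a) - monom 1 1"
  shows "card {x. poly A x = 0} = degree A"
proof -
  let ?Q = "CARD('a)"
  have Q1: "?Q > 1" using card_mono[of UNIV "{0::'a, 1}"] by simp
  have deg: "degree (A * R) = ?Q"
    unfolding assms using Q1 by (subst degree_diff_eq_left) (auto simp: degree_monom_eq)
  then have nz: "A \<noteq> 0" "R \<noteq> 0" using Q1 by auto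
  have "poly (A * R) x = 0" for x
    unfolding assms by (simp add: poly_monom finite_field_power_card)
  then have "UNIV = {x. poly A x = 0} \<union> {x. poly R x = 0}" by auto
  then have "?Q \<le> card {x. poly A x = 0} + card {x. poly R x = 0}"
    by (metis card_Un_le)
  moreover have "card {x. poly R x = 0} \<le> degree R"
    using card_poly_roots_bound[OF nz(2)] .
  moreover have "card {x. poly A x = 0} \<le> degree A"
    using card_poly_roots_bound[OF nz(1)] .
  moreover have "degree A + degree R = ?Q"
    using deg nz by (simp add: degree_mult_eq)
  ultimately show ?thesis by simp
qed

lemma card_power_eq:
  fixes c :: "'a::{field,finite}"
  assumes "k * n = CARD('a) - 1" and "c ^ k = 1"
  shows "card {x. x ^ n = c} = n"
proof -
  have Q1: "CARD('a) > 1" using card_mono[of UNIV "{0::'a, 1}"] by simp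
  then have "n > 0" using assms(1) by (cases n) auto
  define A where "A = monom (1::'a) n - [:c:]"
  have "A dvd monom 1 n ^ k - [:c:] ^ k"
    unfolding A_def by (metis dvd_triv_left power_diff_sumr2)
  also have "monom 1 n ^ k - [:c:] ^ k = monom (1::'a) (CARD('a) - 1) - 1"
    using assms by (simp add: monom_power mult.commute poly_const_pow flip: one_pCons)
  also have "\<dots> dvd monom 1 1 * (monom 1 (CARD('a) - 1) - 1)" by simp
  also have "\<dots> = monom 1 CARD('a) - monom 1 1"
    using Q1 by (simp add: right_diff_distrib mult_monom)
  finally obtain R where "A * R = monom 1 CARD('a) - monom 1 1" by (metis dvdE)
  then have "card {x. poly A x = 0} = degree A" by (rule card_roots_of_factor)
  moreover have "degree A = n"
    unfolding A_def using \<open>n > 0\<close> by (subst degree_diff_eq_left) (auto simp: degree_monom_eq)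
  moreover have "{x. poly A x = 0} = {x. x ^ n = c}" by (auto simp: A_def poly_monom)
  ultimately show ?thesis by simp
qed

text \<open>
  The solutions of \<open>x^n = c\<close> are permuted by multiplication with an \<open>n\<close>-th
  root of unity. One of these is not an \<open>i\<close>-th root of unity, for lack of enough
  \<open>i\<close>-th roots.
\<close>

lemma sum_powers_over_power_coset:
  fixes c :: "'a::{field,finite}"
  assumes "n dvd CARD('a) - 1" and "0 < i" "i < n"
  shows "(\<Sum>x | x ^ n = c. x ^ i) = 0"
proof -
  obtain k where "k * n = CARD('a) - 1" using assms(1) by (metis dvdE mult.commute)
  then have "card {x. x ^ n = (1::'a)} = n" by (rule card_power_eq) simp
  moreover have "card {x. x ^ i = (1::'a)} \<le> i" using card_power_roots_le assms(2) by blast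
  ultimately obtain z :: 'a where z: "z ^ n = 1" "z ^ i \<noteq> 1"
    using card_mono[of "{x. x ^ i = (1::'a)}" "{x. x ^ n = (1::'a)}"] assms(3) by fastforce
  have z0: "z \<noteq> 0" using z assms by (auto simp: power_0_left)
  have "(\<Sum>x | x ^ n = c. x ^ i) = (\<Sum>x | x ^ n = c. (z * x) ^ i)"
    by (rule sum.reindex_bij_witness[where i = "\<lambda>x. z * x" and j = "\<lambda>x. x / z"])
      (use z z0 in \<open>auto simp: power_mult_distrib power_divide\<close>)
  also have "\<dots> = z ^ i * (\<Sum>x | x ^ n = c. x ^ i)"
    by (simp add: power_mult_distrib sum_distrib_left)
  finally show ?thesis using z(2) by simp
qed

lemma power_eq_1_coprime:
  fixes z :: "'a::comm_ring_1"
  assumes "z ^ a = 1" "z ^ b = 1" "coprime a b"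
  shows "z = 1"
proof (cases "a = 0")
  case True
  then show ?thesis using assms by simp
next
  case False
  then obtain x y where "a * x = b * y + 1" using bezout_nat[of a b] assms(3) by auto
  then have "z ^ (a * x) = z ^ (b * y) * z" by simp
  then show ?thesis using assms by (simp add: power_mult)
qed

lemma sum_rotate:
  "(\<Sum>x\<in>A. \<Sum>i\<in>B. \<Sum>j\<in>C. g x i j) = (\<Sum>i\<in>B. \<Sum>j\<in>C. \<Sum>x\<in>A. g x i j)"
  by (subst sum.swap) (intro sum.cong refl sum.swap)

lemma freshmans_dream_diff:
  fixes x y :: "'a::comm_ring_1"
  assumes "prime CHAR('a)" "m = CHAR('a) ^ n"
  shows "(x - y) ^ m = x ^ m - y ^ m"
  using freshmans_dream'[OF assms, of "x - y" y] by simp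

section \<open>The rational points\<close>

locale curve =
  fixes p r q l e :: nat and K :: "'a::{field,finite} itself"
  assumes prime_p: "prime p" and odd_p: "odd p" and r_pos: "r > 0" and q_def: "q = p ^ r"
    and CARD: "CARD('a) = q ^ 2"
    and l_pos': "l > 0" and gcd_p_l: "gcd p l = 1" and two_gcd_dvd: "2 * gcd l (q + 1) dvd q + 1"
    and e_def: "e = gcd (l * (q - 1)) (q ^ 2 - 1)"
begin

(* keeps q - 1 from being rewritten to q - Suc 0 *)
declare One_nat_def [simp del]

lemma CHAR_eq: "CHAR('a) = p"
proof -
  have "CHAR('a) dvd p ^ (r * 2)"
    using CHAR_dvd_CARD[where 'a='a] by (simp add: CARD q_def power_mult)
  then show ?thesis
    using prime_CHAR_finite_field[where 'a='a] prime_p by (metis prime_dvd_power primes_dvd_imp_eq)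
qed

lemma q_ge_3: "q \<ge> 3"
proof -
  have "p \<noteq> 2" using odd_p by auto
  then have "p \<ge> 3" using prime_ge_2_nat[OF prime_p] by linarith
  moreover have "p ^ 1 \<le> p ^ r" using r_pos prime_p by (intro power_increasing) (use prime_gt_0_nat[OF prime_p] in simp_all)
  ultimately show ?thesis by (simp add: q_def)
qed

sublocale coprime_pair q l
proof
  show "coprime q l" using gcd_p_l unfolding q_def coprime_iff_gcd_eq_1 [symmetric] by simp
qed (use q_ge_3 l_pos' in auto)

lemma frobenius_diff: "(x - y) ^ q = x ^ q - (y ^ q)" for x y :: 'a
  using freshmans_dream_diff[of q r x y] prime_p by (simp add: CHAR_eq q_def)

lemma frobenius_add: "(x + y) ^ q = x ^ q + (y ^ q)" for x y :: 'a
  using freshmans_dream'[of q r x y] prime_p by (simp add: CHAR_eq q_def)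

lemma power_q_q: "(x ^ q) ^ q = x" for x :: 'a
  using finite_field_power_card[of x] by (simp add: CARD power2_eq_square power_mult)

lemma of_nat_q: "of_nat q = (0::'a)"
  using CHAR_eq r_pos by (simp add: q_def of_nat_eq_0_iff_char_dvd)

lemma CARD_minus_1: "CARD('a) - 1 = (q - 1) * (q + 1)"
  using q_ge_3 by (simp add: CARD power2_eq_square algebra_simps)

lemma e_eq: "e = (q - 1) * gcd l (q + 1)"
proof -
  have "q ^ 2 - 1 = (q - 1) * (q + 1)" using CARD_minus_1 by (simp add: CARD)
  then have "e = gcd ((q - 1) * l) ((q - 1) * (q + 1))" by (simp only: e_def mult.commute)
  then show ?thesis by (simp only: gcd_mult_distrib_nat)
qed

lemma e_pos: "e > 0"
proof -
  have "gcd l (q + 1) > 0" using l_pos gcd_le1_nat[of l "q + 1"] gcd_eq_0_iff[of l "q + 1"] by linarith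
  moreover have "q - 1 > 0" using q_ge_3 by linarith
  ultimately show ?thesis unfolding e_eq by (rule mult_pos_pos [rotated])
qed

lemma e_dvd: "2 * e dvd CARD('a) - 1"
proof -
  have "2 * e = (q - 1) * (2 * gcd l (q + 1))" by (simp only: e_eq mult_ac)
  moreover have "(q - 1) * (2 * gcd l (q + 1)) dvd (q - 1) * (q + 1)"
    by (rule mult_dvd_mono[OF dvd_refl two_gcd_dvd])
  ultimately show ?thesis by (simp only: CARD_minus_1)
qed

text \<open>
  Write \<open>l (q - 1) = e M\<close> and \<open>q\<^sup>2 - 1 = e R\<close> with \<open>M\<close> and
  \<open>R\<close> coprime. The divisibility hypothesis makes \<open>R\<close> even and hence
  \<open>M\<close> odd. So \<open>- (x^e)\<close> has both its \<open>M\<close>-th and its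
  \<open>R\<close>-th power equal to \<open>1\<close>.
\<close>

lemma power_l_q_minus_1:
  fixes x :: 'a
  shows "x ^ (l * (q - 1)) = - 1 \<longleftrightarrow> x ^ e = - 1"
proof -
  define c where "c = gcd l (q + 1)"
  have c: "c > 0" "e = (q - 1) * c"
    using e_eq e_pos unfolding c_def [symmetric] by (cases "c = 0", simp_all)
  have "c dvd l" "c dvd q + 1" by (simp_all add: c_def)
  from \<open>c dvd l\<close> obtain M where M: "l = c * M" by (rule dvdE)
  from \<open>c dvd q + 1\<close> obtain R where R: "q + 1 = c * R" by (rule dvdE)
  have "coprime M R"
  proof -
    have "gcd (c * M) (c * R) = c" by (simp only: M [symmetric] R [symmetric] c_def [symmetric])
    then have "c * gcd M R = c * 1" by (simp only: gcd_mult_distrib_nat mult_1_right)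
    then have "gcd M R = 1" by (simp only: nat_mult_eq_cancel1[OF c(1)])
    then show ?thesis by (simp only: coprime_iff_gcd_eq_1)
  qed
  have "even R"
  proof -
    from two_gcd_dvd [folded c_def, unfolded R] obtain k where "c * R = 2 * c * k" by (rule dvdE)
    then have "c * R = c * (2 * k)" by (simp only: mult_ac)
    then have "R = 2 * k" by (simp only: nat_mult_eq_cancel1[OF c(1)])
    then show ?thesis by simp
  qed
  then have "odd M" using \<open>coprime M R\<close> using coprime_common_divisor_nat[of M R 2] by auto
  have "l * (q - 1) = e * M" unfolding c(2) by (subst M, simp only: mult_ac)
  then have lM: "x ^ (l * (q - 1)) = (x ^ e) ^ M" by (simp only: power_mult)
  have eR: "CARD('a) - 1 = e * R" unfolding c(2) CARD_minus_1 R by (simp only: mult_ac)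
  show ?thesis
  proof
    assume "x ^ e = - 1"
    then show "x ^ (l * (q - 1)) = - 1" using \<open>odd M\<close> unfolding lM by simp
  next
    assume *: "x ^ (l * (q - 1)) = - 1"
    then have "x \<noteq> 0" using l_pos q_ge_3 by (auto simp: power_0_left)
    then have "x ^ (CARD('a) - 1) = 1" by (rule finite_field_power_card_minus_1)
    then have "(x ^ e) ^ R = 1"
      by (simp only: eR power_mult)
    then have "(- (x ^ e)) ^ R = 1" using \<open>even R\<close> by simp
    moreover have "(- (x ^ e)) ^ M = 1" using * \<open>odd M\<close> unfolding lM by simp
    ultimately have "- (x ^ e) = 1" using \<open>coprime M R\<close> power_eq_1_coprime[of "- (x ^ e)" M R] by blast
    then have "- (- (x ^ e)) = - 1" by (rule arg_cong)
    then show "x ^ e = - 1" by simp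
  qed
qed

definition xs :: "'a set" where "xs = insert 0 {x. x ^ e = - 1}"

definition fibre :: "'a \<Rightarrow> 'a set" where "fibre x = {y. y ^ q = y + x ^ l}"

lemma card_roots_minus_1: "card {x::'a. x ^ e = - 1} = e"
proof -
  obtain k where k: "CARD('a) - 1 = 2 * e * k" using e_dvd by blast
  then have "(2 * k) * e = CARD('a) - 1" by simp
  then show ?thesis by (rule card_power_eq) simp
qed

lemma card_xs: "card xs = e + 1"
  using card_roots_minus_1 e_pos by (simp add: xs_def power_0_left)

text \<open>
  For \<open>x \<noteq> 0\<close> the condition reads \<open>x^(l (q - 1)) = -1\<close>. The elements
  with \<open>z^q = - z\<close> are the values of \<open>y \<mapsto> y^q - y\<close>.
\<close>

lemma xs_iff: "x \<in> xs \<longleftrightarrow> (x ^ l) ^ q = - (x ^ l)" for x :: 'a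
proof (cases "x = 0")
  case True
  then show ?thesis using l_pos q_ge_3 by (simp add: xs_def power_0_left)
next
  case False
  have "q = Suc (q - 1)" using q_ge_3 by simp
  then have "(x ^ l) ^ q = x ^ l * (x ^ l) ^ (q - 1)" by (metis power_Suc)
  then have "(x ^ l) ^ q = x ^ l * x ^ (l * (q - 1))" by (simp only: power_mult)
  then have "(x ^ l) ^ q = - (x ^ l) \<longleftrightarrow> x ^ (l * (q - 1)) = - 1"
    using False mult_left_cancel[of "x ^ l" "x ^ (l * (q - 1))" "- 1"] by simp
  then show ?thesis using False unfolding power_l_q_minus_1 by (simp add: xs_def)
qed

lemma fibre_nonempty_imp: "y \<in> fibre x \<Longrightarrow> x \<in> xs"
proof -
  assume "y \<in> fibre x"
  then have y: "y ^ q - y = x ^ l" by (simp add: fibre_def)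
  then have "(x ^ l) ^ q = y - y ^ q" using frobenius_diff[of "y ^ q" y] power_q_q[of y] by simp
  then show "x \<in> xs" unfolding xs_iff y [symmetric] by simp
qed

text \<open>
  For \<open>z^q = - z\<close> the polynomial \<open>A = Y^q - Y - z\<close> satisfies \<open>A^q + A =
  Y^(q\<^sup>2) - Y\<close>, so it splits into different linear factors.
\<close>

lemma card_fibre:
  assumes "x \<in> xs"
  shows "card (fibre x) = q"
proof -
  define z where "z = x ^ l"
  have z: "z ^ q = - z" using assms by (simp add: z_def xs_iff)
  define A where "A = monom (1::'a) q - monom 1 1 - [:z:]"
  have pC: "prime CHAR('a poly)" using prime_p by (simp add: semiring_char_poly CHAR_eq)
  have qC: "q = CHAR('a poly) ^ r" by (simp add: semiring_char_poly CHAR_eq q_def)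
  have "A ^ q = monom 1 q ^ q - monom 1 1 ^ q - [:z:] ^ q"
    unfolding A_def by (simp only: freshmans_dream_diff[OF pC qC])
  also have "\<dots> = monom 1 (q ^ 2) - monom 1 q + [:z:]"
    by (simp add: monom_power power2_eq_square poly_const_pow z)
  finally have "A ^ q + A = monom 1 CARD('a) - monom 1 1" by (simp add: A_def CARD)
  moreover have "A * A ^ (q - 1) = A ^ q"
    using q_ge_3 power_minus_mult[of q A] by (simp add: mult.commute)
  ultimately have "A * (A ^ (q - 1) + 1) = monom 1 CARD('a) - monom 1 1"
    by (simp only: distrib_left mult_1_right)
  then have "card {x. poly A x = 0} = degree A" by (rule card_roots_of_factor)
  moreover have "degree (monom (1::'a) q - monom 1 1) = q"
    using q_ge_3 by (subst degree_diff_eq_left) (auto simp: degree_monom_eq)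
  then have "degree A = q"
    unfolding A_def using q_ge_3 by (subst degree_diff_eq_left) auto
  moreover have "{x. poly A x = 0} = fibre x"
    by (auto simp: A_def poly_monom fibre_def z_def algebra_simps)
  ultimately show ?thesis by simp
qed

definition D :: "('a \<times> 'a) set" where "D = Sigma xs fibre"

lemma eval2_curve_poly: "eval2 (curve_poly q l) (x, y) = y ^ q - y - x ^ l" for x y :: 'a
  by (simp add: eval2_def curve_poly_def poly_monom poly_const_pow)

lemma affine_points_eq: "affine_points (curve_poly q l) = D"
proof -
  have "(x, y) \<in> affine_points (curve_poly q l) \<longleftrightarrow> y \<in> fibre x" for x y :: 'a
    by (auto simp: affine_points_def eval2_curve_poly fibre_def algebra_simps)
  then show ?thesis using fibre_nonempty_imp by (auto simp: D_def)
qed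

lemma card_D: "card D = q * (e + 1)"
  by (simp add: D_def card_SigmaI card_fibre card_xs mult.commute)

lemma D_iff: "(x, y) \<in> D \<Longrightarrow> y ^ q = y + x ^ l"
  by (simp add: D_def fibre_def)

section \<open>Power sums over the rational points\<close>

definition Fq :: "'a set" where "Fq = {c. c ^ q = c}"

lemma Fq_eq: "Fq = insert 0 {c. c ^ (q - 1) = 1}"
proof -
  have "c ^ q = c * c ^ (q - 1)" for c :: 'a
    using q_ge_3 power_minus_mult[of q c] by (simp add: mult.commute)
  then show ?thesis using q_ge_3 by (auto simp: Fq_def)
qed

lemma card_units_Fq: "card {c::'a. c ^ (q - 1) = 1} = q - 1"
  by (rule card_power_eq[of "q + 1"]) (simp_all add: CARD_minus_1)

lemma card_Fq: "card Fq = q"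
  using card_units_Fq q_ge_3 by (simp add: Fq_eq power_0_left)

lemma sum_powers_Fq:
  assumes "s \<le> q - 1"
  shows "(\<Sum>c\<in>Fq. c ^ s) = (if s = q - 1 then - 1 else 0)"
proof -
  have split: "(\<Sum>c\<in>Fq. c ^ s) = 0 ^ s + (\<Sum>c | c ^ (q - 1) = 1. c ^ s)"
    unfolding Fq_eq using q_ge_3 by (subst sum.insert) (auto simp: power_0_left)
  consider "s = 0" | "s = q - 1" | "0 < s" "s < q - 1" using assms by linarith
  then show ?thesis
  proof cases
    case 1
    then show ?thesis using of_nat_q q_ge_3 by (simp add: card_Fq)
  next
    case 2
    have "(\<Sum>c::'a | c ^ (q - 1) = 1. c ^ s) = (\<Sum>c::'a | c ^ (q - 1) = 1. 1)"
      by (rule sum.cong) (simp_all add: 2)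
    also have "\<dots> = - 1"
      using of_nat_q q_ge_3 by (simp add: card_units_Fq of_nat_diff)
    finally have E: "(\<Sum>c::'a | c ^ (q - 1) = 1. c ^ s) = - 1" .
    have "(0::'a) ^ s = 0" using 2 q_ge_3 by (simp add: power_0_left)
    then have "(\<Sum>c\<in>Fq. c ^ s) = - 1" unfolding split E by simp
    then show ?thesis using 2 by simp
  next
    case 3
    then have "(\<Sum>c::'a | c ^ (q - 1) = 1. c ^ s) = 0"
      by (intro sum_powers_over_power_coset) (simp_all add: CARD_minus_1)
    then show ?thesis using 3 by (simp add: split power_0_left)
  qed
qed

text \<open>
  A fibre is a translate of the subfield with \<open>q\<close> elements; after binomial expansion only
  \<open>s = q - 1\<close> has a nonzero power sum over this subfield.
\<close>

lemma sum_powers_fibre: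
  assumes "x \<in> xs" and "j \<le> q - 1"
  shows "(\<Sum>y\<in>fibre x. y ^ j) = (if j = q - 1 then - 1 else 0)"
proof -
  have "fibre x \<noteq> {}" using card_fibre[OF assms(1)] q_ge_3 by auto
  then obtain b where b: "b ^ q = b + x ^ l" by (auto simp: fibre_def)
  have "(\<Sum>y\<in>fibre x. y ^ j) = (\<Sum>c\<in>Fq. (b + c) ^ j)"
    by (rule sum.reindex_bij_witness[where i = "\<lambda>c. b + c" and j = "\<lambda>y. y - b"])
      (auto simp: fibre_def Fq_def frobenius_diff frobenius_add b)
  also have "\<dots> = (\<Sum>c\<in>Fq. \<Sum>s\<le>j. of_nat (j choose s) * c ^ s * b ^ (j - s))"
    by (subst add.commute) (simp add: binomial_ring)
  also have "\<dots> = (\<Sum>s\<le>j. of_nat (j choose s) * b ^ (j - s) * (\<Sum>c\<in>Fq. c ^ s))"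
    by (subst sum.swap) (simp add: sum_distrib_left mult_ac)
  also have "\<dots> = (\<Sum>s\<le>j. if s = q - 1 then - of_nat (j choose s) * b ^ (j - s) else 0)"
    using assms(2) by (intro sum.cong) (auto simp: sum_powers_Fq)
  also have "\<dots> = (if j = q - 1 then - 1 else 0)"
    using assms(2) by (auto simp: sum.delta)
  finally show ?thesis .
qed

lemma sum_powers_xs:
  assumes "i < e" and "p dvd e + 1"
  shows "(\<Sum>x\<in>xs. x ^ i) = 0"
proof -
  have split: "(\<Sum>x\<in>xs. x ^ i) = 0 ^ i + (\<Sum>x | x ^ e = - 1. x ^ i)"
    unfolding xs_def using e_pos by (subst sum.insert) (auto simp: power_0_left)
  show ?thesis
  proof (cases "i = 0")
    case True
    have "(of_nat (e + 1) :: 'a) = 0" using assms(2) by (simp only: of_nat_eq_0_iff_char_dvd CHAR_eq)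
    then show ?thesis by (simp add: True card_xs)
  next
    case False
    have "e dvd CARD('a) - 1" using e_dvd by (metis dvd_mult_right)
    then show ?thesis using False assms by (simp add: split power_0_left sum_powers_over_power_coset)
  qed
qed

section \<open>The order bound\<close>

text \<open>
  The value at \<open>x^i y^j\<close> of the linear functional with coefficient vector \<open>c\<close>.
\<close>

definition moment :: "('a \<times> 'a \<Rightarrow> 'a) \<Rightarrow> nat \<Rightarrow> nat \<Rightarrow> 'a" where
  "moment c i j = (\<Sum>P\<in>D. c P * (fst P ^ i * snd P ^ j))"

lemma finite_D: "finite D" by simp

lemma moment_reduce: "moment c i (j + q) = moment c (i + l) j + moment c i (j + 1)"
proof -
  have "c P * (fst P ^ i * snd P ^ (j + q)) =
      c P * (fst P ^ (i + l) * snd P ^ j) + c P * (fst P ^ i * snd P ^ (j + 1))" if "P \<in> D" for P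
    using D_iff[of "fst P" "snd P"] that by (simp add: power_add algebra_simps)
  then show ?thesis unfolding moment_def sum.distrib [symmetric] by (rule sum.cong[OF refl])
qed

text \<open>
  Rewriting \<open>y^q\<close> to \<open>y + x^l\<close> keeps the weight of the second term and lowers
  that of the first, so monomials with \<open>j < q\<close> suffice.
\<close>

lemma moment_vanishes:
  assumes "\<And>i j. j < q \<Longrightarrow> q * i + l * j \<le> B \<Longrightarrow> moment c i j = 0"
    and "q * i + l * j \<le> B"
  shows "moment c i j = 0"
  using assms(2)
proof (induction j arbitrary: i rule: less_induct)
  case (less j)
  show ?case
  proof (cases "j < q")
    case True
    then show ?thesis using assms(1) less.prems by blast
  next
    case False
    define k where "k = j - q"
    have j: "j = k + q" using False by (simp add: k_def)
    have "q * (i + l) + l * k \<le> B" using less.prems by (simp add: j algebra_simps)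
    then have "moment c (i + l) k = 0" using less.IH[of k "i + l"] q_pos by (simp add: j)
    moreover have "l * (k + 1) \<le> l * j" using q_pos unfolding j by (intro mult_left_mono) auto
    then have "q * i + l * (k + 1) \<le> B" using less.prems by linarith
    then have "moment c i (k + 1) = 0" using less.IH[of "k + 1" i] q_ge_3 by (simp add: j)
    ultimately show ?thesis by (simp only: j moment_reduce add_0_left)
  qed
qed

text \<open>
  Modulo monomials of smaller weight, \<open>y^q\<close> may be replaced by \<open>x^l\<close>. So a
  functional that vanishes on all smaller weights depends only on the weight of a monomial.
\<close>

lemma moment_canonical:
  assumes "\<And>i j. q * i + l * j < \<gamma> \<Longrightarrow> moment c i j = 0" and "q * i + l * j = \<gamma>"
  shows "moment c i j = moment c (i + l * (j div q)) (j mod q)"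
  using assms(2)
proof (induction j arbitrary: i rule: less_induct)
  case (less j)
  show ?case
  proof (cases "j < q")
    case False
    define k where "k = j - q"
    have j: "j = k + q" using False by (simp add: k_def)
    have "q * (i + l) + l * k = \<gamma>" using less.prems by (simp add: j algebra_simps)
    then have IH: "moment c (i + l) k = moment c (i + l + l * (k div q)) (k mod q)"
      using less.IH[of k "i + l"] q_pos by (simp add: j)
    have "l * (k + 1) < l * j" using q_ge_3 l_pos unfolding j by (intro mult_strict_left_mono) auto
    then have "q * i + l * (k + 1) < \<gamma>" using less.prems by linarith
    then have "moment c i (k + 1) = 0" by (rule assms(1))
    moreover have "j div q = k div q + 1" "j mod q = k mod q" using q_pos by (simp_all add: j)
    ultimately show ?thesis using IH moment_reduce[of c i k] by (simp add: j algebra_simps)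
  qed simp
qed

lemma moment_same_weight:
  assumes "\<And>i j. q * i + l * j < \<gamma> \<Longrightarrow> moment c i j = 0"
    and "q * i + l * j = \<gamma>" "q * i' + l * j' = \<gamma>"
  shows "moment c i j = moment c i' j'"
proof -
  have can: "int q * int (i + l * (j div q)) + int l * int (j mod q) = int \<gamma>"
    if "q * i + l * j = \<gamma>" for i j
  proof -
    have "q * (i + l * (j div q)) + l * (j mod q) = q * i + l * (q * (j div q) + j mod q)"
      by (simp only: distrib_left mult_ac add_ac)
    then have "q * (i + l * (j div q)) + l * (j mod q) = \<gamma>" using that by (simp only: mult_div_mod_eq)
    then show ?thesis by (simp flip: of_nat_mult of_nat_add)
  qed
  have "j mod q = j' mod q" "int (i + l * (j div q)) = int (i' + l * (j' div q))"
    using weight_unique[of "int (i + l * (j div q))" "j mod q" "int (i' + l * (j' div q))" "j' mod q"]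
      can[OF assms(2)] can[OF assms(3)] q_pos by simp_all
  moreover from this have "i + l * (j div q) = i' + l * (j' div q)" by (simp only: of_nat_eq_iff)
  ultimately show ?thesis
    using moment_canonical[OF assms(1,2)] moment_canonical[OF assms(1,3)] by simp
qed

text \<open>
  The indicator function of a point is a polynomial in the coordinates.
\<close>

lemma moments_determine:
  assumes "\<And>i j. moment c i j = 0" and P: "P \<in> D"
  shows "c P = 0"
proof -
  let ?Q = "CARD('a)"
  have Q1: "?Q > 1" using card_mono[of UNIV "{0::'a, 1}"] by simp
  \<comment> \<open>nonzero elements have \<open>(Q - 1)\<close>-st power \<open>1\<close>\<close>
  define ind where "ind a = 1 - [:- a, 1:] ^ (?Q - 1)" for a :: 'a
  have ind: "poly (ind a) x = (if x = a then 1 else 0)" for a x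
    using finite_field_power_card_minus_1[of "x - a"] Q1 by (auto simp: ind_def power_0_left)
  let ?F = "ind (fst P)" and ?G = "ind (snd P)"
  have "(\<Sum>R\<in>D. c R * (poly ?F (fst R) * poly ?G (snd R))) =
      (\<Sum>R\<in>D. \<Sum>i\<le>degree ?F. \<Sum>j\<le>degree ?G.
         coeff ?F i * coeff ?G j * (c R * (fst R ^ i * snd R ^ j)))"
    by (simp only: poly_altdef sum_product, simp only: sum_distrib_left, intro sum.cong refl)
      (simp only: mult_ac)
  also have "\<dots> = (\<Sum>i\<le>degree ?F. \<Sum>j\<le>degree ?G. coeff ?F i * coeff ?G j * moment c i j)"
    unfolding moment_def sum_distrib_left by (rule sum_rotate)
  also have "\<dots> = 0" using assms(1) by simp
  also have "(\<Sum>R\<in>D. c R * (poly ?F (fst R) * poly ?G (snd R))) = (\<Sum>R\<in>D. if R = P then c R else 0)"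
    by (rule sum.cong) (auto simp: ind prod_eq_iff)
  finally show ?thesis using P finite_D by simp
qed

text \<open>
  The bound of Feng and Rao. Let \<open>\<gamma>\<close> be the least weight of a monomial on which
  \<open>c\<close> does not vanish. For every splitting \<open>\<gamma> = a + b\<close> into weights
  choose a monomial of weight \<open>a\<close>. Restricted to the support of \<open>c\<close> these
  monomials are linearly independent: multiplying a vanishing combination by a monomial of weight
  \<open>\<gamma> - a\<close>, for the largest \<open>a\<close> that occurs, and applying
  \<open>c\<close> leaves only the term at \<open>a\<close>. So the support has at least as many points
  as there are splittings.
\<close>

lemma order_bound:
  assumes low: "\<And>i j. j < q \<Longrightarrow> q * i + l * j \<le> m \<Longrightarrow> moment c i j = 0"
    and nz: "\<exists>P\<in>D. c P \<noteq> 0"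
  shows "m + 2 \<le> card {P \<in> D. c P \<noteq> 0} + (q - 1) * (l - 1)"
proof -
  define S where "S = {P \<in> D. c P \<noteq> 0}"
  have finS: "finite S" by simp
  define \<gamma> where "\<gamma> = (LEAST n. \<exists>i j. q * i + l * j = n \<and> moment c i j \<noteq> 0)"
  have "\<exists>n. \<exists>i j. q * i + l * j = n \<and> moment c i j \<noteq> 0" using moments_determine nz by blast
  then have "\<exists>i j. q * i + l * j = \<gamma> \<and> moment c i j \<noteq> 0" unfolding \<gamma>_def by (rule LeastI_ex)
  then obtain i0 j0 where ij0: "q * i0 + l * j0 = \<gamma>" "moment c i0 j0 \<noteq> 0" by blast
  have below: "moment c i j = 0" if "q * i + l * j < \<gamma>" for i j
    using not_less_Least[OF that[unfolded \<gamma>_def]] by blast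
  have at: "moment c i j \<noteq> 0" if "q * i + l * j = \<gamma>" for i j
    using moment_same_weight[OF below that ij0(1)] ij0(2) by simp
  have "m < \<gamma>"
  proof (rule ccontr)
    assume "\<not> m < \<gamma>"
    then show False using moment_vanishes[of m c i0 j0] low ij0 by simp
  qed
  define T where "T = {a. a \<le> \<gamma> \<and> a \<in> weights q l \<and> \<gamma> - a \<in> weights q l}"
  have finT: "finite T" by (simp add: T_def)
  have "\<forall>a \<in> weights q l. \<exists>t. q * fst t + l * snd t = a" by (auto simp: weights_def)
  then obtain mon where mon: "\<And>a. a \<in> weights q l \<Longrightarrow> q * fst (mon a) + l * snd (mon a) = a"
    by metis
  define \<phi> where "\<phi> a P = fst P ^ fst (mon a) * snd P ^ snd (mon a)" for a and P :: "'a \<times> 'a"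
  have pair: "(\<Sum>P\<in>D. c P * (\<phi> a P * \<phi> b P)) = moment c (fst (mon a) + fst (mon b)) (snd (mon a) + snd (mon b))" for a b
    by (simp add: \<phi>_def moment_def power_add mult_ac)
  have pair_less: "(\<Sum>P\<in>D. c P * (\<phi> a P * \<phi> b P)) = 0"
    if "a \<in> weights q l" "b \<in> weights q l" "a + b < \<gamma>" for a b
    unfolding pair using mon[OF that(1)] mon[OF that(2)] that(3) by (intro below) (simp add: algebra_simps)
  have pair_eq: "(\<Sum>P\<in>D. c P * (\<phi> a P * \<phi> b P)) \<noteq> 0"
    if "a \<in> weights q l" "b \<in> weights q l" "a + b = \<gamma>" for a b
    unfolding pair using mon[OF that(1)] mon[OF that(2)] that(3) by (intro at) (simp add: algebra_simps)
  have indep: "\<forall>a\<in>T. w a = 0" if zero: "\<And>P. P \<in> S \<Longrightarrow> (\<Sum>a\<in>T. w a * \<phi> a P) = 0" for w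
  proof (rule ccontr)
    assume "\<not> (\<forall>a\<in>T. w a = 0)"
    define A where "A = {a \<in> T. w a \<noteq> 0}"
    have A: "finite A" "A \<noteq> {}" using finT \<open>\<not> (\<forall>a\<in>T. w a = 0)\<close> by (auto simp: A_def)
    define a0 where "a0 = Max A"
    have a0: "a0 \<in> T" "w a0 \<noteq> 0" using Max_in[OF A] by (auto simp: A_def a0_def)
    have above: "w a = 0" if "a \<in> T" "a0 < a" for a
      using Max_ge[OF A(1), of a] that by (force simp: A_def a0_def)
    define b0 where "b0 = \<gamma> - a0"
    have b0: "b0 \<in> weights q l" "a0 + b0 = \<gamma>" using a0 by (auto simp: T_def b0_def)
    have "0 = (\<Sum>P\<in>D. c P * ((\<Sum>a\<in>T. w a * \<phi> a P) * \<phi> b0 P))"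
    proof (rule sum.neutral [symmetric], rule ballI)
      fix P assume "P \<in> D"
      then show "c P * ((\<Sum>a\<in>T. w a * \<phi> a P) * \<phi> b0 P) = 0"
        using zero[of P] by (cases "c P = 0") (simp_all add: S_def)
    qed
    also have "\<dots> = (\<Sum>P\<in>D. \<Sum>a\<in>T. w a * (c P * (\<phi> a P * \<phi> b0 P)))"
      by (simp add: sum_distrib_left sum_distrib_right mult_ac)
    also have "\<dots> = (\<Sum>a\<in>T. w a * (\<Sum>P\<in>D. c P * (\<phi> a P * \<phi> b0 P)))"
      by (subst sum.swap) (simp add: sum_distrib_left)
    also have "\<dots> = (\<Sum>a\<in>T. if a = a0 then w a0 * (\<Sum>P\<in>D. c P * (\<phi> a0 P * \<phi> b0 P)) else 0)"
    proof (rule sum.cong[OF refl])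
      fix a assume a: "a \<in> T"
      consider "a < a0" | "a = a0" | "a0 < a" by linarith
      then show "w a * (\<Sum>P\<in>D. c P * (\<phi> a P * \<phi> b0 P)) =
          (if a = a0 then w a0 * (\<Sum>P\<in>D. c P * (\<phi> a0 P * \<phi> b0 P)) else 0)"
      proof cases
        case 1
        then have "(\<Sum>P\<in>D. c P * (\<phi> a P * \<phi> b0 P)) = 0"
          using a b0 by (intro pair_less) (auto simp: T_def)
        then show ?thesis using 1 by simp
      qed (use above a in auto)
    qed
    also have "\<dots> = w a0 * (\<Sum>P\<in>D. c P * (\<phi> a0 P * \<phi> b0 P))" using a0 finT by simp
    finally show False using a0 pair_eq[of a0 b0] b0 by (auto simp: T_def)
  qed
  define F where "F w = restrict (\<lambda>P. \<Sum>a\<in>T. w a * \<phi> a P) S" for w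
  have "inj_on F (T \<rightarrow>\<^sub>E (UNIV :: 'a set))"
  proof (rule inj_onI)
    fix w w' assume w: "w \<in> T \<rightarrow>\<^sub>E UNIV" "w' \<in> T \<rightarrow>\<^sub>E UNIV" "F w = F w'"
    have "(\<Sum>a\<in>T. (w a - w' a) * \<phi> a P) = 0" if "P \<in> S" for P
      using fun_cong[OF w(3), of P] that by (simp add: F_def left_diff_distrib sum_subtractf)
    then have "\<forall>a\<in>T. w a - w' a = 0" by (rule indep)
    then show "w = w'" using w(1,2) by (intro PiE_ext[of w T "\<lambda>_. UNIV" w']) auto
  qed
  moreover have "F ` (T \<rightarrow>\<^sub>E UNIV) \<subseteq> S \<rightarrow>\<^sub>E (UNIV :: 'a set)" by (auto simp: F_def)
  ultimately have "card (T \<rightarrow>\<^sub>E (UNIV :: 'a set)) \<le> card (S \<rightarrow>\<^sub>E (UNIV :: 'a set))"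
    using finS by (intro card_inj_on_le) (auto intro: finite_PiE)
  then have "CARD('a) ^ card T \<le> CARD('a) ^ card S" using finS finT by (simp add: card_PiE)
  moreover have "CARD('a) > 1" using card_mono[of UNIV "{0::'a, 1}"] by simp
  ultimately have "card T \<le> card S" by (metis power_le_imp_le_exp)
  moreover have "\<gamma> + 1 \<le> card T + (q - 1) * (l - 1)" unfolding T_def by (rule card_weight_splittings)
  ultimately show ?thesis using \<open>m < \<gamma>\<close> unfolding S_def by linarith
qed

section \<open>Polynomials of bounded weight and their evaluation code\<close>

text \<open>
  The space \<open>L(m P\<^sub>\<infinity>)\<close>, as will turn out in
  \<open>riemann_roch_space_eq\<close>.
\<close>

definition poly_space :: "nat \<Rightarrow> 'a poly poly set" where
  "poly_space m = {g. \<forall>j. coeff g j \<noteq> 0 \<longrightarrow> j < q \<and> q * degree (coeff g j) + l * j \<le> m}"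

definition exponents :: "nat \<Rightarrow> (nat \<times> nat) set" where
  "exponents m = {(i, j). j < q \<and> q * i + l * j \<le> m}"

lemma finite_exponents: "finite (exponents m)"
proof (rule finite_subset)
  show "exponents m \<subseteq> {..m} \<times> {..<q}"
  proof
    fix t assume "t \<in> exponents m"
    then obtain i j where t: "t = (i, j)" "j < q" "q * i + l * j \<le> m" by (auto simp: exponents_def)
    have "1 * i \<le> q * i" using q_ge_3 by (intro mult_right_mono) auto
    then have "i \<le> m" using t by linarith
    then show "t \<in> {..m} \<times> {..<q}" using t by simp
  qed
qed simp

lemma card_exponents: "card (exponents m) = card {n \<in> weights q l. n \<le> m}"
proof (rule bij_betw_same_card)
  show "bij_betw (\<lambda>(i, j). q * i + l * j) (exponents m) {n \<in> weights q l. n \<le> m}"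
  proof (rule bij_betw_imageI)
    show "inj_on (\<lambda>(i, j). q * i + l * j) (exponents m)"
    proof (rule inj_onI)
      fix s t assume st: "s \<in> exponents m" "t \<in> exponents m"
        "(\<lambda>(i, j). q * i + l * j) s = (\<lambda>(i, j). q * i + l * j) t"
      obtain i j i' j' where s: "s = (i, j)" and t: "t = (i', j')" by (metis surj_pair)
      have "int (q * i + l * j) = int (q * i' + l * j')" using st s t by simp
      then have "int q * int i + int l * int j = int q * int i' + int l * int j'" by simp
      then show "s = t"
        using weight_unique[of "int i" j "int i'" j'] st(1,2) unfolding s t exponents_def by simp
    qed
    show "(\<lambda>(i, j). q * i + l * j) ` exponents m = {n \<in> weights q l. n \<le> m}"
    proof (intro equalityI subsetI)
      fix n assume "n \<in> {n \<in> weights q l. n \<le> m}"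
      then have n: "n \<in> weights q l" "n \<le> m" by auto
      obtain i j where ij: "j < q" "int n = int q * i + int l * int j" using weight_representation by blast
      then have "i \<ge> 0" using weights_iff n(1) by blast
      then have "int n = int (q * nat i + l * j)" using ij by simp
      then have "n = q * nat i + l * j" by (simp only: of_nat_eq_iff)
      then show "n \<in> (\<lambda>(i, j). q * i + l * j) ` exponents m"
        using n ij by (intro image_eqI[of _ _ "(nat i, j)"]) (auto simp: exponents_def)
    qed (auto simp: exponents_def weights_def)
  qed
qed

lemma poly_space_coeff:
  assumes "g \<in> poly_space m" "coeff (coeff g j) i \<noteq> 0"
  shows "(i, j) \<in> exponents m"
proof -
  have "coeff g j \<noteq> 0" using assms(2) by auto
  then have j: "j < q" "q * degree (coeff g j) + l * j \<le> m"
    using assms(1) by (auto simp: poly_space_def)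
  have "i \<le> degree (coeff g j)" using assms(2) by (rule le_degree)
  then have "q * i \<le> q * degree (coeff g j)" by simp
  then have "q * i + l * j \<le> m" using j by linarith
  then show ?thesis using j by (simp add: exponents_def)
qed

lemma poly_space_coeff_eq_0:
  "g \<in> poly_space m \<Longrightarrow> (i, j) \<notin> exponents m \<Longrightarrow> coeff (coeff g j) i = 0"
  using poly_space_coeff by blast

lemma eval2_sum: "eval2 (\<Sum>a\<in>A. h a) P = (\<Sum>a\<in>A. eval2 (h a) P)" for P :: "'a \<times> 'a"
  by (simp add: eval2_def split_beta poly_sum)

lemma eval2_monom: "eval2 (monom (monom c i) j) P = c * (fst P ^ i * snd P ^ j)" for P :: "'a \<times> 'a"
  by (simp add: eval2_def split_beta poly_monom poly_const_pow)

definition poly_of :: "nat \<Rightarrow> (nat \<times> nat \<Rightarrow> 'a) \<Rightarrow> 'a poly poly" where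
  "poly_of m w = (\<Sum>(i, j)\<in>exponents m. monom (monom (w (i, j)) i) j)"

lemma coeff_poly_of: "coeff (coeff (poly_of m w) j) i = (if (i, j) \<in> exponents m then w (i, j) else 0)"
proof -
  have "coeff (coeff (poly_of m w) j) i = (\<Sum>t\<in>exponents m. if t = (i, j) then w t else 0)"
    unfolding poly_of_def coeff_sum by (rule sum.cong) (auto split: if_splits)
  then show ?thesis by (simp add: finite_exponents)
qed

lemma poly_of_coeffs:
  assumes "g \<in> poly_space m"
  shows "poly_of m (\<lambda>(i, j). coeff (coeff g j) i) = g"
  using poly_space_coeff[OF assms] by (auto simp: poly_eq_iff coeff_poly_of)

lemma poly_of_in_poly_space: "poly_of m w \<in> poly_space m"
proof -
  have "j < q \<and> q * degree (coeff (poly_of m w) j) + l * j \<le> m"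
    if "coeff (poly_of m w) j \<noteq> 0" for j
  proof -
    have "coeff (coeff (poly_of m w) j) (degree (coeff (poly_of m w) j)) \<noteq> 0"
      using that by simp
    then have "(degree (coeff (poly_of m w) j), j) \<in> exponents m"
      unfolding coeff_poly_of by (auto split: if_splits)
    then show ?thesis by (simp add: exponents_def)
  qed
  then show ?thesis by (simp add: poly_space_def)
qed

lemma poly_space_eq: "poly_space m = range (poly_of m)"
  using poly_of_coeffs poly_of_in_poly_space by (metis image_subsetI rangeI subsetI subset_antisym)

lemma eval2_poly_of: "eval2 (poly_of m w) P = (\<Sum>t\<in>exponents m. w t * (fst P ^ fst t * snd P ^ snd t))" for P :: "'a \<times> 'a"
  unfolding poly_of_def eval2_sum by (rule sum.cong) (auto simp: eval2_monom)

lemma card_poly_space: "card (poly_space m) = CARD('a) ^ card (exponents m)"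
proof -
  have "bij_betw (poly_of m) (exponents m \<rightarrow>\<^sub>E UNIV) (poly_space m)"
  proof (rule bij_betw_imageI)
    show "inj_on (poly_of m) (exponents m \<rightarrow>\<^sub>E UNIV)"
    proof (rule inj_onI)
      fix w w' assume w: "w \<in> exponents m \<rightarrow>\<^sub>E UNIV" "w' \<in> exponents m \<rightarrow>\<^sub>E UNIV"
        "poly_of m w = poly_of m w'"
      have "w t = w' t" if "t \<in> exponents m" for t
        using arg_cong[OF w(3), of "\<lambda>g. coeff (coeff g (snd t)) (fst t)"] that
        by (simp add: coeff_poly_of)
      then show "w = w'" by (rule PiE_ext[OF w(1,2)])
    qed
    have "poly_of m w = poly_of m (restrict w (exponents m))" for w
      by (simp add: poly_eq_iff coeff_poly_of)
    then show "poly_of m ` (exponents m \<rightarrow>\<^sub>E UNIV) = poly_space m"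
      unfolding poly_space_eq by (auto intro!: image_eqI[of _ _ "restrict _ (exponents m)"])
  qed
  then show ?thesis using bij_betw_same_card finite_exponents by (fastforce simp: card_PiE)
qed

text \<open>
  On each fibre the function is a polynomial in \<open>y\<close> of degree less than \<open>q\<close>
  with \<open>q\<close> roots. So its coefficients vanish at the \<open>e + 1\<close> elements of
  \<open>xs\<close>, more than their degrees allow.
\<close>

lemma vanishing_on_D_imp_0:
  assumes g: "g \<in> poly_space m" and m: "m < q * (e + 1)" and van: "\<And>P. P \<in> D \<Longrightarrow> eval2 g P = 0"
  shows "g = 0"
proof -
  have "poly (coeff g j) x = 0" if x: "x \<in> xs" for x j
  proof -
    define h where "h = map_poly (\<lambda>a. poly a x) g"
    have ch: "coeff h j = poly (coeff g j) x" for j by (simp add: h_def coeff_map_poly)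
    have eh: "poly h y = eval2 g (x, y)" for y
      unfolding h_def eval2_def by (induction g) (simp_all add: map_poly_pCons)
    have "h = 0"
    proof (rule ccontr)
      assume "h \<noteq> 0"
      have "degree h < q"
      proof (rule ccontr)
        assume "\<not> degree h < q"
        then have "coeff g (degree h) = 0" using g by (auto simp: poly_space_def)
        then have "coeff h (degree h) = 0" by (simp add: ch)
        then show False using \<open>h \<noteq> 0\<close> by simp
      qed
      moreover have "fibre x \<subseteq> {y. poly h y = 0}" using van x by (auto simp: eh D_def)
      then have "q \<le> card {y. poly h y = 0}"
        using card_fibre[OF x] poly_roots_finite[OF \<open>h \<noteq> 0\<close>] by (metis card_mono)
      ultimately show False using card_poly_roots_bound[OF \<open>h \<noteq> 0\<close>] by linarith
    qed
    then show ?thesis using ch[of j] by simp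
  qed
  then have sub: "xs \<subseteq> {x. poly (coeff g j) x = 0}" for j by auto
  have "coeff g j = 0" for j
  proof (rule ccontr)
    assume nz: "coeff g j \<noteq> 0"
    have "e + 1 \<le> card {x. poly (coeff g j) x = 0}"
      using card_mono[OF poly_roots_finite[OF nz] sub[of j]] card_xs by simp
    also have "\<dots> \<le> degree (coeff g j)" by (rule card_poly_roots_bound[OF nz])
    finally have "q * (e + 1) \<le> q * degree (coeff g j)" by (rule mult_le_mono2)
    moreover have "q * degree (coeff g j) + l * j \<le> m"
      using g nz unfolding poly_space_def by blast
    ultimately show False using m by linarith
  qed
  then show ?thesis by (simp add: poly_eq_iff)
qed

lemma poly_space_diff:
  assumes "g \<in> poly_space m" "h \<in> poly_space m"
  shows "g - h \<in> poly_space m"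
proof -
  have "g - h = poly_of m (\<lambda>(i, j). coeff (coeff g j) i - coeff (coeff h j) i)"
    using poly_space_coeff_eq_0[OF assms(1)] poly_space_coeff_eq_0[OF assms(2)]
    by (simp add: poly_eq_iff coeff_poly_of)
  then show ?thesis by (simp add: poly_of_in_poly_space)
qed

lemma poly_space_add:
  assumes "g \<in> poly_space m" "h \<in> poly_space m"
  shows "g + h \<in> poly_space m"
proof -
  have "g + h = poly_of m (\<lambda>(i, j). coeff (coeff g j) i + coeff (coeff h j) i)"
    using poly_space_coeff_eq_0[OF assms(1)] poly_space_coeff_eq_0[OF assms(2)]
    by (simp add: poly_eq_iff coeff_poly_of)
  then show ?thesis by (simp add: poly_of_in_poly_space)
qed

lemma poly_space_smult:
  assumes "g \<in> poly_space m"
  shows "smult [:c:] g \<in> poly_space m"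
proof -
  have "smult [:c:] g = poly_of m (\<lambda>(i, j). c * coeff (coeff g j) i)"
    using poly_space_coeff_eq_0[OF assms(1)]
    by (simp add: poly_eq_iff coeff_poly_of)
  then show ?thesis by (simp add: poly_of_in_poly_space)
qed

lemma eval2_simps:
  fixes P :: "'a \<times> 'a"
  shows "eval2 (g + h) P = eval2 g P + eval2 h P" "eval2 (g - h) P = eval2 g P - eval2 h P"
    "eval2 (smult [:c:] g) P = c * eval2 g P" "eval2 0 P = 0" "eval2 (g * h) P = eval2 g P * eval2 h P"
  by (simp_all add: eval2_def split_beta)

definition eval_code :: "(nat \<Rightarrow> 'a \<times> 'a) \<Rightarrow> nat \<Rightarrow> 'a vec set" where
  "eval_code P m = (\<lambda>g. vec (q * (e + 1)) (\<lambda>i. eval2 g (P i))) ` poly_space m"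

text \<open>
  By linearity and \<open>moment_vanishes\<close> it suffices to sum monomials \<open>x^i y^j\<close>
  with \<open>j < q\<close> of weight at most \<open>2 m\<close> over the points. The sum over a fibre
  vanishes unless \<open>j = q - 1\<close>. Then the bound on \<open>m\<close> leaves no room for
  \<open>i \<ge> 0\<close> if \<open>p\<close> does not divide \<open>e + 1\<close>, and otherwise it
  forces \<open>i < e\<close>, where the sum over \<open>xs\<close> vanishes.
\<close>

lemma self_orthogonality:
  assumes g: "g \<in> poly_space m" and h: "h \<in> poly_space m"
    and m: "2 * (int m + 1) \<le> (int q - 1) * (int l - 1) + int q * (int e + 1) -
      (if p dvd e + 1 then 0 else int q * int e)"
  shows "(\<Sum>P\<in>D. eval2 g P * eval2 h P) = 0"
proof -
  have moment0: "moment (\<lambda>_. 1) i j = 0" if j: "j < q" and w: "q * i + l * j \<le> 2 * m" for i j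
  proof -
    have "moment (\<lambda>_. 1) i j = (\<Sum>x\<in>xs. x ^ i * (\<Sum>y\<in>fibre x. y ^ j))"
      by (simp add: moment_def D_def sum_distrib_left sum.Sigma split_beta)
    also have "\<dots> = (\<Sum>x\<in>xs. x ^ i * (if j = q - 1 then - 1 else 0))"
      using j by (intro sum.cong refl) (subst sum_powers_fibre, auto)
    also have "\<dots> = 0"
    proof (cases "j = q - 1")
      case True
      have jj: "int j = int q - 1" using True q_ge_3 by simp
      have "int q * int i + int l * int j \<le> 2 * int m" using w by (metis of_nat_add of_nat_le_iff of_nat_mult of_nat_numeral)
      then have iq: "int q * int i + int l * (int q - 1) \<le> 2 * int m" by (simp add: jj)
      have pd: "p dvd e + 1"
      proof (rule ccontr)
        assume "\<not> p dvd e + 1"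
        then have "2 * int m + 2 \<le> (int q - 1) * (int l - 1) + int q" using m by (simp add: algebra_simps)
        then have "2 * int m + 1 \<le> int l * (int q - 1)" by (simp add: algebra_simps)
        moreover have "0 \<le> int q * int i" by simp
        ultimately show False using iq by linarith
      qed
      then have "2 * int m + 2 \<le> (int q - 1) * (int l - 1) + int q * (int e + 1)" using m by simp
      then have "int q * int i < int q * int e" using iq by (simp add: algebra_simps)
      then have "i < e" using q_pos by simp
      then have "(\<Sum>x\<in>xs. x ^ i) = 0" using pd by (rule sum_powers_xs)
      then show ?thesis by (simp add: True sum_negf)
    qed simp
    finally show ?thesis .
  qed
  obtain v w where gv: "g = poly_of m v" and hw: "h = poly_of m w"
    using g h unfolding poly_space_eq by blast
  have "(\<Sum>P\<in>D. eval2 g P * eval2 h P) = (\<Sum>P\<in>D. \<Sum>s\<in>exponents m. \<Sum>t\<in>exponents m.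
      v s * w t * (1 * (fst P ^ (fst s + fst t) * snd P ^ (snd s + snd t))))"
    unfolding gv hw eval2_poly_of sum_product
    by (intro sum.cong refl) (simp only: power_add mult_ac mult_1_left)
  also have "\<dots> = (\<Sum>s\<in>exponents m. \<Sum>t\<in>exponents m. v s * w t * moment (\<lambda>_. 1) (fst s + fst t) (snd s + snd t))"
    unfolding moment_def sum_distrib_left by (rule sum_rotate)
  also have "\<dots> = 0"
  proof (intro sum.neutral ballI)
    fix s t assume st: "s \<in> exponents m" "t \<in> exponents m"
    have "q * (fst s + fst t) + l * (snd s + snd t) \<le> 2 * m"
      using st by (auto simp: exponents_def algebra_simps)
    then have "moment (\<lambda>_. 1) (fst s + fst t) (snd s + snd t) = 0"
      using moment_vanishes[of "2 * m" "\<lambda>_. 1"] moment0 by blast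
    then show "v s * w t * moment (\<lambda>_. 1) (fst s + fst t) (snd s + snd t) = 0" by simp
  qed
  finally show ?thesis .
qed

lemma sum_over_points:
  assumes "bij_betw P {..<q * (e + 1)} D"
  shows "(\<Sum>i = 0..<q * (e + 1). F (P i)) = sum F D"
  using sum.reindex_bij_betw[OF assms, of F] by (simp add: atLeast0LessThan)

lemma self_orthogonal_eval_code:
  assumes P: "bij_betw P {..<q * (e + 1)} D"
    and m: "2 * (int m + 1) \<le> (int q - 1) * (int l - 1) + int q * (int e + 1) -
      (if p dvd e + 1 then 0 else int q * int e)"
  shows "self_orthogonal_code (q * (e + 1)) (eval_code P m)"
proof
  let ?N = "q * (e + 1)"
  show "eval_code P m \<subseteq> carrier_vec ?N" by (auto simp: eval_code_def)
  have "0 \<in> poly_space m" by (simp add: poly_space_def)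
  then show "0\<^sub>v ?N \<in> eval_code P m"
    unfolding eval_code_def by (rule image_eqI[rotated]) (auto simp: eval2_simps intro!: eq_vecI)
  show "a + b \<in> eval_code P m" if ab: "a \<in> eval_code P m" "b \<in> eval_code P m" for a b
  proof -
    obtain g h where gh: "g \<in> poly_space m" "h \<in> poly_space m" "a = vec ?N (\<lambda>i. eval2 g (P i))"
      "b = vec ?N (\<lambda>i. eval2 h (P i))" using ab unfolding eval_code_def by blast
    have "a + b = vec ?N (\<lambda>i. eval2 (g + h) (P i))" by (auto simp: gh eval2_simps intro!: eq_vecI)
    then show ?thesis using poly_space_add[OF gh(1,2)] unfolding eval_code_def by blast
  qed
  show "s \<cdot>\<^sub>v a \<in> eval_code P m" if a: "a \<in> eval_code P m" for s a
  proof -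
    obtain g where g: "g \<in> poly_space m" "a = vec ?N (\<lambda>i. eval2 g (P i))"
      using a unfolding eval_code_def by blast
    have "s \<cdot>\<^sub>v a = vec ?N (\<lambda>i. eval2 (smult [:s:] g) (P i))" by (auto simp: g eval2_simps intro!: eq_vecI)
    then show ?thesis using poly_space_smult[OF g(1)] unfolding eval_code_def by blast
  qed
  show "a \<bullet> b = 0" if ab: "a \<in> eval_code P m" "b \<in> eval_code P m" for a b
  proof -
    obtain g h where gh: "g \<in> poly_space m" "h \<in> poly_space m" "a = vec ?N (\<lambda>i. eval2 g (P i))"
      "b = vec ?N (\<lambda>i. eval2 h (P i))" using ab unfolding eval_code_def by blast
    have "a \<bullet> b = (\<Sum>i = 0..<?N. eval2 g (P i) * eval2 h (P i))"
      by (simp add: gh scalar_prod_def)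
    also have "\<dots> = (\<Sum>R\<in>D. eval2 g R * eval2 h R)" by (rule sum_over_points[OF P])
    also have "\<dots> = 0" by (rule self_orthogonality[OF gh(1,2) m])
    finally show ?thesis .
  qed
qed

lemma card_eval_code:
  assumes P: "bij_betw P {..<q * (e + 1)} D" and m: "m < q * (e + 1)"
  shows "card (eval_code P m) = CARD('a) ^ card (exponents m)"
proof -
  let ?N = "q * (e + 1)"
  have "inj_on (\<lambda>g. vec ?N (\<lambda>i. eval2 g (P i))) (poly_space m)"
  proof (rule inj_onI)
    fix g h assume gh: "g \<in> poly_space m" "h \<in> poly_space m"
      "vec ?N (\<lambda>i. eval2 g (P i)) = vec ?N (\<lambda>i. eval2 h (P i))"
    have "eval2 (g - h) R = 0" if "R \<in> D" for R
    proof -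
      obtain i where i: "i < ?N" "R = P i" using P \<open>R \<in> D\<close> unfolding bij_betw_def by blast
      have "vec ?N (\<lambda>i. eval2 g (P i)) $ i = vec ?N (\<lambda>i. eval2 h (P i)) $ i" by (simp only: gh(3))
      then show ?thesis using i by (simp add: eval2_simps)
    qed
    then have "g - h = 0" by (rule vanishing_on_D_imp_0[OF poly_space_diff[OF gh(1,2)] m])
    then show "g = h" by simp
  qed
  then show ?thesis by (simp add: eval_code_def card_image card_poly_space)
qed

lemma dual_eval_code_distance:
  assumes P: "bij_betw P {..<q * (e + 1)} D"
    and x: "x \<in> dual_code (q * (e + 1)) (eval_code P m)" "x \<noteq> 0\<^sub>v (q * (e + 1))"
  shows "m + 2 \<le> card {i. i < q * (e + 1) \<and> x $ i \<noteq> 0} + (q - 1) * (l - 1)"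
proof -
  let ?N = "q * (e + 1)"
  have xc: "x \<in> carrier_vec ?N" using x by (simp add: dual_code_def)
  define P' where "P' = the_inv_into {..<?N} P"
  have inv: "P' (P i) = i" if "i < ?N" for i
    using that P unfolding P'_def bij_betw_def by (simp add: the_inv_into_f_f)
  define c where "c R = x $ P' R" for R
  have "moment c i j = 0" if ij: "j < q" "q * i + l * j \<le> m" for i j
  proof -
    have "monom (monom 1 i) j = poly_of m (\<lambda>t. if t = (i, j) then 1 else 0)"
      using ij by (auto simp: poly_eq_iff coeff_poly_of exponents_def)
    then have "monom (monom 1 i) j \<in> poly_space m" by (simp add: poly_of_in_poly_space)
    then have "vec ?N (\<lambda>k. eval2 (monom (monom 1 i) j) (P k)) \<bullet> x = 0"
      using x(1) unfolding dual_code_def eval_code_def by blast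
    then have "0 = (\<Sum>k = 0..<?N. eval2 (monom (monom 1 i) j) (P k) * x $ k)"
      using xc by (simp add: scalar_prod_def)
    also have "\<dots> = (\<Sum>k = 0..<?N. c (P k) * (fst (P k) ^ i * snd (P k) ^ j))"
      by (rule sum.cong) (simp_all add: eval2_monom c_def inv mult.commute)
    also have "\<dots> = moment c i j" unfolding moment_def by (rule sum_over_points[OF P])
    finally show ?thesis by simp
  qed
  moreover have "\<exists>R\<in>D. c R \<noteq> 0"
  proof -
    obtain i where i: "i < ?N" "x $ i \<noteq> 0"
      using x(2) xc by (metis carrier_vecD eq_vecI index_zero_vec(1) index_zero_vec(2))
    then show ?thesis using P inv[of i] unfolding bij_betw_def c_def by (intro bexI[of _ "P i"]) auto
  qed
  ultimately have "m + 2 \<le> card {R \<in> D. c R \<noteq> 0} + (q - 1) * (l - 1)" by (rule order_bound)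
  moreover have "bij_betw P {i. i < ?N \<and> x $ i \<noteq> 0} {R \<in> D. c R \<noteq> 0}"
  proof (rule bij_betw_subset[OF P])
    show "P ` {i. i < ?N \<and> x $ i \<noteq> 0} = {R \<in> D. c R \<noteq> 0}"
    proof (intro equalityI subsetI)
      fix R assume "R \<in> P ` {i. i < ?N \<and> x $ i \<noteq> 0}"
      then obtain i where i: "R = P i" "i < ?N" "x $ i \<noteq> 0" by blast
      then have "R \<in> D" using P unfolding bij_betw_def by blast
      then show "R \<in> {R \<in> D. c R \<noteq> 0}" using i inv[of i] by (simp add: c_def)
    next
      fix R assume R: "R \<in> {R \<in> D. c R \<noteq> 0}"
      then obtain i where "R = P i" "i < ?N" using P unfolding bij_betw_def by blast
      then show "R \<in> P ` {i. i < ?N \<and> x $ i \<noteq> 0}" using R inv[of i] by (auto simp: c_def)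
    qed
  qed auto
  ultimately show ?thesis by (simp add: bij_betw_same_card)
qed

end

section \<open>Semivaluations\<close>

text \<open>
  A valuation that takes the value \<open>\<infinity>\<close> on a prime ideal \<open>Z\<close>. It is
  pulled back along any homomorphism, whether or not the kernel is known. This allows embeddings of the
  curve to be studied before the equation of the curve is known to be irreducible.
\<close>

locale semivaluation =
  fixes Z :: "'b::comm_ring_1 set" and w :: "'b \<Rightarrow> int"
  assumes zero_in: "0 \<in> Z" and one_notin: "1 \<notin> Z"
    and add_in: "x \<in> Z \<Longrightarrow> y \<in> Z \<Longrightarrow> x + y \<in> Z"
    and mult_in: "x \<in> Z \<Longrightarrow> x * y \<in> Z"
    and mult_notin: "x \<notin> Z \<Longrightarrow> y \<notin> Z \<Longrightarrow> x * y \<notin> Z"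
    and w_mult: "x \<notin> Z \<Longrightarrow> y \<notin> Z \<Longrightarrow> w (x * y) = w x + w y"
    and w_add: "x \<notin> Z \<Longrightarrow> y \<notin> Z \<Longrightarrow> x + y \<notin> Z \<Longrightarrow> min (w x) (w y) \<le> w (x + y)"
    and w_cong: "x \<notin> Z \<Longrightarrow> z \<in> Z \<Longrightarrow> w (x + z) = w x"
begin

lemma w_1: "w 1 = 0"
  using w_mult[of 1 1] one_notin by simp

lemma uminus_in_iff: "- x \<in> Z \<longleftrightarrow> x \<in> Z"
  using mult_in[of x "- 1"] mult_in[of "- x" "- 1"] by auto

lemma w_uminus: "w (- x) = w x" if "x \<notin> Z"
proof -
  have "- 1 \<notin> Z" using one_notin uminus_in_iff by blast
  then have "w (- 1) + w (- 1) = 0" using w_mult[of "- 1" "- 1"] w_1 by simp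
  then show ?thesis using w_mult[of "- 1" x] that \<open>- 1 \<notin> Z\<close> by simp
qed

lemma add_notin: "x \<notin> Z \<Longrightarrow> z \<in> Z \<Longrightarrow> x + z \<notin> Z"
  using add_in[of "x + z" "- z"] uminus_in_iff[of z] by auto

lemma strict_triangle:
  assumes "x \<notin> Z" "y \<notin> Z" "w x < w y"
  shows "x + y \<notin> Z" and "w (x + y) = w x"
proof -
  have y': "- y \<notin> Z" "w (- y) = w y" using assms uminus_in_iff w_uminus by auto
  show xy: "x + y \<notin> Z"
  proof
    assume "x + y \<in> Z"
    then have "w (- y + (x + y)) = w (- y)" using w_cong y' by blast
    then show False using y' assms by simp
  qed
  have "min (w (x + y)) (w (- y)) \<le> w x" using w_add[OF xy y'(1)] assms by simp
  moreover have "min (w x) (w y) \<le> w (x + y)" using w_add assms xy by blast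
  ultimately show "w (x + y) = w x" using assms y' by linarith
qed

lemma w_power: "x \<notin> Z \<Longrightarrow> x ^ n \<notin> Z \<and> w (x ^ n) = int n * w x"
  by (induction n) (auto simp: one_notin w_1 mult_notin w_mult algebra_simps)

text \<open>
  The new summand and the sum of the previous ones have different values, so the smaller one prevails.
\<close>

lemma sum_distinct:
  assumes "finite J" "J \<noteq> {}" "\<And>j. j \<in> J \<Longrightarrow> h j \<notin> Z" "inj_on (\<lambda>j. w (h j)) J"
  shows "sum h J \<notin> Z \<and> w (sum h J) = Min ((\<lambda>j. w (h j)) ` J)"
  using assms
proof (induction J rule: finite_ne_induct)
  case (singleton j)
  then show ?case by simp
next
  case (insert j J)
  let ?v = "\<lambda>j. w (h j)"
  have IH: "sum h J \<notin> Z" "w (sum h J) = Min (?v ` J)" using insert by auto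
  have jZ: "h j \<notin> Z" using insert by simp
  have "Min (?v ` J) \<in> ?v ` J" using insert by (intro Min_in) auto
  moreover have "?v j \<notin> ?v ` J" using insert by (auto simp: inj_on_def)
  ultimately have ne: "?v j \<noteq> w (sum h J)" using IH by metis
  have Min: "Min (?v ` insert j J) = min (?v j) (w (sum h J))" using insert IH by simp
  have S: "sum h (insert j J) = h j + sum h J" using insert by simp
  show ?case
  proof (cases "?v j < w (sum h J)")
    case True
    then show ?thesis using strict_triangle[OF jZ IH(1)] Min S by (simp add: min_def)
  next
    case False
    then have "w (sum h J) < ?v j" using ne by simp
    then show ?thesis using strict_triangle[OF IH(1) jZ] Min S by (simp add: min_def add.commute)
  qed
qed

definition integral :: "'b set" where "integral = {x. x \<in> Z \<or> 0 \<le> w x}"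

lemma integral_add: "x \<in> integral \<Longrightarrow> y \<in> integral \<Longrightarrow> x + y \<in> integral"
  using w_add[of x y] w_cong[of x y] w_cong[of y x] add_in[of x y]
  by (cases "x \<in> Z"; cases "y \<in> Z"; cases "x + y \<in> Z") (auto simp: integral_def add.commute)

lemma integral_mult: "x \<in> integral \<Longrightarrow> y \<in> integral \<Longrightarrow> x * y \<in> integral"
  using w_mult[of x y] mult_in[of x y] mult_in[of y x]
  by (cases "x \<in> Z"; cases "y \<in> Z") (auto simp: integral_def mult.commute)

end

lemma semivaluation_fls: "semivaluation {0} (fls_subdegree :: 'b::field fls \<Rightarrow> int)"
  by standard (auto simp: fls_subdegree_mult fls_plus_subdegree)

lemma semivaluation_vimage:
  assumes "semivaluation Z w" and "comm_ring_hom \<Phi>"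
  shows "semivaluation (\<Phi> -` Z) (w \<circ> \<Phi>)"
proof -
  interpret semivaluation Z w by fact
  interpret comm_ring_hom \<Phi> by fact
  show ?thesis
    by standard (auto simp: hom_distribs zero_in one_notin add_in mult_in mult_notin w_mult w_add w_cong)
qed

section \<open>Semivaluations with a pole of x\<close>

text \<open>
  The degree of a rational function, numerator minus denominator; it does not depend on the fraction
  that is chosen (\<open>fdeg_eq\<close>).
\<close>

definition fdeg :: "'a::field poly fract \<Rightarrow> int" where
  "fdeg r = (let (a, b) = SOME (a, b). b \<noteq> 0 \<and> r = to_fract a / to_fract b
    in int (degree a) - int (degree b))"

lemma fract_cases:
  obtains a b :: "'a::idom" where "b \<noteq> 0" "r = to_fract a / to_fract b"
  by (cases r) (metis Fract_conv_to_fract)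

lemma fdeg_eq:
  assumes "b \<noteq> 0" "a \<noteq> 0" "r = to_fract a / to_fract b"
  shows "fdeg r = int (degree a) - int (degree b)"
proof -
  obtain a' b' where ab': "(SOME (a, b). b \<noteq> 0 \<and> r = to_fract a / to_fract b) = (a', b')" by force
  have "case (a', b') of (a, b) \<Rightarrow> b \<noteq> 0 \<and> r = to_fract a / to_fract b"
    unfolding ab'[symmetric] by (rule someI[of _ "(a, b)"]) (use assms in simp)
  then have b': "b' \<noteq> 0" "r = to_fract a' / to_fract b'" by auto
  then have "to_fract a * to_fract b' = to_fract a' * to_fract b"
    using assms by (simp add: field_simps)
  then have eq: "a * b' = a' * b" by (metis to_fract_eq_iff to_fract_mult)
  then have "a' \<noteq> 0" using assms b' by auto
  then have "degree a + degree b' = degree a' + degree b"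
    using arg_cong[OF eq, of degree] assms b' by (simp add: degree_mult_eq)
  then show ?thesis by (simp add: fdeg_def ab')
qed

definition gen_x :: "'a::field poly fract poly" where "gen_x = [:to_fract [:0, 1:]:]"
definition gen_y :: "'a::field poly fract poly" where "gen_y = [:0, 1:]"

abbreviation curve_fract :: "nat \<Rightarrow> nat \<Rightarrow> 'a::field poly fract poly" where
  "curve_fract q l \<equiv> fract_poly (curve_poly q l)"

lemma const_poly_sum:
  fixes f :: "'c \<Rightarrow> 'b::comm_ring_1"
  shows "[:sum f A:] = (\<Sum>a\<in>A. [:f a:])"
proof -
  have add: "[:a + b:] = [:a:] + [:b:]" for a b :: 'b by simp
  show ?thesis
    by (induction A rule: infinite_finite_induct)
      (simp_all only: sum.infinite sum.empty sum.insert add pCons_0_0 not_False_eq_True)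
qed

lemma fract_poly_monom: "fract_poly (monom c n) = monom (to_fract c) n"
  by (simp add: map_poly_monom)

lemma const_monom_eq_gen_x_power: "[:to_fract (monom 1 n):] = gen_x ^ n"
proof -
  have "to_fract ([:0, 1:] ^ n) = to_fract [:0, 1:] ^ n" for n
    by (induction n) (simp_all only: power_0 power_Suc to_fract_1 to_fract_mult)
  then show ?thesis by (simp add: gen_x_def poly_const_pow monom_altdef)
qed

lemma curve_fract_eq: "curve_fract q l = gen_y ^ q - gen_y - (gen_x :: 'a::field poly fract poly) ^ l"
proof -
  have m: "monom 1 n = (gen_y :: 'a poly fract poly) ^ n" for n
    by (simp add: gen_y_def monom_altdef)
  have "(curve_fract q l :: 'a poly fract poly) = monom 1 q - monom 1 1 - [:to_fract (monom 1 l):]"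
    by (simp add: curve_poly_def fract_poly_monom map_poly_pCons del: One_nat_def)
  then show ?thesis by (simp only: m const_monom_eq_gen_x_power power_one_right)
qed

lemma monom_eq_const_times_gen_y_power: "monom r j = [:r:] * gen_y ^ j"
  by (simp add: gen_y_def monom_altdef)

text \<open>
  The pole order at infinity of \<open>h = \<Sum> r\<^sub>j(x) y^j\<close> with \<open>j < q\<close>, by
  \<open>w_eq_weight\<close> below.
\<close>

definition weight :: "nat \<Rightarrow> nat \<Rightarrow> 'a::field poly fract poly \<Rightarrow> int" where
  "weight q l h = Max ((\<lambda>j. int q * fdeg (coeff h j) + int l * int j) ` {j. coeff h j \<noteq> 0})"

locale pole_semivaluation = coprime_pair q l + semivaluation Z w
  for q l :: nat and Z :: "'a::field poly fract poly set" and w +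
  assumes q_gt_1: "q > 1"
    and w_const: "c \<noteq> 0 \<Longrightarrow> w [:to_fract [:c:]:] = 0"
    and curve_in: "curve_fract q l \<in> Z"
    and gen_x_notin: "gen_x \<notin> Z" and w_gen_x_neg: "w gen_x < 0"
begin

lemma const_notin: "r \<noteq> 0 \<Longrightarrow> [:r:] \<notin> Z"
  using mult_in[of "[:r:]" "[:inverse r:]"] one_notin by (auto simp: one_pCons)

text \<open>
  In the equation \<open>y^q - y = x^l\<close> a pole of \<open>x\<close> forces a pole of
  \<open>y\<close>, at which \<open>y^q\<close> dominates.
\<close>

lemma gen_y_pole: "gen_y \<notin> Z" "int q * w gen_y = int l * w gen_x"
proof -
  have Xl: "gen_x ^ l \<notin> Z" "w (gen_x ^ l) = int l * w gen_x" using w_power[OF gen_x_notin] by auto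
  have neg: "int l * w gen_x < 0" using l_pos w_gen_x_neg by (simp add: mult_pos_neg)
  have eq: "gen_y ^ q - gen_y = gen_x ^ l + (curve_fract q l :: 'a poly fract poly)" by (simp add: curve_fract_eq)
  show gen_y: "gen_y \<notin> Z"
  proof
    assume "gen_y \<in> Z"
    then have "gen_y ^ q \<in> Z" using mult_in[of gen_y "gen_y ^ (q - 1)"] q_gt_1 by (simp flip: power_Suc)
    then have "gen_y ^ q + (- gen_y) \<in> Z" using add_in \<open>gen_y \<in> Z\<close> uminus_in_iff by blast
    then show False using add_notin[OF Xl(1) curve_in] eq by simp
  qed
  have val: "w (gen_y ^ q + - gen_y) = int l * w gen_x" and notin: "gen_y ^ q + - gen_y \<notin> Z"
    using w_cong[OF Xl(1) curve_in] add_notin[OF Xl(1) curve_in] eq Xl by simp_all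
  have Yq: "gen_y ^ q \<notin> Z" "w (gen_y ^ q) = int q * w gen_y" using w_power[OF gen_y] by auto
  have Ym: "- gen_y \<notin> Z" "w (- gen_y) = w gen_y" using gen_y uminus_in_iff w_uminus by auto
  have "w gen_y < 0"
  proof (rule ccontr)
    assume nn: "\<not> w gen_y < 0"
    then have "0 \<le> int q * w gen_y" by simp
    then have "0 \<le> w (gen_y ^ q + - gen_y)" using w_add[OF Yq(1) Ym(1) notin] Yq Ym nn by linarith
    then show False using val neg by simp
  qed
  then have "int q * w gen_y < 1 * w gen_y" using q_gt_1 by (intro mult_strict_right_mono_neg) auto
  then have "w (gen_y ^ q + - gen_y) = w (gen_y ^ q)" using strict_triangle(2)[OF Yq(1) Ym(1)] Yq Ym by simp
  then show "int q * w gen_y = int l * w gen_x" using val Yq by simp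
qed

text \<open>
  From \<open>q w(y) = l w(x)\<close> and coprimality.
\<close>

lemma pole_order: "\<exists>c>0. w gen_x = - (int q * c) \<and> w gen_y = - (int l * c)"
proof -
  have "int q dvd int l * w gen_x" using gen_y_pole(2) by (metis dvd_triv_left)
  then have "int q dvd w gen_x" using coprime coprime_dvd_mult_right_iff[of "int q" "int l"] by simp
  then obtain c' where c': "w gen_x = int q * c'" by blast
  then have "int q * w gen_y = int q * (int l * c')" using gen_y_pole(2) by simp
  then have "w gen_y = int l * c'" using q_pos by simp
  moreover have "c' < 0" using w_gen_x_neg c' q_pos by (simp add: mult_less_0_iff)
  ultimately show ?thesis using c' by (intro exI[of _ "- c'"]) simp
qed

definition ord where "ord = (SOME c. c > 0 \<and> w gen_x = - (int q * c) \<and> w gen_y = - (int l * c))"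

lemma ord: "ord > 0" "w gen_x = - (int q * ord)" "w gen_y = - (int l * ord)"
proof -
  have "ord > 0 \<and> w gen_x = - (int q * ord) \<and> w gen_y = - (int l * ord)"
    unfolding ord_def by (rule someI_ex[OF pole_order])
  then show "ord > 0" "w gen_x = - (int q * ord)" "w gen_y = - (int l * ord)" by blast+
qed

lemma w_poly:
  assumes "p \<noteq> 0"
  shows "w [:to_fract p:] = - (int q * ord * int (degree p))"
proof -
  let ?J = "{i. coeff p i \<noteq> 0}"
  have fin: "finite ?J" by (rule finite_subset[of _ "{..degree p}"]) (auto intro: le_degree)
  have deg: "degree p \<in> ?J" using assms by simp
  define h where "h i = [:to_fract [:coeff p i:]:] * gen_x ^ i" for i
  have "p = (\<Sum>i\<in>?J. monom (coeff p i) i)"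
  proof -
    have "p = (\<Sum>i\<le>degree p. monom (coeff p i) i)" by (simp add: poly_as_sum_of_monoms)
    also have "\<dots> = (\<Sum>i\<in>?J. monom (coeff p i) i)"
      by (rule sum.mono_neutral_right) (auto intro: le_degree)
    finally show ?thesis .
  qed
  then have "[:to_fract p:] = [:to_fract (\<Sum>i\<in>?J. monom (coeff p i) i):]"
    by (rule arg_cong)
  also have "\<dots> = (\<Sum>i\<in>?J. [:to_fract (monom (coeff p i) i):])"
    by (simp only: to_fract_sum const_poly_sum)
  also have "\<dots> = sum h ?J"
  proof (rule sum.cong[OF refl])
    fix i
    have "monom (coeff p i) i = [:coeff p i:] * monom 1 i" by (simp add: smult_monom)
    then have "to_fract (monom (coeff p i) i) = to_fract [:coeff p i:] * to_fract (monom 1 i)"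
      by (simp only: to_fract_mult)
    then have "[:to_fract (monom (coeff p i) i):] = [:to_fract [:coeff p i:]:] * [:to_fract (monom 1 i):]"
      by simp
    then show "[:to_fract (monom (coeff p i) i):] = h i"
      by (simp only: h_def const_monom_eq_gen_x_power)
  qed
  finally have S: "[:to_fract p:] = sum h ?J" .
  have hi: "h i \<notin> Z \<and> w (h i) = - (int q * ord * int i)" if "i \<in> ?J" for i
  proof -
    have c: "[:to_fract [:coeff p i:]:] \<notin> Z" using that const_notin[of "to_fract [:coeff p i:]"] by simp
    have "w [:to_fract [:coeff p i:]:] = 0" using that by (intro w_const) simp
    then have "w (h i) = int i * w gen_x" "h i \<notin> Z"
      using mult_notin[OF c, of "gen_x ^ i"] w_mult[OF c, of "gen_x ^ i"] w_power[OF gen_x_notin, of i]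
      unfolding h_def by (simp_all only: simp_thms add_0_left)
    then show ?thesis by (simp add: ord(2) algebra_simps)
  qed
  have c: "int q * ord > 0" using q_pos ord(1) by simp
  have "inj_on (\<lambda>i. w (h i)) ?J"
    using c by (auto simp: inj_on_def hi)
  then have "w (sum h ?J) = Min ((\<lambda>i. w (h i)) ` ?J)"
    using sum_distinct[OF fin _ _] deg hi by blast
  also have "\<dots> = - (int q * ord * int (degree p))"
  proof (rule Min_eqI)
    fix y assume "y \<in> (\<lambda>i. w (h i)) ` ?J"
    then obtain i where i: "i \<in> ?J" "y = - (int q * ord * int i)" using hi by auto
    then have "i \<le> degree p" using le_degree by blast
    then show "- (int q * ord * int (degree p)) \<le> y"
      using i c by (simp add: mult_left_mono)
  qed (use fin deg hi in \<open>auto intro!: image_eqI[of _ _ "degree p"]\<close>)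
  finally show ?thesis by (simp add: S)
qed

lemma w_fract:
  assumes "r \<noteq> 0"
  shows "w [:r:] = - (int q * ord * fdeg r)"
proof -
  obtain a b where ab: "b \<noteq> 0" "r = to_fract a / to_fract b" by (rule fract_cases)
  then have a: "a \<noteq> 0" using assms by auto
  have "[:r:] * [:to_fract b:] = [:to_fract a:]" using ab by simp
  then have "w [:r:] + w [:to_fract b:] = w [:to_fract a:]"
    using w_mult[of "[:r:]" "[:to_fract b:]"] const_notin[OF assms] const_notin[of "to_fract b"] ab by simp
  then have "w [:r:] = w [:to_fract a:] - w [:to_fract b:]" by simp
  then show ?thesis
    unfolding w_poly[OF a] w_poly[OF ab(1)] fdeg_eq[OF ab(1) a ab(2)]
    by (simp add: right_diff_distrib)
qed

text \<open>
  The values of the terms of \<open>h\<close> are different modulo \<open>q * ord\<close>, so they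
  determine the value of \<open>h\<close>. In particular no nonzero \<open>h\<close> of degree less than
  \<open>q\<close> has value \<open>\<infinity>\<close>.
\<close>

lemma w_eq_weight:
  assumes h: "h \<noteq> 0" "degree h < q"
  shows "h \<notin> Z" and "w h = - (ord * weight q l h)"
proof -
  let ?J = "{j. coeff h j \<noteq> 0}"
  let ?wt = "\<lambda>j. int q * fdeg (coeff h j) + int l * int j"
  have J: "finite ?J" "?J \<noteq> {}" 
  proof -
    show "finite ?J" by (rule finite_subset[of _ "{..degree h}"]) (auto intro: le_degree)
    have "degree h \<in> ?J" using h by simp
    then show "?J \<noteq> {}" by blast
  qed
  have jq: "j < q" if "j \<in> ?J" for j using that le_degree[of h j] h(2) by simp
  define t where "t j = monom (coeff h j) j" for j
  have S: "h = sum t ?J"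
  proof -
    have "h = (\<Sum>j\<le>degree h. monom (coeff h j) j)" by (simp add: poly_as_sum_of_monoms)
    also have "\<dots> = sum t ?J"
      unfolding t_def by (rule sum.mono_neutral_right) (auto intro: le_degree)
    finally show ?thesis .
  qed
  have t: "t j \<notin> Z \<and> w (t j) = - (ord * ?wt j)" if "j \<in> ?J" for j
  proof -
    have r: "coeff h j \<noteq> 0" using that by simp
    have "w (t j) = w [:coeff h j:] + int j * w gen_y" "t j \<notin> Z"
      using mult_notin[OF const_notin[OF r], of "gen_y ^ j"] w_mult[OF const_notin[OF r], of "gen_y ^ j"]
        w_power[OF gen_y_pole(1), of j]
      unfolding t_def monom_eq_const_times_gen_y_power by (simp_all only: simp_thms)
    then show ?thesis by (simp add: w_fract[OF r] ord(3) algebra_simps)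
  qed
  have inj: "inj_on (\<lambda>j. w (t j)) ?J"
  proof (rule inj_onI)
    fix i j assume ij: "i \<in> ?J" "j \<in> ?J" "w (t i) = w (t j)"
    then have "ord * ?wt i = ord * ?wt j" using t[of i] t[of j] by linarith
    then have "?wt i = ?wt j" using ord(1) mult_left_cancel[of ord "?wt i" "?wt j"] by linarith
    then show "i = j" using weight_unique jq ij by blast
  qed
  have main: "sum t ?J \<notin> Z \<and> w (sum t ?J) = Min ((\<lambda>j. w (t j)) ` ?J)"
    using sum_distinct[OF J _ inj] t by blast
  then show "h \<notin> Z" using S by simp
  have "Max (?wt ` ?J) \<in> ?wt ` ?J" using J by (intro Max_in) auto
  then obtain j0 where j0: "j0 \<in> ?J" "Max (?wt ` ?J) = ?wt j0" by blast
  have "Min ((\<lambda>j. w (t j)) ` ?J) = - (ord * Max (?wt ` ?J))"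
  proof (rule Min_eqI)
    fix y assume "y \<in> (\<lambda>j. w (t j)) ` ?J"
    then obtain j where j: "j \<in> ?J" "y = - (ord * ?wt j)" using t by auto
    then have "?wt j \<le> Max (?wt ` ?J)" using J by (intro Max_ge) auto
    then show "- (ord * Max (?wt ` ?J)) \<le> y" using j ord(1) by (simp add: mult_left_mono)
  next
    have "w (t j0) = - (ord * Max (?wt ` ?J))" using t[OF j0(1)] j0(2) by simp
    then show "- (ord * Max (?wt ` ?J)) \<in> (\<lambda>j. w (t j)) ` ?J" using j0(1) by (metis image_eqI)
  qed (use J in simp)
  then show "w h = - (ord * weight q l h)" using main S by (simp add: weight_def)
qed

end

section \<open>Evaluation at a point of the curve over an extension field\<close>

text \<open>
  A point \<open>(x, y)\<close> of the curve over an extension field whose first coordinate is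
  transcendental. Evaluation of rational functions at \<open>x\<close> (\<open>\<theta>\<close>) and
  then of polynomials at \<open>y\<close> (\<open>\<Phi>\<close>) are ring homomorphisms.
\<close>

locale curve_embedding =
  fixes q l :: nat and \<iota> :: "'a::field \<Rightarrow> 'b::field" and x y :: 'b
  assumes \<iota>_hom: "comm_ring_hom \<iota>"
    and transcendental: "p \<noteq> 0 \<Longrightarrow> poly (map_poly \<iota> p) x \<noteq> 0"
    and on_curve: "y ^ q - y = x ^ l"
begin

sublocale \<iota>: comm_ring_hom \<iota> by (rule \<iota>_hom)

sublocale mp\<iota>: map_poly_comm_ring_hom \<iota> ..

definition ev :: "'a poly \<Rightarrow> 'b" where "ev p = poly (map_poly \<iota> p) x"

lemma ev_simps: "ev (a + b) = ev a + ev b" "ev (a * b) = ev a * ev b" "ev 0 = 0" "ev 1 = 1"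
  "ev a = 0 \<longleftrightarrow> a = 0" "ev [:c:] = \<iota> c" "ev [:0, 1:] = x"
  using transcendental[of a] by (auto simp: ev_def hom_distribs)

definition \<theta> :: "'a poly fract \<Rightarrow> 'b" where
  "\<theta> r = (let (a, b) = SOME (a, b). b \<noteq> 0 \<and> r = to_fract a / to_fract b in ev a / ev b)"

lemma \<theta>_eq:
  assumes "b \<noteq> 0" "r = to_fract a / to_fract b"
  shows "\<theta> r = ev a / ev b"
proof -
  obtain a' b' where ab': "(SOME (a, b). b \<noteq> 0 \<and> r = to_fract a / to_fract b) = (a', b')" by force
  have "case (a', b') of (a, b) \<Rightarrow> b \<noteq> 0 \<and> r = to_fract a / to_fract b"
    unfolding ab'[symmetric] by (rule someI[of _ "(a, b)"]) (use assms in simp)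
  then have b': "b' \<noteq> 0" "r = to_fract a' / to_fract b'" by auto
  then have "to_fract a * to_fract b' = to_fract a' * to_fract b"
    using assms by (simp add: field_simps)
  then have "a * b' = a' * b" by (metis to_fract_eq_iff to_fract_mult)
  then have "ev a * ev b' = ev a' * ev b" by (metis ev_simps(2))
  then show ?thesis using b' assms by (simp add: \<theta>_def ab' ev_simps field_simps)
qed

lemma \<theta>_to_fract: "\<theta> (to_fract a) = ev a"
  using \<theta>_eq[of 1 "to_fract a" a] by (simp add: ev_simps)

lemma \<theta>_hom: "comm_ring_hom \<theta>"
proof
  show "\<theta> 0 = 0" "\<theta> 1 = 1" using \<theta>_to_fract[of 0] \<theta>_to_fract[of 1] by (simp_all add: ev_simps)
  fix r s :: "'a poly fract"
  obtain a b where ab: "b \<noteq> 0" "r = to_fract a / to_fract b" by (rule fract_cases)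
  obtain c d where cd: "d \<noteq> 0" "s = to_fract c / to_fract d" by (rule fract_cases)
  have "r + s = to_fract (a * d + c * b) / to_fract (b * d)" using ab cd by (simp add: field_simps)
  then have "\<theta> (r + s) = ev (a * d + c * b) / ev (b * d)" using ab cd by (intro \<theta>_eq) auto
  moreover have "ev a / ev b + ev c / ev d = (ev a * ev d + ev c * ev b) / (ev b * ev d)"
    by (rule add_frac_eq) (use ab cd in \<open>simp_all add: ev_simps\<close>)
  ultimately show "\<theta> (r + s) = \<theta> r + \<theta> s"
    by (simp only: \<theta>_eq[OF ab] \<theta>_eq[OF cd] ev_simps)
  have "r * s = to_fract (a * c) / to_fract (b * d)" using ab cd by simp
  then have "\<theta> (r * s) = ev (a * c) / ev (b * d)" using ab cd by (intro \<theta>_eq) auto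
  then show "\<theta> (r * s) = \<theta> r * \<theta> s"
    by (simp only: \<theta>_eq[OF ab] \<theta>_eq[OF cd] ev_simps times_divide_times_eq)
qed

sublocale \<theta>: comm_ring_hom \<theta> by (rule \<theta>_hom)

sublocale mp\<theta>: map_poly_comm_ring_hom \<theta> ..

definition \<Phi> :: "'a poly fract poly \<Rightarrow> 'b" where "\<Phi> h = poly (map_poly \<theta> h) y"

lemma \<Phi>_hom: "comm_ring_hom \<Phi>"
  by standard (simp_all add: \<Phi>_def hom_distribs)

sublocale \<Phi>: comm_ring_hom \<Phi> by (rule \<Phi>_hom)

lemma \<Phi>_const: "\<Phi> [:r:] = \<theta> r" by (simp add: \<Phi>_def hom_distribs)

lemma \<Phi>_gen_x: "\<Phi> gen_x = x" by (simp add: gen_x_def \<Phi>_const \<theta>_to_fract ev_simps)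

lemma \<Phi>_gen_y: "\<Phi> gen_y = y" by (simp add: gen_y_def \<Phi>_def hom_distribs)

lemma \<Phi>_curve: "\<Phi> (curve_fract q l) = 0"
  by (simp add: curve_fract_eq hom_distribs \<Phi>_gen_x \<Phi>_gen_y on_curve)

lemma \<Phi>_constant: "\<Phi> [:to_fract [:c:]:] = \<iota> c"
  by (simp add: \<Phi>_const \<theta>_to_fract ev_simps)

lemma \<Phi>_sum: "\<Phi> h = (\<Sum>j\<le>degree h. \<theta> (coeff h j) * y ^ j)"
proof -
  have "\<Phi> h = \<Phi> (\<Sum>j\<le>degree h. monom (coeff h j) j)"
    by (simp add: poly_as_sum_of_monoms)
  also have "\<dots> = (\<Sum>j\<le>degree h. \<theta> (coeff h j) * y ^ j)"
    by (simp only: \<Phi>.hom_sum monom_eq_const_times_gen_y_power \<Phi>.hom_mult \<Phi>.hom_power \<Phi>_const \<Phi>_gen_y)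
  finally show ?thesis .
qed

lemma \<theta>_nonzero: "r \<noteq> 0 \<Longrightarrow> \<theta> r \<noteq> 0"
  using \<theta>.hom_mult[of r "inverse r"] by auto

lemma \<Phi>_mod: "\<Phi> (h mod curve_fract q l) = \<Phi> h"
proof -
  have "\<Phi> h = \<Phi> (curve_fract q l * (h div curve_fract q l) + h mod curve_fract q l)"
    by (simp only: mult_div_mod_eq)
  also have "\<dots> = \<Phi> (h mod curve_fract q l)"
    by (simp only: \<Phi>.hom_add \<Phi>.hom_mult \<Phi>_curve mult_zero_left add_0_left)
  finally show ?thesis ..
qed

end

section \<open>Elements of the function field\<close>

lemma curve_fract_monom:
  "(curve_fract q l :: 'a::field poly fract poly) = monom 1 q - monom 1 1 - [:to_fract (monom 1 l):]"
  by (simp add: curve_poly_def fract_poly_monom map_poly_pCons del: One_nat_def)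

lemma degree_curve_fract:
  assumes "q > 1"
  shows "degree (curve_fract q l :: 'a::field poly fract poly) = q"
proof -
  have "degree (monom (1::'a poly fract) q - monom 1 1) = q"
    using assms by (subst degree_diff_eq_left) (auto simp: degree_monom_eq)
  then show ?thesis
    unfolding curve_fract_monom using assms by (subst degree_diff_eq_left) auto
qed

lemma mod_curve_eq_iff:
  assumes "q > 1"
  shows "h mod curve_fract q l = h \<longleftrightarrow> degree h < q"
proof
  assume "degree h < q"
  then show "h mod curve_fract q l = h" by (intro mod_poly_less) (simp add: degree_curve_fract[OF assms])
next
  assume h: "h mod curve_fract q l = h"
  have "curve_fract q l \<noteq> 0" using degree_curve_fract[OF assms, of l] assms by (metis degree_0 not_one_less_zero)
  then show "degree h < q"
    using degree_mod_less[of "curve_fract q l" h] h assms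
    by (cases "h = 0") (auto simp: degree_curve_fract[OF assms])
qed

lemma function_field_simps:
  assumes "q > 1"
  shows "carrier (function_field (curve_poly q l)) = {h. degree h < q}"
    "\<zero>\<^bsub>function_field (curve_poly q l)\<^esub> = 0"
    "g \<otimes>\<^bsub>function_field (curve_poly q l)\<^esub> h = (g * h) mod curve_fract q l"
    "g \<oplus>\<^bsub>function_field (curve_poly q l)\<^esub> h = g + h"
  by (simp_all add: function_field_def mod_curve_eq_iff[OF assms])

lemma coord_simps:
  assumes "q > 1"
  shows "coord_x (curve_poly q l) = (gen_x :: 'a::field poly fract poly)"
    "coord_y (curve_poly q l) = (gen_y :: 'a poly fract poly)"
proof -
  have "gen_x mod curve_fract q l = (gen_x :: 'a poly fract poly)" "gen_y mod curve_fract q l = (gen_y :: 'a poly fract poly)"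
    unfolding mod_curve_eq_iff[OF assms] using assms by (simp_all add: gen_x_def gen_y_def)
  then show "coord_x (curve_poly q l) = (gen_x :: 'a poly fract poly)" "coord_y (curve_poly q l) = (gen_y :: 'a poly fract poly)"
    by (simp_all add: coord_x_def coord_y_def gen_x_def gen_y_def)
qed

section \<open>The embedding at infinity\<close>

text \<open>
  The series \<open>(1 + X)^l - 1\<close> has linear coefficient \<open>l \<noteq> 0\<close> and hence a
  compositional inverse. Substituting \<open>u - 1\<close> into the inverse yields an
  \<open>l\<close>-th root of \<open>u\<close>.
\<close>

lemma fps_ex_root:
  fixes u :: "'a::field fps"
  assumes l: "of_nat l \<noteq> (0::'a)" and u: "fps_nth u 0 = 1"
  shows "\<exists>z. z ^ l = u \<and> fps_nth z 0 = 1"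
proof -
  define \<phi> where "\<phi> = (1 + fps_X :: 'a fps) ^ l - 1"
  have 0: "fps_nth \<phi> 0 = 0" by (simp add: \<phi>_def fps_power_zeroth)
  have "fps_nth ((1 + fps_X :: 'a fps) ^ n) 1 = of_nat n" for n
    by (induction n) (simp_all add: fps_mult_nth fps_power_zeroth)
  then have 1: "fps_nth \<phi> 1 \<noteq> 0" using l by (simp add: \<phi>_def)
  define s where "s = fps_inv \<phi> oo (u - 1)"
  have inv0: "fps_nth (fps_inv \<phi>) 0 = 0" by (simp add: fps_inv_def)
  have s0: "fps_nth s 0 = 0" by (simp add: s_def inv0)
  have "\<phi> oo s = (\<phi> oo fps_inv \<phi>) oo (u - 1)"
    unfolding s_def by (rule fps_compose_assoc) (simp_all add: u inv0)
  also have "\<dots> = u - 1" by (simp add: fps_inv_right[OF 0 1] u)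
  finally have "\<phi> oo s = u - 1" .
  moreover have "\<phi> oo s = (1 + s) ^ l - 1"
    by (simp add: \<phi>_def fps_compose_sub_distrib fps_compose_add_distrib s0 flip: fps_compose_power[OF s0])
  ultimately have "(1 + s) ^ l = u" by simp
  then show ?thesis using s0 by (intro exI[of _ "1 + s"]) simp
qed

lemma comm_ring_hom_fls_const: "comm_ring_hom (fls_const :: 'b::comm_ring_1 \<Rightarrow> 'b fls)"
  by standard (simp_all add: fls_plus_const)

text \<open>
  The powers of \<open>x\<close> have different subdegrees, so a nontrivial linear combination of them
  is not \<open>0\<close>.
\<close>

lemma fls_transcendental_of_negative_subdegree:
  fixes x :: "'b::field fls"
  assumes "fls_subdegree x < 0" "p \<noteq> 0"
  shows "poly (map_poly fls_const p) x \<noteq> 0"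
proof -
  interpret semivaluation "{0}" "fls_subdegree :: 'b fls \<Rightarrow> int" by (rule semivaluation_fls)
  let ?J = "{i. coeff p i \<noteq> 0}"
  have fin: "finite ?J" by (rule finite_subset[of _ "{..degree p}"]) (auto intro: le_degree)
  have ne: "?J \<noteq> {}" using assms(2) by (auto simp: poly_eq_iff)
  have x0: "x \<noteq> 0" using assms(1) by auto
  define h where "h i = fls_const (coeff p i) * x ^ i" for i
  have hi: "h i \<notin> {0} \<and> fls_subdegree (h i) = int i * fls_subdegree x" if "i \<in> ?J" for i
    using that w_power[of x i] x0 by (simp add: h_def fls_subdegree_mult)
  have "inj_on (\<lambda>i. fls_subdegree (h i)) ?J" using assms(1) by (auto simp: inj_on_def hi)
  then have "sum h ?J \<notin> {0}" using sum_distinct[OF fin ne] hi by blast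
  moreover have "poly (map_poly fls_const p) x = sum h ?J"
  proof -
    have "poly (map_poly fls_const p) x = (\<Sum>i\<le>degree p. h i)"
      by (simp add: poly_altdef degree_map_poly coeff_map_poly h_def)
    also have "\<dots> = sum h ?J" by (rule sum.mono_neutral_right) (auto intro: le_degree simp: h_def)
    finally show ?thesis .
  qed
  ultimately show ?thesis by simp
qed

context curve
begin

lemma of_nat_l: "of_nat l \<noteq> (0::'a)"
  using gcd_p_l prime_p CHAR_eq by (metis gcd_nat.absorb1 not_prime_1 of_nat_eq_0_iff_char_dvd)

lemma q_gt_1: "q > 1" using q_ge_3 by linarith

definition root_inf :: "'a fps" where
  "root_inf = (SOME z. z ^ l = 1 - fps_X ^ (l * (q - 1)) \<and> fps_nth z 0 = 1)"

lemma root_inf: "root_inf ^ l = 1 - fps_X ^ (l * (q - 1))" "fps_nth root_inf 0 = 1"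
proof -
  have "l * (q - 1) \<noteq> 0" using l_pos q_gt_1 by simp
  then have "fps_nth (1 - fps_X ^ (l * (q - 1)) :: 'a fps) 0 = 1" by simp
  from someI_ex[OF fps_ex_root[OF of_nat_l this]]
  have "root_inf ^ l = 1 - fps_X ^ (l * (q - 1)) \<and> fps_nth root_inf 0 = 1"
    unfolding root_inf_def .
  then show "root_inf ^ l = 1 - fps_X ^ (l * (q - 1))" "fps_nth root_inf 0 = 1" by blast+
qed

text \<open>
  The parametrization of the curve near infinity, with poles of orders \<open>q\<close> and
  \<open>l\<close>.
\<close>

definition x_inf :: "'a fls" where "x_inf = fls_X_inv ^ q * fps_to_fls root_inf"
definition y_inf :: "'a fls" where "y_inf = fls_X_inv ^ l"

lemma subdegree_X_inv_power: "fls_subdegree ((fls_X_inv :: 'b::field fls) ^ n) = - int n"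
  by (induction n) (simp_all add: fls_subdegree_mult)

lemma subdegree_x_inf: "fls_subdegree x_inf = - int q"
proof -
  have "root_inf \<noteq> 0" using root_inf(2) by auto
  moreover have "subdegree root_inf = 0" using root_inf(2) by simp
  ultimately show ?thesis
    by (simp add: x_inf_def fls_subdegree_mult subdegree_X_inv_power fls_subdegree_fls_to_fps)
qed

lemma on_curve_inf: "y_inf ^ q - y_inf = x_inf ^ l"
proof -
  define n where "n = l * (q - 1)"
  have ql: "q * l = l + n" using q_gt_1 by (simp add: n_def algebra_simps)
  have inv: "(fls_X_inv :: 'a fls) ^ n * fls_X ^ n = 1"
  proof -
    have "(fls_X_inv :: 'a fls) * fls_X = 1" by (simp add: fls_X_inv_times_conv_shift)
    then show ?thesis by (simp flip: power_mult_distrib)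
  qed
  have "x_inf ^ l = fls_X_inv ^ (q * l) * fps_to_fls (root_inf ^ l)"
    by (simp add: x_inf_def power_mult_distrib power_mult fps_to_fls_power)
  also have "fps_to_fls (root_inf ^ l) = 1 - fls_X ^ n"
    unfolding root_inf(1) n_def [symmetric] by (simp add: fps_to_fls_minus fps_to_fls_power)
  also have "fls_X_inv ^ (q * l) * (1 - fls_X ^ n) =
      fls_X_inv ^ (q * l) - fls_X_inv ^ l * (fls_X_inv ^ n * (fls_X ^ n :: 'a fls))"
    by (simp add: ql power_add right_diff_distrib mult.assoc)
  also have "\<dots> = y_inf ^ q - y_inf"
    unfolding inv by (simp add: y_inf_def mult.commute flip: power_mult)
  finally show ?thesis ..
qed

lemma embedding_inf: "curve_embedding q l fls_const x_inf y_inf"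
proof (rule curve_embedding.intro)
  show "poly (map_poly fls_const p) x_inf \<noteq> 0" if "p \<noteq> 0" for p
    using subdegree_x_inf q_gt_1 that by (intro fls_transcendental_of_negative_subdegree) auto
qed (rule comm_ring_hom_fls_const on_curve_inf)+

sublocale inf: curve_embedding q l fls_const x_inf y_inf by (rule embedding_inf)

lemma pole_semivaluation_inf: "pole_semivaluation q l (inf.\<Phi> -` {0}) (fls_subdegree \<circ> inf.\<Phi>)"
proof -
  interpret sv: semivaluation "inf.\<Phi> -` {0}" "fls_subdegree \<circ> inf.\<Phi>"
    by (rule semivaluation_vimage[OF semivaluation_fls inf.\<Phi>_hom])
  have "x_inf \<noteq> 0" using subdegree_x_inf q_gt_1 by auto
  then show ?thesis
    using q_gt_1 subdegree_x_inf
    by unfold_locales (auto simp: inf.\<Phi>_constant inf.\<Phi>_curve inf.\<Phi>_gen_x)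
qed

sublocale pinf: pole_semivaluation q l "inf.\<Phi> -` {0}" "fls_subdegree \<circ> inf.\<Phi>"
  by (rule pole_semivaluation_inf)

lemma \<Phi>_inf_nonzero: "h \<noteq> 0 \<Longrightarrow> degree h < q \<Longrightarrow> inf.\<Phi> h \<noteq> 0"
  using pinf.w_eq_weight(1)[of h] by simp

lemma ord_inf: "pinf.ord = 1"
  using pinf.ord(2) q_gt_1 by (simp add: inf.\<Phi>_gen_x subdegree_x_inf)

lemma subdegree_\<Phi>_inf:
  "h \<noteq> 0 \<Longrightarrow> degree h < q \<Longrightarrow> fls_subdegree (inf.\<Phi> h) = - weight q l h"
  using pinf.w_eq_weight(2)[of h] by (simp add: ord_inf)

section \<open>Places\<close>

abbreviation "F \<equiv> function_field (curve_poly q l) :: 'a poly fract poly ring"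
abbreviation "f0 \<equiv> curve_fract q l :: 'a poly fract poly"

lemmas F_simps = function_field_simps[OF q_gt_1]

lemma f0_nonzero: "f0 \<noteq> 0"
  using degree_curve_fract[OF q_gt_1, of l, where 'a='a] q_gt_1 by auto

lemma degree_mod: "degree (h mod f0) < q"
  using degree_mod_less[OF f0_nonzero, of h] q_gt_1 by (auto simp: degree_curve_fract[OF q_gt_1])

text \<open>
  As the right hand side defines a prime ideal, this expresses that the curve is irreducible.
\<close>

lemma mod_eq_0_iff: "h mod f0 = 0 \<longleftrightarrow> inf.\<Phi> h = 0"
  using \<Phi>_inf_nonzero[OF _ degree_mod, of h] inf.\<Phi>_mod[of h] by auto

definition place_of :: "('a poly fract poly \<Rightarrow> 'b::field fls) \<Rightarrow> 'a poly fract poly \<Rightarrow> int" where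
  "place_of \<Phi> = restrict (\<lambda>h. fls_subdegree (\<Phi> h)) (carrier F - {0})"

text \<open>
  An embedding into Laurent series induces a place. Besides trivial values of the constants, injectivity
  on remainders and an element of value \<open>1\<close> are needed; the valuation axioms are those of
  the subdegree.
\<close>

lemma place_ofI:
  fixes x y :: "'b::field fls"
  assumes "curve_embedding q l \<iota> x y"
    and nonzero: "\<And>h. h \<noteq> 0 \<Longrightarrow> degree h < q \<Longrightarrow> curve_embedding.\<Phi> \<iota> x y h \<noteq> 0"
    and const: "\<And>c. c \<noteq> 0 \<Longrightarrow> fls_subdegree (\<iota> c) = 0"
    and unif: "t \<noteq> 0" "degree t < q" "fls_subdegree (curve_embedding.\<Phi> \<iota> x y t) = 1"
  shows "place_of (curve_embedding.\<Phi> \<iota> x y) \<in> places F constants"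
proof -
  interpret curve_embedding q l \<iota> x y by fact
  let ?v = "place_of \<Phi>"
  have v: "?v h = fls_subdegree (\<Phi> h)" if "h \<noteq> 0" "degree h < q" for h
    using that by (simp add: place_of_def F_simps)
  have arith: "?v (g \<otimes>\<^bsub>F\<^esub> h) = ?v g + ?v h \<and> (g \<oplus>\<^bsub>F\<^esub> h \<noteq> \<zero>\<^bsub>F\<^esub> \<longrightarrow> min (?v g) (?v h) \<le> ?v (g \<oplus>\<^bsub>F\<^esub> h))"
    if "g \<in> carrier F - {\<zero>\<^bsub>F\<^esub>}" "h \<in> carrier F - {\<zero>\<^bsub>F\<^esub>}" for g h
  proof -
    have g: "g \<noteq> 0" "degree g < q" and h: "h \<noteq> 0" "degree h < q"
      using that by (auto simp: F_simps)
    have nz: "\<Phi> g \<noteq> 0" "\<Phi> h \<noteq> 0" using nonzero g h by auto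
    have P: "\<Phi> ((g * h) mod f0) = \<Phi> g * \<Phi> h" by (simp only: \<Phi>_mod \<Phi>.hom_mult)
    then have "(g * h) mod f0 \<noteq> 0" using nz by auto
    then have "?v ((g * h) mod f0) = ?v g + ?v h"
      using v[of "(g * h) mod f0"] degree_mod P v[OF g] v[OF h] nz by (simp add: fls_subdegree_mult)
    moreover have "min (?v g) (?v h) \<le> ?v (g + h)" if "g + h \<noteq> 0"
    proof -
      have d: "degree (g + h) < q" using g h by (intro degree_add_less)
      then have "\<Phi> (g + h) \<noteq> 0" using nonzero that by blast
      then show ?thesis
        using fls_plus_subdegree[of "\<Phi> g" "\<Phi> h"] v[OF that d] v[OF g] v[OF h] by (simp add: \<Phi>.hom_add)
    qed
    ultimately show ?thesis by (simp add: F_simps)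
  qed
  have trivial: "?v c = 0" if "c \<in> constants - {\<zero>\<^bsub>F\<^esub>}" for c
  proof -
    obtain k where k: "c = [:to_fract [:k:]:]" "c \<noteq> 0" using \<open>c \<in> _\<close> by (auto simp: constants_def F_simps)
    then have "k \<noteq> 0" by auto
    then show ?thesis using v[of c] k q_gt_1 const by (simp add: \<Phi>_constant)
  qed
  have uniformizer: "\<exists>t\<in>carrier F - {\<zero>\<^bsub>F\<^esub>}. ?v t = 1"
    using unif v[of t] by (intro bexI[of _ t]) (simp_all add: F_simps)
  have ext: "?v \<in> extensional (carrier F - {\<zero>\<^bsub>F\<^esub>})"
    by (simp add: place_of_def F_simps)
  show ?thesis
    unfolding places_def
  proof (intro CollectI conjI ballI)
    fix g h assume gh: "g \<in> carrier F - {\<zero>\<^bsub>F\<^esub>}" "h \<in> carrier F - {\<zero>\<^bsub>F\<^esub>}"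
    show "?v (g \<otimes>\<^bsub>F\<^esub> h) = ?v g + ?v h" by (rule conjunct1[OF arith[OF gh]])
    show "g \<oplus>\<^bsub>F\<^esub> h \<noteq> \<zero>\<^bsub>F\<^esub> \<longrightarrow> min (?v g) (?v h) \<le> ?v (g \<oplus>\<^bsub>F\<^esub> h)"
      by (rule conjunct2[OF arith[OF gh]])
  qed (fact ext trivial uniformizer)+
qed

text \<open>
  This makes the computations for semivaluations apply to every place.
\<close>

lemma semivaluation_of_place:
  assumes v: "v \<in> places F constants"
  shows "semivaluation {h. h mod f0 = 0} (\<lambda>h. v (h mod f0))"
proof
  let ?Z = "{h. h mod f0 = 0}"
  have vm: "v ((g * h) mod f0) = v g + v h" "g + h \<noteq> 0 \<Longrightarrow> min (v g) (v h) \<le> v (g + h)"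
    if "g \<noteq> 0" "degree g < q" "h \<noteq> 0" "degree h < q" for g h
    using v that unfolding places_def F_simps by auto
  show "0 \<in> ?Z" by simp
  show "1 \<notin> ?Z" by (simp add: mod_eq_0_iff)
  show "g + h \<in> ?Z" if "g \<in> ?Z" "h \<in> ?Z" for g h using that by (simp add: mod_eq_0_iff hom_distribs)
  show "g * h \<in> ?Z" if "g \<in> ?Z" for g h using that by (simp add: mod_eq_0_iff hom_distribs)
  show "g * h \<notin> ?Z" if "g \<notin> ?Z" "h \<notin> ?Z" for g h using that by (simp add: mod_eq_0_iff hom_distribs)
  show "v (g * h mod f0) = v (g mod f0) + v (h mod f0)" if "g \<notin> ?Z" "h \<notin> ?Z" for g h
    using vm(1)[of "g mod f0" "h mod f0"] that degree_mod by (simp add: mod_mult_eq)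
  show "min (v (g mod f0)) (v (h mod f0)) \<le> v ((g + h) mod f0)"
    if "g \<notin> ?Z" "h \<notin> ?Z" "g + h \<notin> ?Z" for g h
    using vm(2)[of "g mod f0" "h mod f0"] that degree_mod by (simp add: poly_mod_add_left)
  show "v ((g + z) mod f0) = v (g mod f0)" if "g \<notin> ?Z" "z \<in> ?Z" for g z
    using that by (simp add: poly_mod_add_left)
qed

lemma place_constant:
  assumes "v \<in> places F constants" "c \<noteq> 0"
  shows "v ([:to_fract [:c:]:] mod f0) = 0"
proof -
  have "[:to_fract [:c:]:] mod f0 = [:to_fract [:c:]:]"
    unfolding mod_curve_eq_iff[OF q_gt_1] using q_gt_1 by simp
  then show ?thesis using assms unfolding places_def constants_def F_simps by auto
qed

text \<open>
  The place at infinity, as a formula that is comparable with an arbitrary place.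
\<close>

definition P_inf :: "'a poly fract poly \<Rightarrow> int" where
  "P_inf = restrict (\<lambda>h. - weight q l h) (carrier F - {0})"

lemma P_inf_eq: "P_inf = place_of inf.\<Phi>"
  unfolding P_inf_def place_of_def
  by (rule restrict_ext) (simp add: F_simps subdegree_\<Phi>_inf)

lemma P_inf_place: "P_inf \<in> places F constants"
proof -
  \<comment> \<open>\<open>x^(i - l) y^j\<close> has value \<open>1\<close> at infinity, because \<open>- 1 = q (i - l) + l j\<close>\<close>
  obtain i j where ij: "j < q" "int (q * l - 1) = int q * i + int l * int j"
    using weight_representation by blast
  have ql: "q * l \<ge> 1" using mult_pos_pos[OF q_pos l_pos] by linarith
  have eq: "int q * (int l - i) = 1 + int l * int j"
    using ij(2) ql by (simp add: of_nat_diff right_diff_distrib)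
  then have "0 < int q * (int l - i)" using mult_nonneg_nonneg[of "int l" "int j"] by linarith
  then have "0 < int l - i" by (simp add: zero_less_mult_iff)
  then obtain a where a: "int a = int l - i" by (metis nonneg_int_cases order_less_imp_le)
  define r :: "'a poly fract" where "r = to_fract 1 / to_fract (monom 1 a)"
  have r: "r \<noteq> 0" "fdeg r = - int a"
    using fdeg_eq[of "monom 1 a" 1 r] by (simp_all add: r_def degree_monom_eq)
  define t where "t = monom r j"
  have t: "t \<noteq> 0" "degree t < q" using r ij(1) by (simp_all add: t_def degree_monom_eq monom_eq_0_iff)
  have "{k. coeff t k \<noteq> 0} = {j}" using r by (auto simp: t_def)
  moreover have "int q * int a = 1 + int l * int j" unfolding a by (rule eq)
  then have "int q * (- int a) + int l * int j = - 1" by simp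
  ultimately have "weight q l t = - 1" using r by (simp add: weight_def t_def)
  then have "fls_subdegree (inf.\<Phi> t) = 1" using subdegree_\<Phi>_inf[OF t] by simp
  then show ?thesis
    unfolding P_inf_eq using t by (intro place_ofI embedding_inf \<Phi>_inf_nonzero) auto
qed

text \<open>
  By \<open>w_eq_weight\<close> a place at which \<open>x\<close> has a pole is a multiple of minus the
  weight, and normalization makes the factor \<open>1\<close>. A pole of \<open>y\<close> implies a pole
  of \<open>x\<close> by the equation of the curve.
\<close>

lemma place_with_pole_eq_P_inf:
  assumes v: "v \<in> places F constants" and pole: "v gen_x < 0 \<or> v gen_y < 0"
  shows "v = P_inf"
proof -
  interpret sv: semivaluation "{h. h mod f0 = 0}" "\<lambda>h. v (h mod f0)" by (rule semivaluation_of_place[OF v])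
  have x: "gen_x mod f0 = gen_x" and y: "gen_y mod f0 = gen_y"
    unfolding mod_curve_eq_iff[OF q_gt_1] using q_gt_1 by (simp_all add: gen_x_def gen_y_def)
  have nz: "gen_x \<noteq> (0 :: 'a poly fract poly)" "gen_y \<noteq> (0 :: 'a poly fract poly)"
    by (simp_all add: gen_x_def gen_y_def)
  have xZ: "gen_x \<notin> {h. h mod f0 = 0}" and yZ: "gen_y \<notin> {h. h mod f0 = 0}" using x y nz by auto
  have x_pole: "v gen_x < 0"
  proof (rule ccontr)
    assume nx: "\<not> v gen_x < 0"
    then have vy: "v gen_y < 0" using pole by simp
    have Yq: "gen_y ^ q \<notin> {h. h mod f0 = 0}" "v (gen_y ^ q mod f0) = int q * v gen_y"
      using sv.w_power[OF yZ, of q] y by auto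
    have Ym: "- gen_y \<notin> {h. h mod f0 = 0}" "v (- gen_y mod f0) = v gen_y"
      using sv.uminus_in_iff[of gen_y] yZ sv.w_uminus[OF yZ] y by auto
    have "int q * v gen_y < 1 * v gen_y" using vy q_gt_1 by (intro mult_strict_right_mono_neg) auto
    then have A: "v ((gen_y ^ q + - gen_y) mod f0) = int q * v gen_y"
      using sv.strict_triangle(2)[OF Yq(1) Ym(1)] Yq Ym by simp
    have "gen_x ^ l + f0 = gen_y ^ q + - gen_y" by (simp add: curve_fract_eq)
    moreover have Xl: "gen_x ^ l \<notin> {h. h mod f0 = 0}" "v (gen_x ^ l mod f0) = int l * v gen_x"
      using sv.w_power[OF xZ, of l] x by auto
    ultimately have "v ((gen_y ^ q + - gen_y) mod f0) = int l * v gen_x"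
      using sv.w_cong[OF Xl(1), of f0] by simp
    moreover have "0 \<le> int l * v gen_x" using nx by simp
    moreover have "int q * v gen_y < 0" using vy q_gt_1 by (simp add: mult_pos_neg)
    ultimately show False using A by linarith
  qed
  interpret pv: pole_semivaluation q l "{h. h mod f0 = 0}" "\<lambda>h. v (h mod f0)"
    by unfold_locales (use q_gt_1 place_constant[OF v] xZ x x_pole in auto)
  have val: "v h = - (pv.ord * weight q l h)" if "h \<noteq> 0" "degree h < q" for h
    using pv.w_eq_weight(2)[OF that] that by (simp add: mod_curve_eq_iff[OF q_gt_1, THEN iffD2])
  obtain t where t: "t \<noteq> 0" "degree t < q" "v t = 1"
    using v unfolding places_def F_simps by auto
  have "pv.ord * (- weight q l t) = 1" using val[OF t(1,2)] t(3) by simp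
  then have "pv.ord dvd 1" by (metis dvd_triv_left)
  then have one: "pv.ord = 1" using pv.ord(1) by simp
  show "v = P_inf"
  proof (rule extensionalityI[of _ "carrier F - {0}"])
    show "v \<in> extensional (carrier F - {0})" using v unfolding places_def F_simps by auto
    show "P_inf \<in> extensional (carrier F - {0})" by (simp add: P_inf_def)
    show "v h = P_inf h" if "h \<in> carrier F - {0}" for h
      using that val[of h] one by (simp add: P_inf_def F_simps)
  qed
qed

lemma P_inf_gen_x: "P_inf gen_x < 0"
proof -
  have x: "gen_x \<noteq> (0 :: 'a poly fract poly)" "degree (gen_x :: 'a poly fract poly) < q"
    using q_gt_1 by (simp_all add: gen_x_def)
  then have "P_inf gen_x = fls_subdegree (inf.\<Phi> gen_x)" by (simp add: P_inf_eq place_of_def F_simps)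
  then show ?thesis using subdegree_x_inf q_gt_1 by (simp add: inf.\<Phi>_gen_x)
qed

lemma place_at_infinity_eq: "place_at_infinity (curve_poly q l) = P_inf"
  unfolding place_at_infinity_def coord_simps[OF q_gt_1]
proof (rule the_equality)
  show "P_inf \<in> places F constants \<and> (gen_x \<noteq> 0 \<and> P_inf gen_x < 0 \<or> gen_y \<noteq> 0 \<and> P_inf gen_y < 0)"
    using P_inf_place P_inf_gen_x by (auto simp: gen_x_def)
next
  fix v :: "'a poly fract poly \<Rightarrow> int"
  assume "v \<in> places F constants \<and> (gen_x \<noteq> 0 \<and> v gen_x < 0 \<or> gen_y \<noteq> 0 \<and> v gen_y < 0)"
  then show "v = P_inf" using place_with_pole_eq_P_inf by blast
qed

end

section \<open>The affine places\<close>

lemma CHAR_fps: "CHAR('b::comm_ring_1 fps) = CHAR('b)"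
proof (rule CHAR_eqI)
  show "of_nat CHAR('b) = (0 :: 'b fps)" by (simp flip: fps_of_nat)
  show "CHAR('b) dvd n" if "of_nat n = (0 :: 'b fps)" for n
  proof -
    have "fps_const (of_nat n :: 'b) = 0" using that by (simp add: fps_of_nat)
    then have "(of_nat n :: 'b) = 0" by simp
    then show ?thesis by (simp only: of_nat_eq_0_iff_char_dvd)
  qed
qed

text \<open>
  Over an algebraically closed field the polynomial splits into linear factors with constant roots.
\<close>

lemma root_of_constant_poly:
  fixes z :: "'b::alg_closed_field fls"
  assumes "poly (map_poly fls_const P) z = 0" "P \<noteq> 0"
  shows "z \<in> range fls_const"
  using assms
proof (induction "degree P" arbitrary: P)
  case 0
  then obtain c where "P = [:c:]" by (metis degree_eq_zeroE)
  then show ?case using 0 by simp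
next
  case (Suc n)
  interpret comm_ring_hom "fls_const :: 'b \<Rightarrow> 'b fls" by (rule comm_ring_hom_fls_const)
  interpret mp: map_poly_comm_ring_hom "fls_const :: 'b \<Rightarrow> 'b fls" ..
  obtain a where a: "poly P a = 0" using alg_closed_imp_poly_has_root[of P] Suc by auto
  then obtain R where R: "P = [:- a, 1:] * R" using poly_eq_0_iff_dvd by blast
  have R0: "R \<noteq> 0" using R Suc by auto
  have "degree R = n" using R R0 Suc(2) by (simp add: degree_mult_eq del: mult_pCons_left)
  have "map_poly fls_const [:- a, 1:] = [:- fls_const a, 1:]" by (simp add: map_poly_pCons)
  then have "poly (map_poly fls_const P) z = (z - fls_const a) * poly (map_poly fls_const R) z"
    by (simp only: R mp.hom_mult poly_mult) simp
  then have "z = fls_const a \<or> poly (map_poly fls_const R) z = 0" using Suc by simp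
  then show ?case using Suc(1)[of R] \<open>degree R = n\<close> R0 by auto
qed

text \<open>
  As for roots, by the compositional inverse of \<open>X^q - X\<close>, which has linear coefficient
  \<open>-1\<close>.
\<close>

lemma fps_artin_schreier:
  fixes u :: "'b::field fps"
  assumes "fps_nth u 0 = 0" "q > 1"
  shows "\<exists>s. s ^ q - s = u \<and> fps_nth s 0 = 0"
proof -
  define \<phi> where "\<phi> = (fps_X :: 'b fps) ^ q - fps_X"
  have 0: "fps_nth \<phi> 0 = 0" and 1: "fps_nth \<phi> 1 \<noteq> 0"
    using assms(2) by (simp_all add: \<phi>_def fps_X_power_nth)
  define s where "s = fps_inv \<phi> oo u"
  have inv0: "fps_nth (fps_inv \<phi>) 0 = 0" by (simp add: fps_inv_def)
  have s0: "fps_nth s 0 = 0" by (simp add: s_def inv0)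
  have "\<phi> oo s = (\<phi> oo fps_inv \<phi>) oo u"
    unfolding s_def by (rule fps_compose_assoc) (simp_all add: assms inv0)
  also have "\<dots> = u" by (simp add: fps_inv_right[OF 0 1] assms)
  finally have "\<phi> oo s = u" .
  moreover have "\<phi> oo s = s ^ q - s"
    by (simp add: \<phi>_def fps_compose_sub_distrib s0 flip: fps_compose_power[OF s0])
  ultimately have "s ^ q - s = u" by simp
  then show ?thesis using s0 by blast
qed

text \<open>
  Only the constant coefficient of \<open>B\<close> contributes to the coefficient of lowest possible
  order.
\<close>

lemma fls_nth_mult_fps:
  fixes A :: "'b::field fls"
  assumes "A = 0 \<or> k \<le> fls_subdegree A"
  shows "fls_nth (A * fps_to_fls B) k = fls_nth A k * fps_nth B 0"
proof -
  have "B = fps_const (fps_nth B 0) + fps_X * fps_shift 1 B"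
    by (rule fps_ext) (auto simp: fps_X_mult_nth split: nat.split)
  then have "A * fps_to_fls B = A * fps_to_fls (fps_const (fps_nth B 0) + fps_X * fps_shift 1 B)" by simp
  also have "\<dots> = fls_const (fps_nth B 0) * A + fls_X * (A * fps_to_fls (fps_shift 1 B))"
    by (simp add: fls_times_fps_to_fls algebra_simps)
  finally have eq: "A * fps_to_fls B = fls_const (fps_nth B 0) * A + fls_X * (A * fps_to_fls (fps_shift 1 B))" .
  define C where "C = A * fps_to_fls (fps_shift 1 B)"
  have "fls_nth C (k - 1) = 0"
  proof (cases "C = 0")
    case False
    then have "fls_subdegree A + fls_subdegree (fps_to_fls (fps_shift 1 B)) \<le> fls_subdegree C"
      unfolding C_def by (intro fls_mult_subdegree_ge)
    moreover have "0 \<le> fls_subdegree (fps_to_fls (fps_shift 1 B))"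
      by (rule fls_subdegree_fls_to_fps_gt0)
    ultimately have "k \<le> fls_subdegree C" using assms False by (auto simp: C_def)
    then show ?thesis by simp
  qed simp
  then show ?thesis
    unfolding eq C_def [symmetric] by (simp add: fls_X_times_conv_shift mult.commute)
qed

context curve
begin

lemma prime_CHAR_closure: "prime CHAR('a alg_closure)" "q = CHAR('a alg_closure) ^ r"
    "CARD('a) = CHAR('a alg_closure) ^ (2 * r)"
  using prime_p by (simp_all add: CHAR_eq q_def CARD power_mult [symmetric] mult.commute)

lemma to_ac_power_CARD: "to_ac c ^ CARD('a) ^ s = to_ac (c :: 'a)"
proof (induction s)
  case (Suc s)
  have "to_ac c ^ CARD('a) = to_ac c" using finite_field_power_card[of c] by (metis to_ac_power)
  then show ?case by (simp add: power_mult Suc)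
qed simp

text \<open>
  The conjugates \<open>x^(Q^i)\<close> are all roots of one polynomial over the finite field, so two of
  them agree. As raising to the power \<open>Q\<close> is injective, \<open>x\<close> itself recurs.
\<close>

lemma closure_power_CARD:
  fixes x :: "'a alg_closure"
  obtains s where "s > 0" "x ^ (CARD('a) ^ s) = x"
proof -
  let ?Q = "CARD('a)"
  have Q: "?Q ^ s = CHAR('a alg_closure) ^ (2 * r * s)" for s
    by (simp only: prime_CHAR_closure(3) power_mult)
  have frob: "(\<Sum>i\<in>A. t i) ^ (?Q ^ s) = (\<Sum>i\<in>A. t i ^ (?Q ^ s))"
    for t :: "nat \<Rightarrow> 'a alg_closure" and A s
    by (rule freshmans_dream_sum'[OF prime_CHAR_closure(1) Q])
  obtain P :: "'a poly" where P: "P \<noteq> 0" "poly (map_poly to_ac P) x = 0" by (rule alg_closure_algebraic)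
  have root: "poly (map_poly to_ac P) (x ^ (?Q ^ s)) = 0" for s
  proof -
    have "poly (map_poly to_ac P) (x ^ (?Q ^ s)) =
        (\<Sum>i\<le>degree P. (to_ac (coeff P i) * x ^ i) ^ (?Q ^ s))"
      by (simp add: poly_altdef degree_map_poly coeff_map_poly power_mult_distrib to_ac_power_CARD
          mult.commute flip: power_mult)
    also have "\<dots> = (poly (map_poly to_ac P) x) ^ (?Q ^ s)"
      by (simp add: frob poly_altdef degree_map_poly coeff_map_poly)
    also have "\<dots> = 0" using P by simp
    finally show ?thesis .
  qed
  have "map_poly to_ac P \<noteq> 0" using P(1) by (simp add: poly_eq_iff coeff_map_poly)
  then have "finite {z. poly (map_poly to_ac P) z = 0}" by (rule poly_roots_finite)
  moreover have "range (\<lambda>s. x ^ (?Q ^ s)) \<subseteq> {z. poly (map_poly to_ac P) z = 0}" using root by auto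
  ultimately have "finite (range (\<lambda>s. x ^ (?Q ^ s)))" by (rule finite_subset[rotated])
  then have "\<not> inj (\<lambda>s. x ^ (?Q ^ s))" using finite_imageD infinite_UNIV_nat by blast
  then obtain i j where ij: "i < j" "x ^ (?Q ^ i) = x ^ (?Q ^ j)"
    unfolding inj_def by (metis linorder_neqE_nat)
  define s where "s = j - i"
  have j: "j = s + i" using ij(1) by (simp add: s_def)
  have "(x ^ (?Q ^ s) - x) ^ (?Q ^ i) = (x ^ (?Q ^ s)) ^ (?Q ^ i) - x ^ (?Q ^ i)"
    by (rule freshmans_dream_diff[OF prime_CHAR_closure(1) Q])
  also have "\<dots> = 0" using ij(2) by (simp add: j power_add flip: power_mult)
  finally have "x ^ (?Q ^ s) = x" by simp
  then show ?thesis using that[of s] ij(1) by (simp add: s_def)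
qed

end

locale affine_point = curve p r q l e K
  for p r q l e and K :: "'a::{field,finite} itself" +
  fixes x0 y0 :: "'a alg_closure"
  assumes x0_y0: "y0 ^ q - y0 = x0 ^ l"
begin

definition \<xi> :: "'a alg_closure fps" where "\<xi> = fps_const x0 + fps_X"

definition \<delta> :: "'a alg_closure fps" where
  "\<delta> = (SOME s. s ^ q - s = \<xi> ^ l - fps_const (x0 ^ l) \<and> fps_nth s 0 = 0)"

definition \<eta> :: "'a alg_closure fps" where "\<eta> = fps_const y0 + \<delta>"

lemma \<delta>: "\<delta> ^ q - \<delta> = \<xi> ^ l - fps_const (x0 ^ l)" "fps_nth \<delta> 0 = 0"
proof -
  have "fps_nth (\<xi> ^ l - fps_const (x0 ^ l)) 0 = 0" by (simp add: \<xi>_def fps_power_zeroth)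
  from someI_ex[OF fps_artin_schreier[OF this q_gt_1]]
  have "\<delta> ^ q - \<delta> = \<xi> ^ l - fps_const (x0 ^ l) \<and> fps_nth \<delta> 0 = 0" unfolding \<delta>_def .
  then show "\<delta> ^ q - \<delta> = \<xi> ^ l - fps_const (x0 ^ l)" "fps_nth \<delta> 0 = 0" by blast+
qed

lemma \<eta>_0: "fps_nth \<eta> 0 = y0" by (simp add: \<eta>_def \<delta>)

lemma \<xi>_0: "fps_nth \<xi> 0 = x0" by (simp add: \<xi>_def)

lemma prime_CHAR_series: "prime CHAR('a alg_closure fps)" "q = CHAR('a alg_closure fps) ^ r"
  using prime_CHAR_closure by (simp_all only: CHAR_fps)

lemma on_curve_series: "\<eta> ^ q - \<eta> = \<xi> ^ l"
proof -
  have "\<eta> ^ q = fps_const y0 ^ q + \<delta> ^ q"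
    unfolding \<eta>_def by (rule freshmans_dream'[OF prime_CHAR_series])
  then have "\<eta> ^ q - \<eta> = fps_const (y0 ^ q - y0) + (\<delta> ^ q - \<delta>)"
    by (simp add: \<eta>_def fps_const_power flip: fps_const_sub)
  then show ?thesis by (simp add: x0_y0 \<delta>(1))
qed

definition \<iota> :: "'a \<Rightarrow> 'a alg_closure fls" where "\<iota> c = fls_const (to_ac c)"

lemma embedding_affine: "curve_embedding q l \<iota> (fps_to_fls \<xi>) (fps_to_fls \<eta>)"
proof (rule curve_embedding.intro)
  show "comm_ring_hom \<iota>" by standard (simp_all add: \<iota>_def fls_plus_const)
  show "poly (map_poly \<iota> P) (fps_to_fls \<xi>) \<noteq> 0" if "P \<noteq> 0" for P
  proof
    assume "poly (map_poly \<iota> P) (fps_to_fls \<xi>) = 0"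
    moreover have "map_poly \<iota> P = map_poly fls_const (map_poly to_ac P)"
      by (simp add: map_poly_map_poly o_def \<iota>_def [abs_def])
    moreover have "map_poly to_ac P \<noteq> 0" using that by (simp add: poly_eq_iff coeff_map_poly)
    ultimately have "fps_to_fls \<xi> \<in> range fls_const" using root_of_constant_poly by metis
    then obtain c where "fps_to_fls \<xi> = fps_to_fls (fps_const c)" by auto
    then have "\<xi> = fps_const c" by (simp only: fps_to_fls_eq_iff)
    then have "fps_nth \<xi> 1 = fps_nth (fps_const c) 1" by simp
    then show False by (simp add: \<xi>_def)
  qed
  show "fps_to_fls \<eta> ^ q - fps_to_fls \<eta> = fps_to_fls \<xi> ^ l"
    using on_curve_series by (metis fps_to_fls_minus fps_to_fls_power)
qed

sublocale aff: curve_embedding q l \<iota> "fps_to_fls \<xi>" "fps_to_fls \<eta>" by (rule embedding_affine)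

text \<open>
  A nonzero element of the kernel of least degree divides the equation of the curve. By irreducibility
  it would be a constant, but nonzero constants are not in the kernel.
\<close>

lemma \<Phi>_affine_nonzero:
  assumes "h \<noteq> 0" "degree h < q"
  shows "aff.\<Phi> h \<noteq> 0"
proof
  assume "aff.\<Phi> h = 0"
  let ?P = "\<lambda>k. k \<noteq> 0 \<and> aff.\<Phi> k = 0"
  obtain k where k: "?P k" and min: "\<And>k'. ?P k' \<Longrightarrow> degree k \<le> degree k'"
    using ex_has_least_nat[of ?P h degree] assms(1) \<open>aff.\<Phi> h = 0\<close> by blast
  have dk: "degree k < q" using min[of h] assms \<open>aff.\<Phi> h = 0\<close> by simp
  have "aff.\<Phi> (f0 mod k) = 0"
  proof -
    have "0 = aff.\<Phi> (k * (f0 div k) + f0 mod k)" by (simp only: mult_div_mod_eq aff.\<Phi>_curve)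
    also have "\<dots> = aff.\<Phi> (f0 mod k)"
      by (simp only: aff.\<Phi>.hom_add aff.\<Phi>.hom_mult conjunct2[OF k] mult_zero_left add_0_left)
    finally show ?thesis ..
  qed
  have "f0 mod k = 0"
  proof (rule ccontr)
    assume nz: "f0 mod k \<noteq> 0"
    then have "degree (f0 mod k) < degree k"
      using degree_mod_less[of k f0] k by auto
    then show False using min[of "f0 mod k"] nz \<open>aff.\<Phi> (f0 mod k) = 0\<close> by simp
  qed
  then obtain u where u: "f0 = k * u" by (metis mod_0_imp_dvd dvdE)
  have u0: "u \<noteq> 0" using u f0_nonzero by auto
  have "inf.\<Phi> k * inf.\<Phi> u = inf.\<Phi> f0" unfolding u by (rule inf.\<Phi>.hom_mult [symmetric])
  then have "inf.\<Phi> u = 0" using \<Phi>_inf_nonzero[of k] k dk inf.\<Phi>_curve by simp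
  then have "q \<le> degree u" using \<Phi>_inf_nonzero[OF u0] by force
  moreover have "degree k + degree u = q"
    using degree_curve_fract[OF q_gt_1, of l, where 'a='a] u k u0 by (simp add: degree_mult_eq)
  ultimately have "degree k = 0" by simp
  then obtain c where "k = [:c:]" by (metis degree_eq_zeroE)
  then show False using k aff.\<theta>_nonzero[of c] by (simp add: aff.\<Phi>_const)
qed

definition P_aff :: "'a poly fract poly \<Rightarrow> int" where "P_aff = place_of aff.\<Phi>"

lemma P_aff_eq: "h \<noteq> 0 \<Longrightarrow> degree h < q \<Longrightarrow> P_aff h = fls_subdegree (aff.\<Phi> h)"
  by (simp add: P_aff_def place_of_def F_simps)

lemma P_aff_place: "P_aff \<in> places F constants"
proof -
  obtain s where s: "s > 0" "x0 ^ (CARD('a) ^ s) = x0" by (rule closure_power_CARD)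
  let ?n = "CARD('a) ^ s"
  have Q1: "CARD('a) > 1" using card_mono[of UNIV "{0::'a, 1}"] by simp
  then have n1: "?n > 1" using s(1) by (metis one_less_power)
  have nC: "?n = CHAR('a alg_closure fps) ^ (2 * r * s)"
    by (simp only: CHAR_fps prime_CHAR_closure(3) power_mult)
  \<comment> \<open>with \<open>x = x\<^sub>0 + t\<close> the expansion is \<open>x\<^sub>0^n + t^n - x\<^sub>0 - t = t^n - t\<close>\<close>
  define t :: "'a poly fract poly" where "t = gen_x ^ ?n - gen_x"
  have "aff.\<Phi> t = fps_to_fls (\<xi> ^ ?n - \<xi>)"
    by (simp add: t_def aff.\<Phi>.hom_minus aff.\<Phi>.hom_power aff.\<Phi>_gen_x fps_to_fls_minus fps_to_fls_power)
  also have "\<xi> ^ ?n = fps_const x0 ^ ?n + fps_X ^ ?n"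
    unfolding \<xi>_def by (rule freshmans_dream'[OF prime_CHAR_series(1) nC])
  then have "\<xi> ^ ?n - \<xi> = fps_X ^ ?n - fps_X"
    by (simp add: fps_const_power s(2)) (simp add: \<xi>_def)
  finally have \<Phi>t: "aff.\<Phi> t = fps_to_fls (fps_X ^ ?n - fps_X)" .
  have "subdegree (fps_X ^ ?n - fps_X :: 'a alg_closure fps) = 1"
    using n1 by (intro subdegreeI) (auto simp: fps_X_power_nth)
  then have sub: "fls_subdegree (aff.\<Phi> t) = 1" by (simp only: \<Phi>t fls_subdegree_fls_to_fps of_nat_1)
  have "t = [:to_fract [:0, 1:] ^ ?n - to_fract [:0, 1:]:]"
    by (simp add: t_def gen_x_def poly_const_pow)
  then have "degree t < q" using q_gt_1 by simp
  moreover have "t \<noteq> 0" using sub by auto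
  ultimately show ?thesis
    unfolding P_aff_def using sub
    by (intro place_ofI embedding_affine \<Phi>_affine_nonzero) (simp_all add: \<iota>_def)
qed

lemma P_aff_neq_P_inf: "P_aff \<noteq> P_inf"
proof -
  have x: "gen_x \<noteq> (0 :: 'a poly fract poly)" "degree (gen_x :: 'a poly fract poly) < q"
    using q_gt_1 by (simp_all add: gen_x_def)
  then have "P_aff gen_x = fls_subdegree (fps_to_fls \<xi>)" by (simp add: P_aff_eq aff.\<Phi>_gen_x)
  then have "P_aff gen_x \<ge> 0" by (simp only: fls_subdegree_fls_to_fps_gt0)
  then show ?thesis using P_inf_gen_x by auto
qed

lemma ev_affine: "\<exists>s. aff.ev a = fps_to_fls s \<and> fps_nth s 0 = poly (map_poly to_ac a) x0"
proof (induction a)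
  case 0
  show ?case by (intro exI[of _ 0]) (simp add: aff.ev_simps)
next
  case (pCons c a)
  then obtain s where s: "aff.ev a = fps_to_fls s" "fps_nth s 0 = poly (map_poly to_ac a) x0" by blast
  have "pCons c a = [:c:] + [:0, 1:] * a" by simp
  then have "aff.ev (pCons c a) = fps_to_fls (fps_const (to_ac c) + \<xi> * s)"
    by (simp only: aff.ev_simps s) (simp add: \<iota>_def fls_times_fps_to_fls fps_to_fls_plus)
  moreover have "fps_nth (fps_const (to_ac c) + \<xi> * s) 0 = poly (map_poly to_ac (pCons c a)) x0"
    using s(2) by (cases "c = 0"; cases "a = 0") (simp_all add: map_poly_pCons \<xi>_0)
  ultimately show ?case by blast
qed

text \<open>
  As \<open>y\<close> is a power series with constant coefficient \<open>y\<^sub>0\<close>,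
  multiplication by \<open>y^j\<close> acts on the coefficient of least possible order as multiplication
  by \<open>y\<^sub>0^j\<close>.
\<close>

lemma fls_nth_\<Phi>_affine:
  assumes "\<And>j. aff.\<theta> (coeff h j) = 0 \<or> k \<le> fls_subdegree (aff.\<theta> (coeff h j))"
  shows "fls_nth (aff.\<Phi> h) k = (\<Sum>j\<le>degree h. fls_nth (aff.\<theta> (coeff h j)) k * y0 ^ j)"
proof -
  have "fls_nth (aff.\<theta> (coeff h j) * fps_to_fls \<eta> ^ j) k = fls_nth (aff.\<theta> (coeff h j)) k * y0 ^ j" for j
  proof -
    have "fls_nth (aff.\<theta> (coeff h j) * fps_to_fls (\<eta> ^ j)) k = fls_nth (aff.\<theta> (coeff h j)) k * fps_nth (\<eta> ^ j) 0"
      by (rule fls_nth_mult_fps[OF assms])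
    then show ?thesis by (simp add: fps_to_fls_power fps_power_zeroth \<eta>_0)
  qed
  then show ?thesis by (simp add: aff.\<Phi>_sum fls_nth_sum)
qed

end

section \<open>Poles on the affine curve\<close>

text \<open>
  For a fraction in lowest terms, a root of the denominator is not one of the numerator: otherwise both
  would be divisible by the minimal polynomial of the root.
\<close>

lemma fract_reduced:
  fixes s :: "'a::field poly fract"
  assumes "s \<notin> range to_fract"
  obtains a b x where "b \<noteq> 0" "s = to_fract a / to_fract b"
    "poly (map_poly to_ac b) x = 0" "poly (map_poly to_ac a) x \<noteq> 0"
proof -
  interpret to_ac: comm_ring_hom "to_ac :: 'a \<Rightarrow> 'a alg_closure" by standard simp_all
  interpret mp: map_poly_comm_ring_hom "to_ac :: 'a \<Rightarrow> 'a alg_closure" ..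
  let ?P = "\<lambda>(a, b). b \<noteq> 0 \<and> s = to_fract a / to_fract b"
  obtain a0 b0 where ab0: "b0 \<noteq> 0" "s = to_fract a0 / to_fract b0" by (rule fract_cases)
  then have "?P (a0, b0)" by simp
  from ex_has_least_nat[of ?P "(a0, b0)" "\<lambda>t. degree (snd t)", OF this]
  obtain t where t: "?P t" "\<forall>t'. ?P t' \<longrightarrow> degree (snd t) \<le> degree (snd t')" by blast
  define a where "a = fst t"
  define b where "b = snd t"
  have ab: "b \<noteq> 0" "s = to_fract a / to_fract b" using t(1) by (simp_all add: a_def b_def split_beta)
  have min: "degree b \<le> degree b'" if "b' \<noteq> 0" "s = to_fract a' / to_fract b'" for a' b'
    using t(2) that by (auto simp: b_def split_beta)
  have "degree b \<noteq> 0"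
  proof
    assume "degree b = 0"
    then obtain c where c: "b = [:c:]" by (metis degree_eq_zeroE)
    then have "c \<noteq> 0" using ab(1) by auto
    then have "a = b * smult (inverse c) a" by (simp add: c)
    then have "to_fract a = to_fract b * to_fract (smult (inverse c) a)" by (metis to_fract_mult)
    then have "s = to_fract (smult (inverse c) a)" using ab by simp
    then show False using assms by blast
  qed
  then have "degree (map_poly to_ac b) > 0" by (simp add: degree_map_poly)
  then obtain x where x: "poly (map_poly to_ac b) x = 0" using alg_closed_imp_poly_has_root by blast
  have "poly (map_poly to_ac a) x \<noteq> 0"
  proof
    assume ax: "poly (map_poly to_ac a) x = 0"
    let ?R = "\<lambda>d. d \<noteq> 0 \<and> poly (map_poly to_ac d) x = 0"
    have "?R b" using ab x by simp
    from ex_has_least_nat[of ?R b degree, OF this]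
    obtain d where d: "?R d" "\<And>d'. ?R d' \<Longrightarrow> degree d \<le> degree d'" by blast
    have dvd: "d dvd g" if "poly (map_poly to_ac g) x = 0" for g
    proof -
      have "map_poly to_ac g = map_poly to_ac (d * (g div d) + g mod d)" by simp
      then have "poly (map_poly to_ac g) x =
          poly (map_poly to_ac d) x * poly (map_poly to_ac (g div d)) x + poly (map_poly to_ac (g mod d)) x"
        by (simp only: mp.hom_add mp.hom_mult poly_add poly_mult)
      then have "poly (map_poly to_ac (g mod d)) x = 0" using d that by simp
      then have "g mod d = 0" using d(2)[of "g mod d"] degree_mod_less[of d g] d(1) by force
      then show ?thesis by (simp only: mod_eq_0_iff_dvd)
    qed
    obtain a' where a': "a = d * a'" using dvd[OF ax] by blast
    obtain b' where b': "b = d * b'" using dvd[OF x] by blast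
    have "b' \<noteq> 0" using ab b' by auto
    moreover have "s = to_fract a' / to_fract b'" using ab d by (simp add: a' b')
    ultimately have "degree b \<le> degree b'" by (rule min)
    moreover have "degree b = degree d + degree b'"
      using d \<open>b' \<noteq> 0\<close> unfolding b' by (intro degree_mult_eq) auto
    ultimately have "degree d = 0" by simp
    then obtain c where "d = [:c:]" by (metis degree_eq_zeroE)
    then show False using d by (auto simp: map_poly_pCons)
  qed
  then show ?thesis using that ab x by blast
qed

context curve
begin

text \<open>
  The \<open>q\<close> points over \<open>x\<^sub>0\<close> differ by elements of the subfield with
  \<open>q\<close> elements; \<open>P\<close> has too few roots to vanish at all of them.
\<close>

lemma points_over:
  fixes x0 :: "'a alg_closure" and P :: "'a alg_closure poly"
  assumes "P \<noteq> 0" "degree P < q"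
  obtains y0 where "y0 ^ q - y0 = x0 ^ l" "poly P y0 \<noteq> 0"
proof -
  define A where "A = monom (1::'a alg_closure) q - monom 1 1 - [:x0 ^ l:]"
  have "degree (monom (1::'a alg_closure) q - monom 1 1) = q"
    using q_gt_1 by (subst degree_diff_eq_left) (auto simp: degree_monom_eq)
  then have "degree A = q"
    unfolding A_def using q_gt_1 by (subst degree_diff_eq_left) auto
  then obtain b where "poly A b = 0" using alg_closed_imp_poly_has_root[of A] q_pos by auto
  then have b: "b ^ q - b = x0 ^ l" by (simp add: A_def poly_monom)
  let ?R = "(\<lambda>c. b + to_ac c) ` Fq"
  have "card ?R = q" by (subst card_image) (auto simp: inj_on_def card_Fq)
  moreover have "card {y. poly P y = 0} < q" using card_poly_roots_bound[OF assms(1)] assms(2) by linarith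
  ultimately have "\<not> ?R \<subseteq> {y. poly P y = 0}"
    using card_mono[OF poly_roots_finite[OF assms(1)], of ?R] by linarith
  then obtain c where c: "c \<in> Fq" "poly P (b + to_ac c) \<noteq> 0" by auto
  have "(b + to_ac c) ^ q = b ^ q + to_ac c ^ q"
    by (rule freshmans_dream'[OF prime_CHAR_closure(1,2)])
  moreover have "to_ac c ^ q = to_ac c" using c(1) by (simp add: Fq_def flip: to_ac_power)
  ultimately have "(b + to_ac c) ^ q - (b + to_ac c) = x0 ^ l" using b by simp
  then show ?thesis using that c(2) by blast
qed

text \<open>
  Choose \<open>x\<^sub>0\<close> as a pole of a coefficient, and let \<open>k < 0\<close> be the least
  order at \<open>x\<^sub>0\<close> among all coefficients. At a suitable point over
  \<open>x\<^sub>0\<close> the coefficient of \<open>h\<close> at \<open>t^k\<close> does not vanish.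
\<close>

lemma affine_pole:
  assumes h: "degree h < q" and np: "coeff h j0 \<notin> range to_fract"
  shows "\<exists>v \<in> places F constants. v \<noteq> P_inf \<and> v h < 0"
proof -
  have h0: "h \<noteq> 0" using np by (metis coeff_0 rangeI to_fract_0)
  obtain a b x0 where ab: "b \<noteq> 0" "coeff h j0 = to_fract a / to_fract b"
    and x0: "poly (map_poly to_ac b) x0 = 0" "poly (map_poly to_ac a) x0 \<noteq> 0"
    using fract_reduced[OF np] by blast
  have ap: "affine_point p r q l e x0 y0" if "y0 ^ q - y0 = x0 ^ l" for y0
    using that curve_axioms by (simp add: affine_point_def affine_point_axioms_def)
  obtain y1 where "y1 ^ q - y1 = x0 ^ l" by (rule points_over[of 1 x0]) (use q_pos in auto)
  then interpret A1: affine_point p r q l e K x0 y1 by (rule ap)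
  let ?\<theta> = "\<lambda>j. A1.aff.\<theta> (coeff h j)"
  let ?J = "{j. coeff h j \<noteq> 0}"
  have finJ: "finite ?J" by (rule finite_subset[of _ "{..degree h}"]) (auto intro: le_degree)
  have j0: "j0 \<in> ?J" using np rangeI[of to_fract "0 :: 'a poly"] by auto
  have neg: "fls_subdegree (?\<theta> j0) < 0"
  proof -
    obtain sa where sa: "A1.aff.ev a = fps_to_fls sa" "fps_nth sa 0 \<noteq> 0" using A1.ev_affine[of a] x0 by metis
    obtain sb where sb: "A1.aff.ev b = fps_to_fls sb" "fps_nth sb 0 = 0" using A1.ev_affine[of b] x0 by metis
    have b0: "A1.aff.ev b \<noteq> 0" using ab(1) by (simp add: A1.aff.ev_simps)
    have "sb \<noteq> 0" using b0 sb(1) by auto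
    then have "subdegree sb > 0" using sb(2) by (metis gr0I nth_subdegree_nonzero)
    moreover have "subdegree sa = 0" using sa(2) by simp
    moreover have "?\<theta> j0 * A1.aff.ev b = A1.aff.ev a" using A1.aff.\<theta>_eq[OF ab] b0 by simp
    then have "fls_subdegree (?\<theta> j0) + fls_subdegree (A1.aff.ev b) = fls_subdegree (A1.aff.ev a)"
      using fls_subdegree_mult[of "?\<theta> j0" "A1.aff.ev b"] A1.aff.\<theta>_nonzero[of "coeff h j0"] j0 b0 by simp
    ultimately show ?thesis by (simp add: sa sb fls_subdegree_fls_to_fps)
  qed
  define k where "k = Min ((\<lambda>j. fls_subdegree (?\<theta> j)) ` ?J)"
  have k_le: "k \<le> fls_subdegree (?\<theta> j)" if "j \<in> ?J" for j
    unfolding k_def using finJ that by (intro Min_le) auto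
  have "k \<in> (\<lambda>j. fls_subdegree (?\<theta> j)) ` ?J" unfolding k_def using finJ j0 by (intro Min_in) auto
  then obtain j1 where j1: "j1 \<in> ?J" "k = fls_subdegree (?\<theta> j1)" by blast
  have k0: "k < 0" using k_le[OF j0] neg by simp
  \<comment> \<open>the order \<open>k\<close> coefficients of the \<open>r\<^sub>j\<close>, not all \<open>0\<close> by the choice of \<open>k\<close>\<close>
  define P where "P = (\<Sum>j\<le>degree h. monom (fls_nth (?\<theta> j) k) j)"
  have "coeff P j1 = fls_nth (?\<theta> j1) k"
  proof -
    have "j1 \<le> degree h" using j1(1) le_degree by blast
    then show ?thesis by (simp add: P_def coeff_sum)
  qed
  moreover have "?\<theta> j1 \<noteq> 0" using A1.aff.\<theta>_nonzero j1(1) by blast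
  ultimately have "P \<noteq> 0" using j1(2) by (metis coeff_0 nth_fls_subdegree_nonzero)
  have "degree P \<le> degree h"
    unfolding P_def by (intro degree_sum_le) (auto intro: order.trans[OF degree_monom_le])
  then have "degree P < q" using h by simp
  then obtain y0 where y0: "y0 ^ q - y0 = x0 ^ l" "poly P y0 \<noteq> 0" by (rule points_over[OF \<open>P \<noteq> 0\<close>])
  interpret A2: affine_point p r q l e K x0 y0 by (rule ap[OF y0(1)])
  have "fls_nth (A2.aff.\<Phi> h) k = (\<Sum>j\<le>degree h. fls_nth (?\<theta> j) k * y0 ^ j)"
  proof (rule A2.fls_nth_\<Phi>_affine)
    show "?\<theta> j = 0 \<or> k \<le> fls_subdegree (?\<theta> j)" for j
      using k_le[of j] by (cases "coeff h j = 0") simp_all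
  qed
  also have "\<dots> = poly P y0" by (simp add: P_def poly_sum poly_monom)
  finally have "fls_nth (A2.aff.\<Phi> h) k \<noteq> 0" using y0(2) by simp
  then have "fls_subdegree (A2.aff.\<Phi> h) \<le> k" by (rule fls_subdegree_leI)
  then have "A2.P_aff h < 0" using A2.P_aff_eq[OF h0 h] k0 by simp
  then show ?thesis using A2.P_aff_place A2.P_aff_neq_P_inf by blast
qed

end

section \<open>The Riemann-Roch spaces and the one-point codes\<close>

lemma fdeg_to_fract: "a \<noteq> 0 \<Longrightarrow> fdeg (to_fract a) = int (degree a)"
  using fdeg_eq[of 1 a "to_fract a"] by simp

lemma weight_le_iff:
  assumes "h \<noteq> 0"
  shows "weight q l h \<le> m \<longleftrightarrow> (\<forall>j. coeff h j \<noteq> 0 \<longrightarrow> int q * fdeg (coeff h j) + int l * int j \<le> m)"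
proof -
  have "finite {j. coeff h j \<noteq> 0}"
    by (rule finite_subset[of _ "{..degree h}"]) (auto intro: le_degree)
  moreover have "{j. coeff h j \<noteq> 0} \<noteq> {}" using assms by (auto simp: poly_eq_iff)
  ultimately show ?thesis by (simp add: weight_def)
qed

lemma fract_poly_pCons: "fract_poly (pCons a g) = [:to_fract a:] + gen_y * fract_poly g"
  by (cases "a = 0"; cases "g = 0") (simp_all add: gen_y_def map_poly_pCons)

lemma to_fract_pCons: "[:to_fract (pCons c a):] = [:to_fract [:c:]:] + gen_x * [:to_fract a:]"
proof -
  have "pCons c a = [:c:] + [:0, 1:] * a" by simp
  then have "to_fract (pCons c a) = to_fract [:c:] + to_fract [:0, 1:] * to_fract a"
    by (metis to_fract_add to_fract_mult)
  then show ?thesis by (simp add: gen_x_def)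
qed

lemma eval2_pCons: "eval2 (pCons a g) (x, y) = poly a x + y * eval2 g (x, y)"
  by (simp add: eval2_def)

text \<open>
  This transfers equations on the curve to equations between values at rational points.
\<close>

lemma (in affine_point) \<Phi>_fract_poly:
  assumes "x0 = to_ac x" "y0 = to_ac y"
  shows "\<exists>s. aff.\<Phi> (fract_poly g) = fps_to_fls s \<and> fps_nth s 0 = to_ac (eval2 g (x, y))"
proof (induction g)
  case 0
  show ?case by (intro exI[of _ 0]) (simp add: eval2_def)
next
  case (pCons a g)
  then obtain s where s: "aff.\<Phi> (fract_poly g) = fps_to_fls s" "fps_nth s 0 = to_ac (eval2 g (x, y))" by blast
  obtain t where t: "aff.ev a = fps_to_fls t" "fps_nth t 0 = poly (map_poly to_ac a) x0" using ev_affine by blast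
  interpret to_ac: comm_ring_hom "to_ac :: 'a \<Rightarrow> 'a alg_closure" by standard simp_all
  have "poly (map_poly to_ac a) x0 = to_ac (poly a x)" by (simp add: assms)
  moreover have "aff.\<Phi> (fract_poly (pCons a g)) = fps_to_fls (t + \<eta> * s)"
    by (simp only: fract_poly_pCons aff.\<Phi>.hom_add aff.\<Phi>.hom_mult aff.\<Phi>_const aff.\<theta>_to_fract aff.\<Phi>_gen_y s t
        fps_to_fls_plus fls_times_fps_to_fls)
  moreover have "fps_nth \<eta> 0 = to_ac y" using \<eta>_0 assms(2) by (rule trans)
  ultimately show ?case
    using s t by (intro exI[of _ "t + \<eta> * s"]) (simp add: eval2_pCons)
qed

context curve
begin

text \<open>
  A place other than the one at infinity has no pole at \<open>x\<close> or \<open>y\<close>, hence none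
  at a polynomial in them.
\<close>

lemma regular_outside_infinity:
  assumes v: "v \<in> places F constants" and "v \<noteq> P_inf" and h: "fract_poly g \<noteq> 0" "degree (fract_poly g) < q"
  shows "0 \<le> v (fract_poly g)"
proof -
  interpret sv: semivaluation "{h. h mod f0 = 0}" "\<lambda>h. v (h mod f0)" by (rule semivaluation_of_place[OF v])
  have "gen_x mod f0 = gen_x" "gen_y mod f0 = gen_y"
    unfolding mod_curve_eq_iff[OF q_gt_1] using q_gt_1 by (simp_all add: gen_x_def gen_y_def)
  moreover have "\<not> (v gen_x < 0 \<or> v gen_y < 0)"
    using place_with_pole_eq_P_inf[OF v] assms(2) by blast
  then have "0 \<le> v gen_x" "0 \<le> v gen_y" by linarith+
  ultimately have x: "gen_x \<in> sv.integral" and y: "gen_y \<in> sv.integral" by (simp_all add: sv.integral_def)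
  have const: "[:to_fract [:c:]:] \<in> sv.integral" for c
    using place_constant[OF v, of c] by (cases "c = 0") (simp_all add: sv.integral_def)
  have poly_x: "[:to_fract a:] \<in> sv.integral" for a
  proof (induction a)
    case 0
    show ?case by (simp add: sv.integral_def)
  next
    case (pCons c a)
    then show ?case unfolding to_fract_pCons[of c a] by (intro sv.integral_add sv.integral_mult const x)
  qed
  have "fract_poly g \<in> sv.integral" for g
  proof (induction g)
    case 0
    show ?case by (simp add: sv.integral_def)
  next
    case (pCons a g)
    then show ?case
      unfolding fract_poly_pCons[of a g]
      by (intro sv.integral_add sv.integral_mult y poly_x)
  qed
  then have "fract_poly g \<in> sv.integral" .
  moreover have "fract_poly g mod f0 = fract_poly g"
    unfolding mod_curve_eq_iff[OF q_gt_1] by (rule h(2))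
  ultimately show ?thesis using h(1) unfolding sv.integral_def by auto
qed

text \<open>
  Poles at affine places exclude denominators; the pole order at infinity bounds the weights.
\<close>

theorem riemann_roch_space_eq:
  "riemann_roch_space F constants (\<lambda>v. if v = place_at_infinity (curve_poly q l) then int m else 0) =
    fract_poly ` poly_space m"
proof (intro equalityI subsetI)
  fix h assume "h \<in> riemann_roch_space F constants (\<lambda>v. if v = place_at_infinity (curve_poly q l) then int m else 0)"
  then have h: "degree h < q"
    and pos: "h \<noteq> 0 \<Longrightarrow> v \<in> places F constants \<Longrightarrow> 0 \<le> v h + (if v = P_inf then int m else 0)" for v
    by (auto simp: riemann_roch_space_def F_simps place_at_infinity_eq)
  show "h \<in> fract_poly ` poly_space m"
  proof (cases "h = 0")
    case True
    have "0 \<in> poly_space m" by (simp add: poly_space_def)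
    then show ?thesis using True by (metis fract_poly_0 image_eqI)
  next
    case False
    have coeffs: "coeff h j \<in> range to_fract" for j
    proof (rule ccontr)
      assume "coeff h j \<notin> range to_fract"
      then obtain v where "v \<in> places F constants" "v \<noteq> P_inf" "v h < 0" using affine_pole[OF h] by blast
      then show False using pos[OF False, of v] by simp
    qed
    have inj: "inj (to_fract :: 'a poly \<Rightarrow> _)" by (auto simp: inj_def)
    define g where "g = map_poly (inv_into UNIV to_fract) h"
    have "inv_into UNIV to_fract (0 :: 'a poly fract) = 0" using inv_f_f[OF inj, of 0] by simp
    then have cg: "to_fract (coeff g j) = coeff h j" for j
      using coeffs[of j] by (simp add: g_def coeff_map_poly f_inv_into_f)
    have hg: "h = fract_poly g" by (simp add: poly_eq_iff coeff_map_poly cg)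
    have "P_inf h = - weight q l h" using False h by (simp add: P_inf_def F_simps)
    then have wt: "weight q l h \<le> int m" using pos[OF False P_inf_place] by simp
    have "j < q \<and> q * degree (coeff g j) + l * j \<le> m" if nz: "coeff g j \<noteq> 0" for j
    proof -
      have nz': "coeff h j \<noteq> 0" using nz cg[of j] by (metis to_fract_eq_0_iff)
      then have "j < q" using le_degree[of h j] h by simp
      moreover have "int q * fdeg (coeff h j) + int l * int j \<le> int m"
        using wt nz' unfolding weight_le_iff[OF False] by blast
      then have "int (q * degree (coeff g j) + l * j) \<le> int m"
        using fdeg_to_fract[OF nz] cg[of j] by simp
      ultimately show ?thesis by (simp only: of_nat_le_iff)
    qed
    then have "g \<in> poly_space m" by (simp add: poly_space_def)
    then show ?thesis using hg by blast
  qed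
next
  fix h assume "h \<in> fract_poly ` poly_space m"
  then obtain g where g: "g \<in> poly_space m" "h = fract_poly g" by blast
  have ch: "coeff h j = to_fract (coeff g j)" for j by (simp add: g coeff_map_poly)
  have dh: "degree h < q"
  proof (cases "h = 0")
    case False
    then have "coeff g (degree h) \<noteq> 0" using ch[of "degree h"] by auto
    then show ?thesis using g unfolding poly_space_def by blast
  qed (use q_pos in simp)
  have "0 \<le> v h + (if v = P_inf then int m else 0)" if "h \<noteq> 0" "v \<in> places F constants" for v
  proof (cases "v = P_inf")
    case True
    have "weight q l h \<le> int m"
      unfolding weight_le_iff[OF \<open>h \<noteq> 0\<close>]
    proof (intro allI impI)
      fix j assume "coeff h j \<noteq> 0"
      then have nz: "coeff g j \<noteq> 0" by (auto simp: ch)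
      then have "int (q * degree (coeff g j) + l * j) \<le> int m"
        using g unfolding poly_space_def by (simp only: of_nat_le_iff) blast
      then show "int q * fdeg (coeff h j) + int l * int j \<le> int m"
        by (simp add: ch fdeg_to_fract[OF nz])
    qed
    then show ?thesis using True that dh by (simp add: P_inf_def F_simps)
  next
    case False
    then show ?thesis using regular_outside_infinity[OF that(2) False, of g] that(1) dh by (simp add: g)
  qed
  then show "h \<in> riemann_roch_space F constants (\<lambda>v. if v = place_at_infinity (curve_poly q l) then int m else 0)"
    using dh unfolding riemann_roch_space_def place_at_infinity_eq by (simp only: F_simps mem_Collect_eq) blast
qed

text \<open>
  That the value does not depend on the representation \<open>a / b\<close> follows from the power
  series expansion at the point: a multiple of the equation of the curve has expansion \<open>0\<close>.
\<close>

lemma value_at_eq: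
  assumes P: "P \<in> D"
  shows "value_at (curve_poly q l) (fract_poly g) P = eval2 g P"
  unfolding value_at_def
proof (rule the_equality)
  show "\<exists>a b. eval2 b P \<noteq> 0 \<and> f0 dvd fract_poly b * fract_poly g - fract_poly a \<and>
      eval2 g P = eval2 a P / eval2 b P"
  proof (intro exI conjI)
    show "eval2 1 P \<noteq> 0" by (simp add: eval2_def split_beta)
    show "f0 dvd fract_poly 1 * fract_poly g - fract_poly g" by simp
    show "eval2 g P = eval2 g P / eval2 1 P" by (simp add: eval2_def split_beta)
  qed
next
  fix c assume "\<exists>a b. eval2 b P \<noteq> 0 \<and> f0 dvd fract_poly b * fract_poly g - fract_poly a \<and>
      c = eval2 a P / eval2 b P"
  then obtain a b where b: "eval2 b P \<noteq> 0" and dvd: "f0 dvd fract_poly (b * g - a)"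
    and c: "c = eval2 a P / eval2 b P" by (auto simp: fract_poly_diff)
  obtain x y where xy: "P = (x, y)" by (rule prod.exhaust)
  have "y ^ q - y = x ^ l" using D_iff[of x y] P xy by simp
  then have "to_ac y ^ q - to_ac y = to_ac x ^ l" by (metis to_ac_diff to_ac_power)
  then interpret A: affine_point p r q l e K "to_ac x" "to_ac y" by unfold_locales
  obtain s where s: "A.aff.\<Phi> (fract_poly (b * g - a)) = fps_to_fls s"
    "fps_nth s 0 = to_ac (eval2 (b * g - a) (x, y))" using A.\<Phi>_fract_poly[OF refl refl] by blast
  obtain u where u: "fract_poly (b * g - a) = f0 * u" using dvd by (rule dvdE)
  have "fps_to_fls s = 0" using s(1) unfolding u by (simp only: A.aff.\<Phi>.hom_mult A.aff.\<Phi>_curve mult_zero_left)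
  then have "eval2 (b * g - a) P = 0" using s(2) xy by simp
  then have "eval2 a P = eval2 b P * eval2 g P" by (simp add: eval2_simps)
  then show "c = eval2 g P" using b by (simp add: c)
qed

theorem one_point_code_eq:
  assumes P: "bij_betw P {..<q * (e + 1)} D"
  shows "one_point_code (curve_poly q l) (q * (e + 1)) P m = eval_code P m"
proof -
  have "vec (q * (e + 1)) (\<lambda>i. value_at (curve_poly q l) (fract_poly g) (P i)) =
      vec (q * (e + 1)) (\<lambda>i. eval2 g (P i))" for g
  proof (rule eq_vecI)
    fix i assume "i < dim_vec (vec (q * (e + 1)) (\<lambda>i. eval2 g (P i)))"
    then have i: "i < q * (e + 1)" by simp
    then have "P i \<in> D" using P unfolding bij_betw_def by blast
    then show "vec (q * (e + 1)) (\<lambda>i. value_at (curve_poly q l) (fract_poly g) (P i)) $ i =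
        vec (q * (e + 1)) (\<lambda>i. eval2 g (P i)) $ i"
      using i by (simp only: index_vec value_at_eq)
  qed simp
  then show ?thesis
    unfolding one_point_code_def eval_code_def riemann_roch_space_eq image_image by (simp only:)
qed

theorem quantum_code_parameters:
  assumes P: "bij_betw P {..<q * (e + 1)} D"
    and g: "2 * g = (q - 1) * (l - 1)" "2 * g \<le> m + 1" and m: "m < q * (e + 1)"
    and orth: "2 * (int m + 1) \<le> (int q - 1) * (int l - 1) + int q * (int e + 1) -
      (if p dvd e + 1 then 0 else int q * int e)"
  shows "2 * (m + 1 - g) \<le> q * (e + 1)"
    and "stabilizer_code (q * (e + 1)) (q * (e + 1) - 2 * (m + 1 - g)) (m + 2 - 2 * g)
      (quantum_code_of (q * (e + 1)) (one_point_code (curve_poly q l) (q * (e + 1)) P m))"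
proof -
  interpret self_orthogonal_code "q * (e + 1)" "eval_code P m"
    by (rule self_orthogonal_eval_code[OF P orth])
  have C: "CARD('a) = CHAR('a) ^ (r * 2)" by (simp only: CARD CHAR_eq q_def power_mult)
  have "card (exponents m) + g = m + 1" unfolding card_exponents by (rule card_weights_le[OF g])
  then have "card (exponents m) = m + 1 - g" by simp
  then have card: "card (eval_code P m) = CARD('a) ^ (m + 1 - g)" using card_eval_code[OF P m] by simp
  have dist: "m + 2 - 2 * g \<le> card {i. i < q * (e + 1) \<and> x $ i \<noteq> 0}"
    if "x \<in> dual_code (q * (e + 1)) (eval_code P m)" "x \<noteq> 0\<^sub>v (q * (e + 1))" for x
    using dual_eval_code_distance[OF P that] g(1) by linarith
  show "2 * (m + 1 - g) \<le> q * (e + 1)"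
    by (rule stabilizer_code_of_self_orthogonal(1)[OF C card dist])
  show "stabilizer_code (q * (e + 1)) (q * (e + 1) - 2 * (m + 1 - g)) (m + 2 - 2 * g)
      (quantum_code_of (q * (e + 1)) (one_point_code (curve_poly q l) (q * (e + 1)) P m))"
    unfolding one_point_code_eq[OF P] by (rule stabilizer_code_of_self_orthogonal(2)[OF C card dist])
qed

end

theorem theorem7p9:
  fixes p r q l e N g \<mu> m :: nat
    and f :: "'a::{field,finite} poly poly"
  assumes "prime p" and "odd p" and "r > 0" and "q = p ^ r"
    and "CARD('a) = q ^ 2"
    and "l > 0" and "gcd p l = 1" and "2 * gcd l (q + 1) dvd q + 1"
    and "e = gcd (l * (q - 1)) (q ^ 2 - 1)"
    and "N = q * (e + 1)"
    and "f = curve_poly q l"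
    and "2 * g = (q - 1) * (l - 1)"
    and "\<mu> = (if p dvd e + 1 then 0 else 1)"
    and "2 * int g - 2 < int m" and "m < N"
    and "2 * (int m + 1) \<le> (int q - 1) * (int l - 1) + int q * (int e + 1) - int \<mu> * (int q * int e)"
  shows "card (affine_points f) = N \<and>
    (\<forall>P. bij_betw P {..<N} (affine_points f) \<longrightarrow>
      (\<exists>K d (V :: 'a state set).
         int K = int N - 2 * int m + 2 * int g - 2 \<and>
         int d = int m - (int q - 1) * (int l - 1) + 2 \<and>
         stabilizer_code N K d V \<and>
         V = quantum_code_of N (one_point_code f N P m)))"
proof -
  interpret curve p r q l e "TYPE('a)" by unfold_locales (fact assms)+
  have aff: "affine_points f = D" unfolding \<open>f = _\<close> by (rule affine_points_eq)
  have "2 * int g < int m + 2" using \<open>2 * int g - 2 < int m\<close> by simp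
  then have gm: "2 * g \<le> m + 1" by linarith
  have g_int: "(int q - 1) * (int l - 1) = 2 * int g"
  proof -
    have "int (2 * g) = int (q - 1) * int (l - 1)" unfolding \<open>2 * g = _\<close> by simp
    then show ?thesis using q_pos l_pos by (simp add: of_nat_diff)
  qed
  have "int \<mu> * (int q * int e) = (if p dvd e + 1 then 0 else int q * int e)"
    using \<open>\<mu> = _\<close> by simp
  then have orth: "2 * (int m + 1) \<le> (int q - 1) * (int l - 1) + int q * (int e + 1) -
      (if p dvd e + 1 then 0 else int q * int e)"
    using assms(16) by simp
  have "\<exists>K d (V :: 'a state set).
         int K = int N - 2 * int m + 2 * int g - 2 \<and>
         int d = int m - (int q - 1) * (int l - 1) + 2 \<and>
         stabilizer_code N K d V \<and>
         V = quantum_code_of N (one_point_code f N P m)"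
    if P: "bij_betw P {..<N} (affine_points f)" for P
  proof (intro exI conjI)
    have P': "bij_betw P {..<q * (e + 1)} D" using P unfolding aff \<open>N = _\<close> .
    have m': "m < q * (e + 1)" using \<open>m < N\<close> unfolding \<open>N = _\<close> .
    note params = quantum_code_parameters[OF P' \<open>2 * g = _\<close> gm m' orth]
    show "int (N - 2 * (m + 1 - g)) = int N - 2 * int m + 2 * int g - 2"
      using params(1) gm unfolding \<open>N = _\<close> [symmetric] by (simp add: of_nat_diff)
    show "int (m + 2 - 2 * g) = int m - (int q - 1) * (int l - 1) + 2"
      unfolding g_int using gm by (simp add: of_nat_diff)
    show "stabilizer_code N (N - 2 * (m + 1 - g)) (m + 2 - 2 * g)
        (quantum_code_of N (one_point_code f N P m))"
      unfolding \<open>N = _\<close> \<open>f = _\<close> by (rule params(2))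
  qed (rule refl)
  then show ?thesis using card_D unfolding aff \<open>N = _\<close> by blast
qed

end
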